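(* Let $T$ be a forward expansive correspondence on a compact metric space $X$, let $\boldsymbol\psi\in C(\Gamma_T,\mathbb{R}^d)$, and suppose that $(T,\boldsymbol\psi)$ satisfies the $C^1$ Legendre assumptions. Let $U$ be an open neighborhood of the convex hull of $\boldsymbol\psi(\Gamma_T)$, let $F\in C^1(U)$, and set $\mathcal{E}(\gamma)=F\bigl(\int_{\Gamma_T}\boldsymbol\psi\,d\gamma\bigr)$ for $\gamma\in\mathcal{M}(\Gamma_T)$. Assume that $(T,\mathcal{E})$ has an abundance of ergodic path measures, and that the set $$V:=\operatorname*{argmax}_{\boldsymbol z\in\mathcal{R}(\boldsymbol\psi)}\{\mathfrak{h}(\boldsymbol z)+F(\boldsymbol z)\}$$ is contained in the interior of $\mathcal{R}(\boldsymbol\psi)$. Then $$\Pi_{\mathrm{top}}^{\mathcal{E}}(T)=\max_{\boldsymbol z\in\mathcal{R}(\boldsymbol\psi)}\{\mathfrak{h}(\boldsymbol z)+F(\boldsymbol z)\}.$$ Moreover, with $Y=(\nabla P)^{-1}(V)$, the set of nonlinear equilibrium pairs for $\mathcal{E}$ is exactly $$\bigcup_{\boldsymbol y\in Y}\mathsf{Eq}(T,\boldsymbol y\cdot\boldsymbol\psi),$$ and every $\boldsymbol y\in Y$ satisfies $\boldsymbol y=\nabla F(\nabla P(\boldsymbol y))$.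
   Context: For a compact metric space $Y$, $\mathcal{M}(Y)$ is the set of Borel probability measures on $Y$ with the weak-star topology. For $S:Y\to Y$ continuous, $\mathcal{M}(Y,S)$ is the set of $S$-invariant elements of $\mathcal{M}(Y)$ and $h_\nu(S)$ is Kolmogorov--Sinai entropy. Logarithms are natural. Correspondences. Let $(X,d)$ be a compact metric space. A correspondence $T$ on $X$ assigns to each $x\in X$ a nonempty closed set $T(x)\subset X$ such that $\Gamma_T=\{(x,y)\in X^2:y\in T(x)\}$ is closed in $X^2$. Set $\mathcal{O}_{n+1}(T)=\{(x_0,\dots,x_n)\in X^{n+1}:x_{j+1}\in T(x_j),\ 0\le j<n\}$ with metric $d_{n+1}(\boldsymbol{x},\boldsymbol{y})=\max_{0\le j\le n}d(x_j,y_j)$. The orbit space is $\Omega_T=\{(x_j)_{j\ge0}:x_{j+1}\in T(x_j)\ \forall j\ge 0\}$ with the product topology and shift $\sigma((x_j)_{j\geq 0})=(x_{j+1})_{j\geq 0}$. $T$ is forward expansive if there is $\varepsilon_0>0$ such that any two distinct $\boldsymbol{x},\boldsymbol{y}\in\Omega_T$ satisfy $d(x_j,y_j)>\varepsilon_0$ for some $j\ge0$. Topological pressure. Let $\mathcal{E}:\mathcal{M}(\Gamma_T)\to\mathbb{R}$ be continuous. For $\boldsymbol{x}\in\mathcal{O}_{n+1}(T)$ let $L_n(\boldsymbol{x})=\frac1n\sum_{j=0}^{n-1}\delta_{(x_j,x_{j+1})}$. A set $\mathcal{C}\subset\mathcal{O}_{n+1}(T)$ is $(n,\varepsilon)$-separated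 if $d_{n+1}(\boldsymbol{x},\boldsymbol{y})>\varepsilon$ for all distinct $\boldsymbol{x},\boldsymbol{y}\in\mathcal{C}$. Let $Z_n(T,\mathcal{E},\varepsilon)=\sup_{\mathcal{C}}\sum_{\boldsymbol{x}\in\mathcal{C}}\exp(n\mathcal{E}(L_n(\boldsymbol{x})))$ over $(n,\varepsilon)$-separated $\mathcal C$. The upper and lower pressures are $\lim_{\varepsilon\to0^+}\limsup_{n}\frac1n\log Z_n(T,\mathcal{E},\varepsilon)$ and $\lim_{\varepsilon\to0^+}\liminf_{n}\frac1n\log Z_n(T,\mathcal{E},\varepsilon)$; when they agree (as they do for forward expansive $T$ under the abundance assumption below) $\Pi_{\mathrm{top}}^{\mathcal{E}}(T)$ denotes the common value. Stationary transition pairs. $\mathcal{K}(X;T)$ is the set of Borel transition probability kernels $Q$ on $X$ with $\operatorname{supp}Q_x\subseteq T(x)$ for every $x$. $\mathcal{M}(X,Q)=\{\mu\in\mathcal{M}(X):\mu Q=\mu\}$, $(\mu Q)(A)=\int_XQ_x(A)\,d\mu(x)$. A stationary transition pair is $(\mu,Q)$ with $Q\in\mathcal{K}(X;T)$, $\mu\in\mathcal{M}(X,Q)$; its two-coordinate distribution is $\gamma_{\mu,Q}(dx,dy)=\mu(dx)Q_x(dy)$, an element of $\mathcal{M}(\Gamma_T)$. Kernels agreeing $\mu$-almost everywhere are identified. Kernel entropy. Let $\mu Q^{[n-1]}$ be the law on $X^n$ of $(x_0,\dots,x_{n-1})$ for the Markov process with initial law $\mu$ and kernel $Q$. For a finite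 Borel partition $\mathcal{A}$ of $X$ with product partition $\mathcal{A}^{\times n}$, $h_\mu(Q,\mathcal{A})=\lim_{n}\frac1nH_{\mu Q^{[n-1]}}(\mathcal{A}^{\times n})$, where $H_\lambda(\mathcal{B})=-\sum_{B\in\mathcal{B}}\lambda(B)\log\lambda(B)$, and $h_\mu(Q)=\sup_{\mathcal{A}}h_\mu(Q,\mathcal{A})$. A nonlinear equilibrium pair for $\mathcal{E}$ is a stationary transition pair maximizing $h_\mu(Q)+\mathcal{E}(\gamma_{\mu,Q})$ among all stationary transition pairs. For $\varphi\in C(\Gamma_T,\mathbb{R})$, $P(T,\varphi)$ is the (linear) topological pressure, i.e. $\Pi_{\mathrm{top}}$ for the energy $\gamma\mapsto\int\varphi\,d\gamma$; for forward expansive $T$ it equals $\sup\{h_\mu(Q)+\int\varphi\,d\gamma_{\mu,Q}\}$ over stationary transition pairs, and $\mathsf{Eq}(T,\varphi)$ is the set of pairs attaining this supremum (linear equilibrium pairs). Abundance. Let $p_2:\Omega_T\to\Gamma_T$, $p_2((x_j)_{j\geq 0})=(x_0,x_1)$, and $\widehat{\mathcal{E}}(\nu)=\mathcal{E}((p_2)_*\nu)$. $(T,\mathcal{E})$ has an abundance of ergodic path measures if for every $\nu\in\mathcal{M}(\Omega_T,\sigma)$ and $\eta>0$ there is an ergodic $\rho\in\mathcal{M}(\Omega_T,\sigma)$ with $h_\rho(\sigma)+\widehat{\mathcal{E}}(\rho)>h_\nu(\sigma)+\widehat{\mathcal{E}}(\nu)-\eta$. Rotation set and localized entropy. $\mathcal{R}(\boldsymbol\psi)=\{\int\boldsymbol\psi\,d\gamma_{\mu,Q}:(\mu,Q)\text{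 stationary transition pair}\}\subset\mathbb{R}^d$; for $\boldsymbol z\in\mathcal{R}(\boldsymbol\psi)$, $\mathfrak{h}(\boldsymbol z)=\sup\{h_\mu(Q):\int\boldsymbol\psi\,d\gamma_{\mu,Q}=\boldsymbol z\}$. Put $P(\boldsymbol y)=P(T,\boldsymbol y\cdot\boldsymbol\psi)$, $\boldsymbol y\in\mathbb{R}^d$. $C^1$ Legendre assumptions for $(T,\boldsymbol\psi)$: (i) $\mathcal{R}(\boldsymbol\psi)$ has nonempty interior; (ii) $\mathfrak{h}$ is finite and upper semicontinuous on $\mathcal{R}(\boldsymbol\psi)$, and is $C^1$ and strictly concave on its interior; (iii) $P$ is $C^1$ and strictly convex, and $\nabla P:\mathbb{R}^d\to\operatorname{int}\mathcal{R}(\boldsymbol\psi)$ is a homeomorphism; (iv) $\mathfrak{h}(\boldsymbol z)=\inf_{\boldsymbol y\in\mathbb{R}^d}(P(\boldsymbol y)-\boldsymbol y\cdot\boldsymbol z)$ for all $\boldsymbol z\in\mathcal{R}(\boldsymbol\psi)$. *)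

theory Defs
  imports "HOL-Probability.Probability"
begin

text \<open>
  The compact metric space \<open>X\<close> is the whole type \<^typ>\<open>'a\<close>, with compactness of
  \<^term>\<open>UNIV :: 'a set\<close> as a hypothesis of the theorem. A compact metric space is complete and
  second countable, so sort \<^class>\<open>polish_space\<close> is no restriction; it is what the library
  uses to identify Borel and product sigma-algebras. Borel probability measures on a subset \<open>Y\<close>
  of a type are the elements of \<open>space (prob_algebra (restrict_space borel Y))\<close>.
\<close>

section \<open>Correspondences\<close>

definition graph :: "('a \<Rightarrow> 'a set) \<Rightarrow> ('a \<times> 'a) set" where
  "graph T = {(x, y). y \<in> T x}"

definition correspondence :: "('a::topological_space \<Rightarrow> 'a set) \<Rightarrow> bool" where
  "correspondence T \<longleftrightarrow> (\<forall>x. T x \<noteq> {} \<and> closed (T x)) \<and> closed (graph T)"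

text \<open>Points of $X^{n+1}$ are functions on \<open>{..n}\<close>, extended by \<^const>\<open>undefined\<close>.\<close>

definition finite_orbits :: "('a \<Rightarrow> 'a set) \<Rightarrow> nat \<Rightarrow> (nat \<Rightarrow> 'a) set" where
  "finite_orbits T n = {x \<in> extensional {..n}. \<forall>j<n. x (Suc j) \<in> T (x j)}"

definition orbit_dist :: "nat \<Rightarrow> (nat \<Rightarrow> 'a::metric_space) \<Rightarrow> (nat \<Rightarrow> 'a) \<Rightarrow> real" where
  "orbit_dist n x y = Max ((\<lambda>j. dist (x j) (y j)) ` {..n})"

definition orbit_space :: "('a \<Rightarrow> 'a set) \<Rightarrow> (nat \<Rightarrow> 'a) set" where
  "orbit_space T = {x. \<forall>j. x (Suc j) \<in> T (x j)}"

definition shift :: "(nat \<Rightarrow> 'a) \<Rightarrow> nat \<Rightarrow> 'a" where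
  "shift x = (\<lambda>j. x (Suc j))"

definition forward_expansive :: "('a::metric_space \<Rightarrow> 'a set) \<Rightarrow> bool" where
  "forward_expansive T \<longleftrightarrow>
     (\<exists>\<epsilon>\<^sub>0>0. \<forall>x\<in>orbit_space T. \<forall>y\<in>orbit_space T. x \<noteq> y \<longrightarrow> (\<exists>j. dist (x j) (y j) > \<epsilon>\<^sub>0))"


section \<open>Topological pressure\<close>

text \<open>
  The push-forward of the uniform distribution on \<open>{..<n}\<close> is the average
  $\frac1n\sum_{j<n}\delta_{(x_j,x_{j+1})}$.
\<close>

definition empirical :: "('a::topological_space \<Rightarrow> 'a set) \<Rightarrow> nat \<Rightarrow> (nat \<Rightarrow> 'a) \<Rightarrow> ('a \<times> 'a) measure" where
  "empirical T n x =
     distr (uniform_count_measure {..<n}) (restrict_space borel (graph T)) (\<lambda>j. (x j, x (Suc j)))"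

definition separated :: "('a::metric_space \<Rightarrow> 'a set) \<Rightarrow> nat \<Rightarrow> real \<Rightarrow> (nat \<Rightarrow> 'a) set \<Rightarrow> bool" where
  "separated T n \<epsilon> C \<longleftrightarrow>
     C \<subseteq> finite_orbits T n \<and> (\<forall>x\<in>C. \<forall>y\<in>C. x \<noteq> y \<longrightarrow> orbit_dist n x y > \<epsilon>)"

text \<open>
  For compact \<open>X\<close> and \<open>\<epsilon> > 0\<close>, separated sets are finite and of bounded cardinality; as a
  weak-star continuous energy is bounded, the real supremum below is a genuine one.
\<close>

definition partition_sum ::
    "('a::metric_space \<Rightarrow> 'a set) \<Rightarrow> (('a \<times> 'a) measure \<Rightarrow> real) \<Rightarrow> nat \<Rightarrow> real \<Rightarrow> real" where
  "partition_sum T E n \<epsilon> =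
     (SUP C \<in> {C. separated T n \<epsilon> C}. \<Sum>x\<in>C. exp (real n * E (empirical T n x)))"

definition upper_pressure ::
    "('a::metric_space \<Rightarrow> 'a set) \<Rightarrow> (('a \<times> 'a) measure \<Rightarrow> real) \<Rightarrow> ereal" where
  "upper_pressure T E =
     Lim (at_right 0) (\<lambda>\<epsilon>. limsup (\<lambda>n. ereal (ln (partition_sum T E n \<epsilon>) / real n)))"

definition lower_pressure ::
    "('a::metric_space \<Rightarrow> 'a set) \<Rightarrow> (('a \<times> 'a) measure \<Rightarrow> real) \<Rightarrow> ereal" where
  "lower_pressure T E =
     Lim (at_right 0) (\<lambda>\<epsilon>. liminf (\<lambda>n. ereal (ln (partition_sum T E n \<epsilon>) / real n)))"

text \<open>The common value of the two pressures, unspecified if they differ.\<close>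

definition top_pressure ::
    "('a::metric_space \<Rightarrow> 'a set) \<Rightarrow> (('a \<times> 'a) measure \<Rightarrow> real) \<Rightarrow> ereal" where
  "top_pressure T E = (THE p. upper_pressure T E = p \<and> lower_pressure T E = p)"

definition linear_energy :: "('a \<times> 'a \<Rightarrow> real) \<Rightarrow> ('a \<times> 'a) measure \<Rightarrow> real" where
  "linear_energy \<phi> \<gamma> = (\<integral>p. \<phi> p \<partial>\<gamma>)"

text \<open>For forward expansive \<open>T\<close> and continuous \<open>\<phi>\<close> the linear pressure exists and is finite.\<close>

definition linear_pressure :: "('a::metric_space \<Rightarrow> 'a set) \<Rightarrow> ('a \<times> 'a \<Rightarrow> real) \<Rightarrow> real" where
  "linear_pressure T \<phi> = real_of_ereal (top_pressure T (linear_energy \<phi>))"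


section \<open>Entropy\<close>

definition finite_partition :: "'b measure \<Rightarrow> 'b set set \<Rightarrow> bool" where
  "finite_partition M A \<longleftrightarrow> finite A \<and> A \<subseteq> sets M \<and> partition_on (space M) A"

text \<open>Since \<^term>\<open>ln 0 = (0::real)\<close>, null sets contribute nothing.\<close>

definition partition_entropy :: "'b measure \<Rightarrow> 'b set set \<Rightarrow> real" where
  "partition_entropy M A = - (\<Sum>B\<in>A. measure M B * ln (measure M B))"

text \<open>
  The join of the preimages of \<open>A\<close> under the iterates \<open>S ^^ j\<close>, \<open>j < n\<close>. It may contain the
  empty set, which does not affect \<^const>\<open>partition_entropy\<close>.
\<close>

definition dynamical_join :: "'b measure \<Rightarrow> ('b \<Rightarrow> 'b) \<Rightarrow> 'b set set \<Rightarrow> nat \<Rightarrow> 'b set set" where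
  "dynamical_join M S A n =
     (\<lambda>B. {x \<in> space M. \<forall>j<n. (S ^^ j) x \<in> B j}) ` (PiE {..<n} (\<lambda>_. A))"

definition KS_entropy :: "'b measure \<Rightarrow> ('b \<Rightarrow> 'b) \<Rightarrow> ereal" where
  "KS_entropy M S =
     (SUP A \<in> {A. finite_partition M A}.
        ereal (lim (\<lambda>n. partition_entropy M (dynamical_join M S A n) / real n)))"

text \<open>
  \<open>markov_law \<mu> Q m\<close> is the law of the first \<open>m + 1\<close> coordinates $(x_0,\dots,x_m)$ of the Markov
  process with initial law \<open>\<mu>\<close> and kernel \<open>Q\<close>, that is, $\mu Q^{[m]}$.
\<close>

primrec markov_law ::
    "'a::topological_space measure \<Rightarrow> ('a \<Rightarrow> 'a measure) \<Rightarrow> nat \<Rightarrow> (nat \<Rightarrow> 'a) measure" where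
  "markov_law \<mu> Q 0 = distr \<mu> (PiM {..0} (\<lambda>_. borel)) (\<lambda>x. \<lambda>i\<in>{..0}. x)"
| "markov_law \<mu> Q (Suc m) =
     bind (markov_law \<mu> Q m)
       (\<lambda>\<omega>. distr (Q (\<omega> m)) (PiM {..Suc m} (\<lambda>_. borel)) (\<lambda>y. fun_upd \<omega> (Suc m) y))"

definition product_partition :: "'a set set \<Rightarrow> nat \<Rightarrow> (nat \<Rightarrow> 'a) set set" where
  "product_partition A m = PiE {..m} ` (PiE {..m} (\<lambda>_. A))"

definition kernel_entropy_wrt ::
    "'a::topological_space measure \<Rightarrow> ('a \<Rightarrow> 'a measure) \<Rightarrow> 'a set set \<Rightarrow> real" where
  "kernel_entropy_wrt \<mu> Q A =
     lim (\<lambda>m. partition_entropy (markov_law \<mu> Q m) (product_partition A m) / real (Suc m))"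

definition kernel_entropy :: "'a::topological_space measure \<Rightarrow> ('a \<Rightarrow> 'a measure) \<Rightarrow> ereal" where
  "kernel_entropy \<mu> Q = (SUP A \<in> {A. finite_partition borel A}. ereal (kernel_entropy_wrt \<mu> Q A))"


section \<open>Stationary transition pairs\<close>

definition msupport :: "'b::topological_space measure \<Rightarrow> 'b set" where
  "msupport M = {x. \<forall>U. open U \<and> x \<in> U \<longrightarrow> emeasure M U > 0}"

definition transition_kernels :: "('a::topological_space \<Rightarrow> 'a set) \<Rightarrow> ('a \<Rightarrow> 'a measure) set" where
  "transition_kernels T = {Q \<in> measurable borel (prob_algebra borel). \<forall>x. msupport (Q x) \<subseteq> T x}"

definition stationary_measures :: "('a::topological_space \<Rightarrow> 'a measure) \<Rightarrow> 'a measure set" where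
  "stationary_measures Q = {\<mu> \<in> space (prob_algebra borel). bind \<mu> Q = \<mu>}"

text \<open>
  Kernels agreeing almost everywhere are not quotiented out: kernel entropy and two-coordinate
  distribution do not distinguish them, so every set of pairs below is saturated.
\<close>

definition stationary_pairs ::
    "('a::topological_space \<Rightarrow> 'a set) \<Rightarrow> ('a measure \<times> ('a \<Rightarrow> 'a measure)) set" where
  "stationary_pairs T = {(\<mu>, Q). Q \<in> transition_kernels T \<and> \<mu> \<in> stationary_measures Q}"

text \<open>The measure $\mu(dx)\,Q_x(dy)$, carried by \<open>graph T\<close> and viewed as a measure on it.\<close>

definition pair_law ::
    "('a::topological_space \<Rightarrow> 'a set) \<Rightarrow> 'a measure \<Rightarrow> ('a \<Rightarrow> 'a measure) \<Rightarrow> ('a \<times> 'a) measure" where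
  "pair_law T \<mu> Q = restrict_space (bind \<mu> (\<lambda>x. distr (Q x) borel (\<lambda>y. (x, y)))) (graph T)"

definition equilibrium_pairs ::
    "('a::topological_space \<Rightarrow> 'a set) \<Rightarrow> (('a \<times> 'a) measure \<Rightarrow> real) \<Rightarrow>
     ('a measure \<times> ('a \<Rightarrow> 'a measure)) set" where
  "equilibrium_pairs T E =
     {p. is_arg_max (\<lambda>(\<mu>, Q). kernel_entropy \<mu> Q + ereal (E (pair_law T \<mu> Q)))
           (\<lambda>p. p \<in> stationary_pairs T) p}"

definition linear_equilibrium_pairs ::
    "('a::topological_space \<Rightarrow> 'a set) \<Rightarrow> ('a \<times> 'a \<Rightarrow> real) \<Rightarrow>
     ('a measure \<times> ('a \<Rightarrow> 'a measure)) set" where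
  "linear_equilibrium_pairs T \<phi> = equilibrium_pairs T (linear_energy \<phi>)"


section \<open>Abundance of ergodic path measures\<close>

definition invariant_path_measures ::
    "('a::topological_space \<Rightarrow> 'a set) \<Rightarrow> (nat \<Rightarrow> 'a) measure set" where
  "invariant_path_measures T =
     {\<nu> \<in> space (prob_algebra (restrict_space borel (orbit_space T))).
        distr \<nu> (restrict_space borel (orbit_space T)) shift = \<nu>}"

definition ergodic :: "'b measure \<Rightarrow> ('b \<Rightarrow> 'b) \<Rightarrow> bool" where
  "ergodic M S \<longleftrightarrow> (\<forall>A\<in>sets M. S -` A \<inter> space M = A \<longrightarrow> measure M A = 0 \<or> measure M A = 1)"

definition path_energy ::
    "('a::topological_space \<Rightarrow> 'a set) \<Rightarrow> (('a \<times> 'a) measure \<Rightarrow> real) \<Rightarrow> (nat \<Rightarrow> 'a) measure \<Rightarrow> real" where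
  "path_energy T E \<nu> = E (distr \<nu> (restrict_space borel (graph T)) (\<lambda>x. (x 0, x 1)))"

definition abundance_ergodic ::
    "('a::topological_space \<Rightarrow> 'a set) \<Rightarrow> (('a \<times> 'a) measure \<Rightarrow> real) \<Rightarrow> bool" where
  "abundance_ergodic T E \<longleftrightarrow>
     (\<forall>\<nu>\<in>invariant_path_measures T. \<forall>\<eta>>0. \<exists>\<rho>\<in>invariant_path_measures T. ergodic \<rho> shift \<and>
        KS_entropy \<rho> shift + ereal (path_energy T E \<rho>)
          > KS_entropy \<nu> shift + ereal (path_energy T E \<nu>) - ereal \<eta>)"


section \<open>Rotation set and Legendre assumptions\<close>

definition rotation_vector ::
    "('a::topological_space \<Rightarrow> 'a set) \<Rightarrow> ('a \<times> 'a \<Rightarrow> real ^ 'd) \<Rightarrow>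
     'a measure \<times> ('a \<Rightarrow> 'a measure) \<Rightarrow> real ^ 'd" where
  "rotation_vector T \<psi> = (\<lambda>(\<mu>, Q). \<integral>p. \<psi> p \<partial>pair_law T \<mu> Q)"

definition rotation_set ::
    "('a::topological_space \<Rightarrow> 'a set) \<Rightarrow> ('a \<times> 'a \<Rightarrow> real ^ 'd) \<Rightarrow> (real ^ 'd) set" where
  "rotation_set T \<psi> = rotation_vector T \<psi> ` stationary_pairs T"

definition local_entropy ::
    "('a::topological_space \<Rightarrow> 'a set) \<Rightarrow> ('a \<times> 'a \<Rightarrow> real ^ 'd) \<Rightarrow> real ^ 'd \<Rightarrow> ereal" where
  "local_entropy T \<psi> z =
     (SUP (\<mu>, Q) \<in> {p \<in> stationary_pairs T. rotation_vector T \<psi> p = z}. kernel_entropy \<mu> Q)"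

definition pressure_fun ::
    "('a::metric_space \<Rightarrow> 'a set) \<Rightarrow> ('a \<times> 'a \<Rightarrow> real ^ 'd) \<Rightarrow> real ^ 'd \<Rightarrow> real" where
  "pressure_fun T \<psi> y = linear_pressure T (\<lambda>p. y \<bullet> \<psi> p)"

definition gradient :: "('v::real_inner \<Rightarrow> real) \<Rightarrow> 'v \<Rightarrow> 'v" where
  "gradient f x = (THE g. GDERIV f x :> g)"

definition C1_on :: "'v::real_inner set \<Rightarrow> ('v \<Rightarrow> real) \<Rightarrow> bool" where
  "C1_on S f \<longleftrightarrow> (\<forall>x\<in>S. \<exists>g. GDERIV f x :> g) \<and> continuous_on S (gradient f)"

definition strictly_convex_on :: "'v::real_vector set \<Rightarrow> ('v \<Rightarrow> real) \<Rightarrow> bool" where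
  "strictly_convex_on S f \<longleftrightarrow> convex S \<and>
     (\<forall>x\<in>S. \<forall>y\<in>S. \<forall>t. x \<noteq> y \<and> 0 < t \<and> t < 1 \<longrightarrow>
        f ((1 - t) *\<^sub>R x + t *\<^sub>R y) < (1 - t) * f x + t * f y)"

definition strictly_concave_on :: "'v::real_vector set \<Rightarrow> ('v \<Rightarrow> real) \<Rightarrow> bool" where
  "strictly_concave_on S f \<longleftrightarrow> strictly_convex_on S (\<lambda>x. - f x)"

definition usc_on :: "'v::topological_space set \<Rightarrow> ('v \<Rightarrow> ereal) \<Rightarrow> bool" where
  "usc_on S f \<longleftrightarrow> (\<forall>x\<in>S. \<forall>c>f x. eventually (\<lambda>w. f w < c) (at x within S))"

definition C1_legendre ::
    "('a::metric_space \<Rightarrow> 'a set) \<Rightarrow> ('a \<times> 'a \<Rightarrow> real ^ 'd) \<Rightarrow> bool" where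
  "C1_legendre T \<psi> \<longleftrightarrow>
     (let R = rotation_set T \<psi>; h = local_entropy T \<psi>; P = pressure_fun T \<psi> in
       interior R \<noteq> {} \<and>
       (\<forall>z\<in>R. \<bar>h z\<bar> \<noteq> \<infinity>) \<and> usc_on R h \<and>
       C1_on (interior R) (\<lambda>z. real_of_ereal (h z)) \<and>
       strictly_concave_on (interior R) (\<lambda>z. real_of_ereal (h z)) \<and>
       C1_on UNIV P \<and> strictly_convex_on UNIV P \<and>
       (\<exists>G. homeomorphism UNIV (interior R) (gradient P) G) \<and>
       (\<forall>z\<in>R. h z = (INF y. ereal (P y - y \<bullet> z))))"

definition rotation_energy :: "('a \<times> 'a \<Rightarrow> real ^ 'd) \<Rightarrow> (real ^ 'd \<Rightarrow> real) \<Rightarrow> ('a \<times> 'a) measure \<Rightarrow> real" where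
  "rotation_energy \<psi> F \<gamma> = F (\<integral>p. \<psi> p \<partial>\<gamma>)"

definition rotation_maximizers ::
    "('a::topological_space \<Rightarrow> 'a set) \<Rightarrow> ('a \<times> 'a \<Rightarrow> real ^ 'd) \<Rightarrow> (real ^ 'd \<Rightarrow> real) \<Rightarrow> (real ^ 'd) set" where
  "rotation_maximizers T \<psi> F =
     {z. is_arg_max (\<lambda>z. local_entropy T \<psi> z + ereal (F z)) (\<lambda>z. z \<in> rotation_set T \<psi>) z}"

end

theory Submission
  imports Defs "HOL-Real_Asymp.Real_Asymp"
begin

text \<open>
  Write \<open>R\<close> for the rotation set, \<open>h\<close> for the localized entropy and \<open>P\<close> for the linear
  pressure. The Legendre formula \<open>h z = inf (P y - y \<bullet> z)\<close> on \<open>R\<close> expresses entropy through the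
  topological pressures of the linear energies. So no entropy has to be estimated: the nonlinear
  pressure is compared with linear partition sums only, and the theorem becomes a large deviation
  statement for the orbit averages of \<open>\<psi>\<close>, in the style of the Gaertner--Ellis theorem.

  \<^emph>\<open>Linear pressures exist.\<close> Cutting orbits into blocks and replacing each block by a nearby element
  of a maximal separated set shows that upper and lower pressure of a linear energy agree
  (\<open>linear_growth_eq_liminf\<close>). They are finite, since otherwise \<open>P\<close> would vanish identically and
  would not be strictly convex (\<open>linear_growth_finite\<close>).

  \<^emph>\<open>Upper bound.\<close> If every \<open>w\<close> in the convex hull of the values of \<open>\<psi>\<close> admits some \<open>y\<close> with
  \<open>P y - y \<bullet> w + F w < s\<close>, then by compactness finitely many \<open>y\<close> suffice, the nonlinear partition
  sum is at most a finite sum of weighted linear ones, and the upper pressure is at most \<open>s\<close>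
  (\<open>upper_pressure_le\<close>). On \<open>R\<close> this applies to every \<open>s\<close> above \<open>max (h + F)\<close>; off \<open>R\<close>,
  \<open>P y - y \<bullet> w\<close> is unbounded below in \<open>y\<close>, because a bound from below would place \<open>w\<close> in the
  closure of the range of the gradient of \<open>P\<close> (\<open>closure_range_gradient\<close>), that is, in \<open>R\<close>.

  \<^emph>\<open>Lower bound.\<close> For \<open>z = \<nabla>P y\<close>, the linear partition sum at \<open>y\<close> is exponentially dominated by
  orbits whose average is close to \<open>z\<close>: any other \<open>w\<close> fails to be a subgradient of \<open>P\<close> at \<open>y\<close>, so
  averages near \<open>w\<close> are controlled by a partition sum with a different \<open>y'\<close> and a strictly smaller
  rate. Hence the lower pressure is at least \<open>P y - y \<bullet> z + F z = h z + F z\<close>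
  (\<open>lower_pressure_ge\<close>).

  \<^emph>\<open>Existence of maximizers.\<close> \<open>h\<close> is an infimum of affine functions, so it is enough that \<open>R\<close> is
  compact (\<open>closed_rotation_set\<close>). Two-coordinate distributions of stationary transition pairs are the
  probability measures on the graph with equal marginals: these are closed under weak limits, and
  as soon as there is a transition kernel at all, every one of them disintegrates into a stationary
  transition pair. Weak compactness and
  disintegration are both reduced to the real line by an injective Borel coding of a compact metric
  space, whose inverse extends continuously to the closure of its range
  (\<open>compact_real_coding\<close>).

  \<^emph>\<open>Equilibrium pairs.\<close> A pair is an equilibrium pair of an energy that depends on the rotation vector
  through \<open>g\<close> iff its rotation vector maximizes \<open>h + g\<close> and its entropy is the localized entropy
  there (\<open>equilibrium_pairs_iff\<close>). For \<open>g w = y \<bullet> w\<close> the only maximizer is \<open>\<nabla>P y\<close>, which gives the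
  description of the nonlinear equilibrium pairs. The equation \<open>y = \<nabla>F (\<nabla>P y)\<close> is the first-order
  condition at an interior maximizer, as \<open>\<nabla>h (\<nabla>P y) = - y\<close>.
\<close>

section \<open>Gradients and convex functions\<close>

lemma gradient_eqI:
  assumes "GDERIV f x :> g"
  shows "gradient f x = g"
  unfolding gradient_def
proof (rule the_equality)
  show "GDERIV f x :> g" by fact
  fix g' assume "GDERIV f x :> g'"
  then have "(\<lambda>h. h \<bullet> g') = (\<lambda>h. h \<bullet> g)"
    using assms unfolding gderiv_def by (rule has_derivative_unique)
  then have "h \<bullet> (g' - g) = 0" for h by (simp add: inner_diff_right fun_eq_iff)
  then show "g' = g" by (metis inner_eq_zero_iff right_minus_eq)
qed

lemma C1_onD: "C1_on S f \<Longrightarrow> x \<in> S \<Longrightarrow> GDERIV f x :> gradient f x"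
  unfolding C1_on_def using gradient_eqI by metis

lemma C1_on_imp_continuous_on:
  assumes "C1_on S f"
  shows "continuous_on S f"
proof (rule continuous_at_imp_continuous_on, rule ballI)
  fix x assume "x \<in> S"
  then show "isCont f x"
    using C1_onD[OF assms] has_derivative_continuous unfolding gderiv_def by blast
qed

lemma GDERIV_local_min:
  assumes "GDERIV f x :> g" "eventually (\<lambda>w. f x \<le> f w) (at x)"
  shows "g = 0"
proof -
  have "(\<lambda>h. h \<bullet> g) = (\<lambda>h. 0)"
    using has_derivative_local_min[OF assms(1)[unfolded gderiv_def] assms(2)] .
  then have "g \<bullet> g = 0" by (rule fun_cong)
  then show ?thesis by simp
qed

lemma GDERIV_inner: "GDERIV (\<lambda>x. x \<bullet> z) x :> z"
  unfolding gderiv_def by (auto intro!: derivative_eq_intros)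

lemma gradient_eq_of_global_min:
  assumes "GDERIV P y :> g" "\<And>y'. P y - y \<bullet> z \<le> P y' - y' \<bullet> z"
  shows "g = z"
proof -
  have "GDERIV (\<lambda>y. P y - y \<bullet> z) y :> g - z" by (rule GDERIV_diff[OF assms(1) GDERIV_inner])
  then have "g - z = 0" by (rule GDERIV_local_min) (use assms(2) in auto)
  then show ?thesis by simp
qed

lemma strictly_convex_above_tangent:
  assumes conv: "strictly_convex_on UNIV P" and g: "GDERIV P y :> g"
  shows "P y + (y' - y) \<bullet> g \<le> P y'"
proof -
  define \<phi> where "\<phi> t = P (y + t *\<^sub>R (y' - y))" for t :: real
  have "convex_on UNIV \<phi>"
  proof (rule convex_onI)
    fix t u v :: real assume t: "0 < t" "t < 1"
    let ?L = "\<lambda>t. y + t *\<^sub>R (y' - y)"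
    have eq: "?L ((1 - t) *\<^sub>R u + t *\<^sub>R v) = (1 - t) *\<^sub>R ?L u + t *\<^sub>R ?L v"
      by (simp add: algebra_simps)
    show "\<phi> ((1 - t) *\<^sub>R u + t *\<^sub>R v) \<le> (1 - t) * \<phi> u + t * \<phi> v"
    proof (cases "?L u = ?L v")
      case True
      have "(1 - t) *\<^sub>R ?L u + t *\<^sub>R ?L v = ?L v"
        unfolding True by (simp only: scaleR_left_distrib[symmetric]) simp
      moreover have "\<phi> u = \<phi> v" unfolding \<phi>_def True ..
      moreover have "(1 - t) * \<phi> v + t * \<phi> v = \<phi> v" by (simp add: algebra_simps)
      ultimately show ?thesis by (simp add: \<phi>_def[of "(1 - t) *\<^sub>R u + t *\<^sub>R v"] \<phi>_def[of v] eq del: real_scaleR_def)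
    next
      case False
      then show ?thesis unfolding \<phi>_def eq
        using conv t unfolding strictly_convex_on_def by (simp add: less_imp_le)
    qed
  qed simp
  moreover have "(\<phi> has_real_derivative (y' - y) \<bullet> g) (at 0 within UNIV)"
  proof -
    have "(P has_derivative (\<lambda>h. h \<bullet> g)) (at (y + 0 *\<^sub>R (y' - y)))" using g by (simp add: gderiv_def)
    moreover have "((\<lambda>t. y + t *\<^sub>R (y' - y)) has_derivative (\<lambda>t. t *\<^sub>R (y' - y))) (at 0)"
      by (auto intro!: derivative_eq_intros)
    ultimately have "(\<phi> has_derivative (\<lambda>t. (t *\<^sub>R (y' - y)) \<bullet> g)) (at 0)"
      unfolding \<phi>_def[abs_def] by (rule has_derivative_compose[rotated])
    also have "(\<lambda>t. (t *\<^sub>R (y' - y)) \<bullet> g) = (*) ((y' - y) \<bullet> g)" by (simp add: fun_eq_iff)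
    finally show ?thesis by (simp add: has_field_derivative_def)
  qed
  ultimately have "((y' - y) \<bullet> g) * (1 - 0) \<le> \<phi> 1 - \<phi> 0"
    by (intro convex_on_imp_above_tangent) auto
  then show ?thesis by (simp add: \<phi>_def)
qed

text \<open>
  Where the conjugate of \<open>P\<close> is finite, its argument is a limit of gradients: the minimizer \<open>y\<close> of
  \<open>P y - y \<bullet> z + t/2 * (y \<bullet> y)\<close> has gradient \<open>z - t *\<^sub>R y\<close>, and \<open>t *\<^sub>R y\<close> tends to \<open>0\<close> with \<open>t\<close>.
\<close>

lemma closure_range_gradient:
  fixes P :: "'v::euclidean_space \<Rightarrow> real"
  assumes g: "\<And>y. GDERIV P y :> g y" and c: "\<And>y. c \<le> P y - y \<bullet> z"
  shows "z \<in> closure (range g)"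
proof (rule closure_approachable[THEN iffD2], intro allI impI)
  fix e :: real assume e: "0 < e"
  have "c \<le> P 0" using c[of 0] by simp
  \<comment> \<open>the summand \<open>1\<close> keeps the penalty \<open>t\<close> well defined when \<open>c = P 0\<close>\<close>
  define A where "A = P 0 - c + 1"
  have A: "0 < A" using \<open>c \<le> P 0\<close> by (simp add: A_def)
  define t where "t = e\<^sup>2 / (2 * A)"
  have t: "0 < t" "2 * t * (P 0 - c) < e\<^sup>2"
  proof -
    show "0 < t" using e A by (simp add: t_def)
    then have "2 * t * (P 0 - c) < 2 * t * A" by (simp add: A_def)
    also have "\<dots> = e\<^sup>2" using A by (simp add: t_def)
    finally show "2 * t * (P 0 - c) < e\<^sup>2" .
  qed
  define f where "f y = P y - y \<bullet> z + t/2 * (y \<bullet> y)" for y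
  have fg: "GDERIV f y :> g y - z + t *\<^sub>R y" for y
    using g[of y] unfolding f_def[abs_def] gderiv_def
    by (auto intro!: derivative_eq_intros simp: fun_eq_iff inner_add_right inner_diff_right inner_commute algebra_simps)
  have contf: "continuous_on UNIV f"
    using fg has_derivative_continuous unfolding gderiv_def
    by (intro continuous_at_imp_continuous_on) blast
  define r where "r = sqrt (2 * (P 0 - c) / t)"
  have r: "0 \<le> r" "t/2 * r\<^sup>2 = P 0 - c" using t(1) \<open>c \<le> P 0\<close> by (auto simp: r_def)
  obtain y where y: "y \<in> cball 0 r" "\<And>w. w \<in> cball 0 r \<Longrightarrow> f y \<le> f w"
    using continuous_attains_inf[OF compact_cball, of 0 r f] continuous_on_subset[OF contf] r(1) by auto
  have f0: "f y \<le> P 0" using y(2)[of 0] r(1) by (simp add: f_def)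
  have min: "f y \<le> f w" for w
  proof (cases "w \<in> cball 0 r")
    case False
    then have "r\<^sup>2 \<le> (norm w)\<^sup>2" using r(1) by (intro power_mono) auto
    then have "t/2 * r\<^sup>2 \<le> t/2 * (norm w)\<^sup>2" using t(1) by (intro mult_left_mono) auto
    moreover have "c + t/2 * (norm w)\<^sup>2 \<le> f w" using c[of w] by (simp add: f_def power2_norm_eq_inner)
    ultimately show ?thesis using r(2) f0 by linarith
  qed (use y(2) in auto)
  have "g y - z + t *\<^sub>R y = 0" by (rule GDERIV_local_min[OF fg]) (use min in auto)
  then have gz: "g y - z = - (t *\<^sub>R y)" by (simp add: eq_neg_iff_add_eq_0)
  have "c + t/2 * (norm y)\<^sup>2 \<le> P 0" using c[of y] f0 by (simp add: f_def power2_norm_eq_inner)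
  then have "2 * t * (t/2 * (norm y)\<^sup>2) \<le> 2 * t * (P 0 - c)" using t(1) by (intro mult_left_mono) auto
  then have "(t * norm y)\<^sup>2 < e\<^sup>2" using t(2) by (simp add: power2_eq_square mult_ac)
  then have "t * norm y < e" using e by (simp add: power_less_imp_less_base)
  then have "dist (g y) z < e" using gz t(1) by (simp add: dist_norm)
  then show "\<exists>w\<in>range g. dist w z < e" by blast
qed

section \<open>Real codings, weak compactness and disintegration\<close>

text \<open>
  The first nonzero digit dominates the tail: the remaining terms sum to at most half of it.
\<close>

lemma ternary_series_separates:
  fixes a :: "nat \<Rightarrow> real"
  assumes a: "\<And>i. a i \<in> {-1, 0, 1}" and small: "\<bar>\<Sum>i. a i * (1/3)^i\<bar> < (1/3)^J / 2" and "i \<le> J"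
  shows "a i = 0"
proof (rule ccontr)
  assume "a i \<noteq> 0"
  define j where "j = (LEAST i. a i \<noteq> 0)"
  have j: "a j \<noteq> 0" "j \<le> J"
    using LeastI[of "\<lambda>i. a i \<noteq> 0", OF \<open>a i \<noteq> 0\<close>] Least_le[of "\<lambda>i. a i \<noteq> 0", OF \<open>a i \<noteq> 0\<close>] \<open>i \<le> J\<close>
    by (auto simp: j_def)
  have below: "a k = 0" if "k < j" for k
    using not_less_Least[of k "\<lambda>i. a i \<noteq> 0"] that by (auto simp: j_def)
  have abs_a: "\<bar>a k\<bar> \<le> 1" for k using a[of k] by auto
  have sm: "summable (\<lambda>i. (1/3::real)^(i + n))" for n
    by (simp add: power_add summable_mult2)
  have sma: "summable (\<lambda>i. a (i+n) * (1/3)^(i+n))" for n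
    by (rule summable_comparison_test[OF _ sm[of n]])
       (use abs_a in \<open>auto simp: abs_mult intro!: exI[of _ 0] mult_left_le_one_le\<close>)
  have "(\<Sum>i. a i * (1/3)^i) = (\<Sum>i. a (i + Suc j) * (1/3)^(i + Suc j)) + (\<Sum>i<Suc j. a i * (1/3)^i)"
    using suminf_split_initial_segment[of "\<lambda>i. a i * (1/3)^i" "Suc j"] sma[of 0] by simp
  also have "(\<Sum>i<Suc j. a i * (1/3)^i) = a j * (1/3)^j"
    using below by simp
  finally have eq: "(\<Sum>i. a i * (1/3)^i) = (\<Sum>i. a (i + Suc j) * (1/3)^(i + Suc j)) + a j * (1/3)^j" .
  have "\<bar>\<Sum>i. a (i + Suc j) * (1/3)^(i + Suc j)\<bar> \<le> (\<Sum>i. (1/3)^(i + Suc j))"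
    by (rule norm_suminf_le[where 'a=real, simplified real_norm_def])
       (use abs_a sm in \<open>auto simp: abs_mult intro!: mult_left_le_one_le\<close>)
  also have "\<dots> = (1/3)^j / 2"
  proof -
    have "(\<Sum>i. (1/3::real)^(i + Suc j)) = (\<Sum>i. (1/3)^Suc j * (1/3)^i)"
      by (simp add: power_add mult_ac)
    also have "\<dots> = (1/3)^Suc j * (\<Sum>i. (1/3)^i)"
      by (rule suminf_mult) simp
    also have "(\<Sum>i. (1/3::real)^i) = 3/2"
      by (subst suminf_geometric) auto
    finally show ?thesis by simp
  qed
  finally have "\<bar>\<Sum>i. a (i + Suc j) * (1/3)^(i + Suc j)\<bar> \<le> (1/3)^j / 2" .
  moreover have "\<bar>a j * (1/3)^j\<bar> = (1/3)^j" using a[of j] j by (auto simp: abs_mult)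
  ultimately have "\<bar>\<Sum>i. a i * (1/3)^i\<bar> \<ge> (1/3)^j / 2" unfolding eq by linarith
  moreover have "(1/3::real)^J \<le> (1/3)^j" using j(2) by (simp add: power_decreasing)
  ultimately show False using small by linarith
qed

text \<open>
  The code of \<open>x\<close> has the ternary digits \<open>indicator (B j) x\<close>, where \<open>B\<close> enumerates the balls of
  radii \<open>1 / (m + 1)\<close> about the points of a countable dense set. Finitely many balls of a given
  radius cover the space, so sufficiently close codes share such a ball: the inverse of the code is
  uniformly continuous and extends to the closure \<open>C\<close> of its range.
\<close>

lemma compact_real_coding:
  assumes cpt: "compact (UNIV :: 'b::{complete_space, second_countable_topology} set)"
  obtains c :: "'b::{complete_space, second_countable_topology} \<Rightarrow> real" and g C where
    "c \<in> borel_measurable borel" "closed C" "range c \<subseteq> C" "C \<subseteq> {0..2}"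
    "continuous_on C g" "g \<in> borel_measurable borel" "\<And>x. g (c x) = x"
proof -
  obtain D :: "'b set" where D: "countable D" "\<And>X. open X \<Longrightarrow> X \<noteq> {} \<Longrightarrow> \<exists>d\<in>D. d \<in> X"
    using countable_dense_exists by metis
  have "D \<noteq> {}" using D(2)[of UNIV] by auto
  define B where "B j = ball (from_nat_into D (fst (prod_decode j))) (1 / real (Suc (snd (prod_decode j))))" for j
  define c where "c x = (\<Sum>j. indicator (B j) x * (1/3)^j :: real)" for x
  have B_cover: "\<exists>j. x \<in> B j \<and> snd (prod_decode j) = m" for x m
  proof -
    have "\<exists>d\<in>D. d \<in> ball x (1 / real (Suc m))" by (rule D(2)) auto
    then obtain d where d: "d \<in> D" "dist x d < 1 / real (Suc m)" by auto
    obtain i where "from_nat_into D i = d" using from_nat_into_surj[OF D(1) d(1)] by auto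
    with d show ?thesis
      by (intro exI[of _ "prod_encode (i, m)"]) (auto simp: B_def dist_commute)
  qed
  have sm0: "summable (\<lambda>i. (1/3::real)^i)" by simp
  have sm: "summable (\<lambda>j. indicator (B j) x * (1/3)^j :: real)" for x
    by (rule summable_comparison_test[OF _ sm0]) (auto simp: indicator_def)
  have c_meas: "c \<in> borel_measurable borel"
    unfolding c_def[abs_def] B_def
    by (intro borel_measurable_suminf borel_measurable_times borel_measurable_indicator) auto
  have c_bound: "c x \<in> {0..2}" for x
  proof -
    have "c x \<le> (\<Sum>i. (1/3::real)^i)" unfolding c_def
      by (intro suminf_le sm sm0) (auto simp: indicator_def)
    also have "\<dots> = 3/2" by (subst suminf_geometric) auto
    finally have "c x \<le> 2" by simp
    moreover have "0 \<le> c x" unfolding c_def by (intro suminf_nonneg sm) auto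
    ultimately show ?thesis by simp
  qed
  have uc: "\<exists>d>0. \<forall>x y. \<bar>c x - c y\<bar> < d \<longrightarrow> dist x y < e" if "e > 0" for e
  proof -
    obtain m where m: "1 / real (Suc m) < e/2"
      using nat_approx_posE[of "e/2"] \<open>e > 0\<close> by auto
    let ?I = "{j. snd (prod_decode j) = m}"
    have "x \<in> \<Union>(B ` ?I)" for x using B_cover[of x m] by auto
    then have "UNIV \<subseteq> \<Union>(B ` ?I)" by auto
    moreover have "\<And>S. S \<in> B ` ?I \<Longrightarrow> open S" by (auto simp: B_def)
    ultimately obtain \<F> where F: "\<F> \<subseteq> B ` ?I" "finite \<F>" "UNIV \<subseteq> \<Union>\<F>"
      using compactE[OF cpt] by metis
    obtain I where I: "I \<subseteq> ?I" "finite I" "\<F> = B ` I"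
      using finite_subset_image[OF F(2,1)] by blast
    define J where "J = Max (insert 0 I)"
    have "dist x y < e" if xy: "\<bar>c x - c y\<bar> < (1/3)^J / 2" for x y
    proof -
      obtain j where j: "j \<in> I" "x \<in> B j" using F(3) I(3) by blast
      have "j \<le> J" unfolding J_def using j I(2) by auto
      let ?a = "\<lambda>j. indicator (B j) x - indicator (B j) y :: real"
      have "c x - c y = (\<Sum>j. ?a j * (1/3)^j)"
        unfolding c_def by (subst suminf_diff[OF sm sm]) (simp add: algebra_simps)
      with xy have "\<bar>\<Sum>j. ?a j * (1/3)^j\<bar> < (1/3)^J / 2" by simp
      then have "?a j = 0"
        by (intro ternary_series_separates[where a="?a" and J=J]) (auto simp: indicator_def \<open>j \<le> J\<close>)
      with j have "y \<in> B j" by (auto simp: indicator_def split: if_splits)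
      moreover have "snd (prod_decode j) = m" using I(1) j(1) by auto
      ultimately have "dist (from_nat_into D (fst (prod_decode j))) x < e/2"
          "dist (from_nat_into D (fst (prod_decode j))) y < e/2"
        using j(2) m unfolding B_def mem_ball by auto
      then show ?thesis by (rule dist_triangle_half_r)
    qed
    then show ?thesis by (intro exI[of _ "(1/3)^J / 2"]) auto
  qed
  have inj: "inj c"
  proof (rule injI, rule ccontr)
    fix x y assume "c x = c y" "x \<noteq> y"
    then obtain d where "d > 0" "\<And>x' y'. \<bar>c x' - c y'\<bar> < d \<Longrightarrow> dist x' y' < dist x y"
      using uc[of "dist x y"] by auto
    from this(2)[of x y] this(1) \<open>c x = c y\<close> show False by simp
  qed
  have "uniformly_continuous_on (range c) (inv c)"
    unfolding uniformly_continuous_on_def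
  proof (intro allI impI)
    fix e :: real assume "e > 0"
    from uc[OF this] obtain d where "d > 0" "\<And>x y. \<bar>c x - c y\<bar> < d \<Longrightarrow> dist x y < e" by blast
    then show "\<exists>d>0. \<forall>x\<in>range c. \<forall>x'\<in>range c. dist x' x < d \<longrightarrow> dist (inv c x') (inv c x) < e"
      using inj by (intro exI[of _ d]) (auto simp: dist_real_def inv_f_f)
  qed
  then obtain g0 where g0: "uniformly_continuous_on (closure (range c)) g0"
    "\<And>x. x \<in> range c \<Longrightarrow> inv c x = g0 x"
    using uniformly_continuous_on_extension_on_closure by metis
  have cont: "continuous_on (closure (range c)) g0"
    using g0(1) by (rule uniformly_continuous_imp_continuous)
  define g where "g r = (if r \<in> closure (range c) then g0 r else undefined)" for r
  show ?thesis
  proof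
    show "c \<in> borel_measurable borel" by fact
    show "closed (closure (range c))" "range c \<subseteq> closure (range c)" by (auto simp: closure_subset)
    show "closure (range c) \<subseteq> {0..2}" using c_bound by (intro closure_minimal) auto
    show "continuous_on (closure (range c)) g"
      using cont by (rule continuous_on_eq) (simp add: g_def)
    show "g \<in> borel_measurable borel"
      unfolding g_def[abs_def]
      by (rule borel_measurable_continuous_on_if) (use cont in auto)
    show "g (c x) = x" for x
      using g0(2)[of "c x"] inj closure_subset[of "range c"] by (auto simp: g_def inv_f_f)
  qed
qed

lemma bounded_of_compact_UNIV:
  fixes f :: "'b::topological_space \<Rightarrow> 'c::real_normed_vector"
  assumes "compact (UNIV :: 'b set)" "continuous_on UNIV f"
  obtains B where "\<And>x. norm (f x) \<le> B"
  using compact_imp_bounded[OF compact_continuous_image[OF assms(2,1)]]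
  unfolding bounded_iff by auto

text \<open>
  Push the measures to the real line by the code, select a weakly convergent subsequence there, and
  pull the limit back by the continuous decoding map.
\<close>

lemma weak_sequential_compactness:
  fixes \<gamma> :: "nat \<Rightarrow> 'b::{complete_space, second_countable_topology} measure"
  assumes cpt: "compact (UNIV :: 'b set)"
    and prob: "\<And>n. prob_space (\<gamma> n)" and sets: "\<And>n. sets (\<gamma> n) = sets borel"
  obtains r M where "strict_mono (r :: nat \<Rightarrow> nat)" "prob_space M" "sets M = sets borel"
    "\<And>f :: 'b \<Rightarrow> real. continuous_on UNIV f \<Longrightarrow> (\<lambda>n. \<integral>x. f x \<partial>\<gamma> (r n)) \<longlonglongrightarrow> (\<integral>x. f x \<partial>M)"
proof -
  obtain c :: "'b \<Rightarrow> real" and g C where c: "c \<in> borel_measurable borel" and C: "closed C" "range c \<subseteq> C" "C \<subseteq> {0..2}"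
    and g: "continuous_on C g" "g \<in> borel_measurable borel" "\<And>x. g (c x) = x"
    using compact_real_coding[OF cpt] by metis
  have c': "c \<in> borel_measurable (\<gamma> n)" for n using c by (simp add: measurable_cong_sets[OF sets])
  have c02: "-1 < c x" "c x \<le> 2" for x
    using subsetD[OF C(3) subsetD[OF C(2) rangeI[of c x]]] by auto
  define \<nu> where "\<nu> n = distr (\<gamma> n) borel c" for n
  have \<nu>: "real_distribution (\<nu> n)" for n
    unfolding \<nu>_def using prob_space.real_distribution_distr[OF prob c'] .
  have "tight \<nu>"
    unfolding tight_def
  proof (intro conjI allI impI \<nu>)
    fix \<epsilon> :: real assume "\<epsilon> > 0"
    have "measure (\<nu> n) {-1<..2} = 1" for n
    proof -
      have "measure (\<nu> n) {-1<..2} = measure (\<gamma> n) (c -` {-1<..2} \<inter> space (\<gamma> n))"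
        unfolding \<nu>_def by (rule measure_distr[OF c']) simp
      also have "c -` {-1<..2} \<inter> space (\<gamma> n) = space (\<gamma> n)" using c02 by auto
      finally show ?thesis using prob_space.prob_space[OF prob] by simp
    qed
    then show "\<exists>a b. a < b \<and> (\<forall>n. measure (\<nu> n) {a<..b} > 1 - \<epsilon>)"
      using \<open>\<epsilon> > 0\<close> by (intro exI[of _ "-1"] exI[of _ 2]) auto
  qed
  from tight_imp_convergent_subsubsequence[OF this strict_mono_id]
  obtain r M where r: "strict_mono r" and M: "real_distribution M" and w: "weak_conv_m (\<nu> \<circ> r) M"
    by (auto simp: o_def)
  interpret M: real_distribution M by fact
  have lim: "(\<lambda>n. \<integral>x. k (c x) \<partial>\<gamma> (r n)) \<longlonglongrightarrow> (\<integral>x. k x \<partial>M)"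
    if k: "continuous_on UNIV k" "\<And>x. \<bar>k x\<bar> \<le> B" for k :: "real \<Rightarrow> real" and B
  proof -
    have "(\<lambda>n. \<integral>x. k x \<partial>(\<nu> \<circ> r) n) \<longlonglongrightarrow> (\<integral>x. k x \<partial>M)"
      by (rule weak_conv_imp_integral_bdd_continuous_conv[OF _ M w])
         (use \<nu> k in \<open>auto simp: continuous_on_eq_continuous_at o_def\<close>)
    also have "(\<lambda>n. \<integral>x. k x \<partial>(\<nu> \<circ> r) n) = (\<lambda>n. \<integral>x. k (c x) \<partial>\<gamma> (r n))"
      unfolding \<nu>_def o_def using k(1)
      by (intro ext integral_distr[OF c']) (auto intro: borel_measurable_continuous_onI)
    finally show ?thesis .
  qed
  have "C \<noteq> {}" using C by auto
  have AE_C: "AE x in M. x \<in> C"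
  proof -
    let ?k = "\<lambda>x. min 1 (infdist x C)"
    have contk: "continuous_on UNIV ?k" by (intro continuous_intros)
    have "(\<lambda>n. \<integral>x. ?k (c x) \<partial>\<gamma> (r n)) \<longlonglongrightarrow> (\<integral>x. ?k x \<partial>M)"
      by (rule lim[OF contk, of 1]) (auto simp: infdist_nonneg)
    moreover have "?k (c x) = 0" for x using C by (auto simp: image_subset_iff)
    ultimately have "(\<integral>x. ?k x \<partial>M) = 0" by (simp add: LIMSEQ_const_iff)
    moreover have "integrable M ?k"
      by (rule M.integrable_const_bound[where B=1])
         (auto simp: infdist_nonneg intro!: M.measurable_finite_borel borel_measurable_continuous_onI[OF contk])
    ultimately have "AE x in M. ?k x = 0"
      by (subst (asm) integral_nonneg_eq_0_iff_AE) (auto simp: infdist_nonneg)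
    then show ?thesis
    proof (eventually_elim)
      case (elim x)
      then have "infdist x C = 0" by (auto simp: min_def split: if_splits)
      then show ?case using in_closed_iff_infdist_zero[OF C(1) \<open>C \<noteq> {}\<close>] by simp
    qed
  qed
  have gM: "g \<in> measurable M borel" using g(2) by (simp add: measurable_cong_sets[OF M.events_eq_borel])
  show ?thesis
  proof (rule that)
    show "strict_mono r" by fact
    show "prob_space (distr M borel g)" by (rule M.prob_space_distr[OF gM])
    show "sets (distr M borel g) = sets borel" by simp
    fix f :: "'b \<Rightarrow> real" assume f: "continuous_on UNIV f"
    obtain B where B: "\<And>x. norm (f x) \<le> B" using bounded_of_compact_UNIV[OF cpt f] by blast
    have B0: "0 \<le> B" using B[of undefined] norm_ge_zero order_trans by blast
    have fg: "continuous_on C (f \<circ> g)"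
      by (rule continuous_on_compose[OF g(1)]) (use f continuous_on_subset in blast)
    obtain k where k: "continuous_on UNIV k" "\<And>x. x \<in> C \<Longrightarrow> k x = (f \<circ> g) x" "\<And>x. norm (k x) \<le> B"
      using Tietze[OF fg _ B0, of UNIV] C(1) B by (auto simp: closedin_closed_eq)
    have "(\<lambda>n. \<integral>x. k (c x) \<partial>\<gamma> (r n)) \<longlonglongrightarrow> (\<integral>x. k x \<partial>M)"
      by (rule lim[OF k(1)]) (use k(3) in auto)
    also have "(\<lambda>n. \<integral>x. k (c x) \<partial>\<gamma> (r n)) = (\<lambda>n. \<integral>x. f x \<partial>\<gamma> (r n))"
      using k(2) C(2) g(3) by (auto simp: image_subset_iff)
    also have "(\<integral>x. k x \<partial>M) = (\<integral>x. f (g x) \<partial>M)"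
      by (rule integral_cong_AE)
        (use AE_C k(2) f k(1) gM in \<open>auto intro!: M.measurable_finite_borel borel_measurable_continuous_onI measurable_compose[OF gM]\<close>)
    also have "\<dots> = (\<integral>x. f x \<partial>distr M borel g)"
      by (rule integral_distr[symmetric, OF gM]) (use f in \<open>auto intro: borel_measurable_continuous_onI\<close>)
    finally show "(\<lambda>n. \<integral>x. f x \<partial>\<gamma> (r n)) \<longlonglongrightarrow> (\<integral>x. f x \<partial>distr M borel g)" .
  qed
qed

lemma prob_measure_eqI_continuous:
  fixes M N :: "'b::metric_space measure"
  assumes M: "prob_space M" "sets M = sets borel" and N: "prob_space N" "sets N = sets borel"
    and eq: "\<And>f :: 'b \<Rightarrow> real. continuous_on UNIV f \<Longrightarrow> (\<And>x. 0 \<le> f x \<and> f x \<le> 1) \<Longrightarrow> (\<integral>x. f x \<partial>M) = (\<integral>x. f x \<partial>N)"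
  shows "M = N"
proof (rule measure_eqI_generator_eq[where \<Omega>=UNIV and E="Collect closed" and A="\<lambda>_. UNIV"])
  interpret M: prob_space M by fact
  interpret N: prob_space N by fact
  show "sets M = sigma_sets UNIV (Collect closed)" "sets N = sigma_sets UNIV (Collect closed)"
    using M(2) N(2) by (simp_all add: borel_eq_closed)
  show "Int_stable (Collect closed :: 'b set set)" by (auto simp: Int_stable_def)
  show "emeasure M UNIV \<noteq> \<infinity>" for i :: nat by simp
  fix S :: "'b set" assume "S \<in> Collect closed"
  then have S: "closed S" by simp
  have key: "measure M S = measure N S"
  proof (cases "S = {}")
    case False
    define f where "f n x = max 0 (1 - real n * infdist x S)" for n x
    have cf: "continuous_on UNIV (f n)" for n unfolding f_def by (intro continuous_intros)
    have bf: "0 \<le> f n x \<and> f n x \<le> 1" for n x unfolding f_def by (auto simp: infdist_nonneg)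
    have limf: "(\<lambda>n. f n x) \<longlonglongrightarrow> indicator S x" for x
    proof (cases "x \<in> S")
      case True
      then show ?thesis by (simp add: f_def)
    next
      case False
      then have "infdist x S > 0"
        using in_closed_iff_infdist_zero[OF S \<open>S \<noteq> {}\<close>, of x] infdist_nonneg[of x S] by linarith
      then obtain n0 where n0: "1 < real n0 * infdist x S" using reals_Archimedean3 by blast
      have "f n x = 0" if "n \<ge> n0" for n
      proof -
        have "real n0 * infdist x S \<le> real n * infdist x S"
          using that by (intro mult_right_mono) (auto simp: infdist_nonneg)
        then show ?thesis using n0 by (auto simp: f_def)
      qed
      then have "eventually (\<lambda>n. f n x = 0) sequentially" unfolding eventually_sequentially by blast
      then show ?thesis using False by (simp add: tendsto_eventually)
    qed
    have lim: "(\<lambda>n. \<integral>x. f n x \<partial>L) \<longlonglongrightarrow> measure L S" if "prob_space L" "sets L = sets borel" for L :: "'b measure"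
    proof -
      interpret L: prob_space L by fact
      have SL: "S \<in> sets L" using S that by auto
      have "(\<lambda>n. \<integral>x. f n x \<partial>L) \<longlonglongrightarrow> (\<integral>x. indicator S x \<partial>L)"
        by (rule integral_dominated_convergence[where w="\<lambda>_. 1"])
          (use limf bf SL borel_measurable_continuous_onI[OF cf] that(2) in \<open>auto cong: measurable_cong_sets\<close>)
      then show ?thesis using SL by simp
    qed
    have "(\<lambda>n. \<integral>x. f n x \<partial>M) = (\<lambda>n. \<integral>x. f n x \<partial>N)"
      using eq[OF cf bf] by auto
    then show ?thesis using lim[OF M] lim[OF N] LIMSEQ_unique by metis
  qed simp
  then show "emeasure M S = emeasure N S"
    by (simp add: M.emeasure_eq_measure N.emeasure_eq_measure)
qed auto

text \<open>
  The marginal of a measure restricted to a strip, evaluated at a set, is its value at a rectangle.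
\<close>

lemma emeasure_distr_density_fst:
  assumes "sets \<gamma> = sets (borel :: ('a::second_countable_topology \<times> 'b::second_countable_topology) measure)"
    and "A \<in> sets borel" "B \<in> sets borel"
  shows "emeasure (distr (density \<gamma> (indicator (UNIV \<times> B))) borel fst) A = emeasure \<gamma> (A \<times> B)"
    and "emeasure (distr (density \<gamma> (indicator (A \<times> UNIV))) borel snd) B = emeasure \<gamma> (A \<times> B)"
proof -
  have sp: "space \<gamma> = UNIV" using sets_eq_imp_space_eq[OF assms(1)] by simp
  have prod: "C \<times> D \<in> sets \<gamma>" if "C \<in> sets borel" "D \<in> sets borel" for C :: "'a set" and D :: "'b set"
    using pair_measureI[OF that] by (simp add: assms(1) borel_prod[symmetric])
  have sets_density: "sets (density \<gamma> w) = sets (borel \<Otimes>\<^sub>M borel)" for w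
    using assms(1) by (simp add: borel_prod[symmetric])
  have fst: "fst \<in> measurable (density \<gamma> w) borel" and snd: "snd \<in> measurable (density \<gamma> w) borel" for w
    by (simp_all add: measurable_cong_sets[OF sets_density refl])
  have "emeasure (distr (density \<gamma> (indicator (UNIV \<times> B))) borel fst) A
      = emeasure (density \<gamma> (indicator (UNIV \<times> B))) (A \<times> UNIV)"
    by (subst emeasure_distr[OF fst]) (use assms sp in \<open>auto intro!: arg_cong2[where f=emeasure]\<close>)
  also have "\<dots> = (\<integral>\<^sup>+p. indicator (UNIV \<times> B) p * indicator (A \<times> UNIV) p \<partial>\<gamma>)"
    by (rule emeasure_density) (use assms prod in auto)
  also have "\<dots> = (\<integral>\<^sup>+p. indicator (A \<times> B) p \<partial>\<gamma>)"
    by (rule nn_integral_cong) (auto simp: indicator_def)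
  also have "\<dots> = emeasure \<gamma> (A \<times> B)" using assms prod by simp
  finally show "emeasure (distr (density \<gamma> (indicator (UNIV \<times> B))) borel fst) A = emeasure \<gamma> (A \<times> B)" .
  have "emeasure (distr (density \<gamma> (indicator (A \<times> UNIV))) borel snd) B
      = emeasure (density \<gamma> (indicator (A \<times> UNIV))) (UNIV \<times> B)"
    by (subst emeasure_distr[OF snd]) (use assms sp in \<open>auto intro!: arg_cong2[where f=emeasure]\<close>)
  also have "\<dots> = (\<integral>\<^sup>+p. indicator (A \<times> UNIV) p * indicator (UNIV \<times> B) p \<partial>\<gamma>)"
    by (rule emeasure_density) (use assms prod in auto)
  also have "\<dots> = (\<integral>\<^sup>+p. indicator (A \<times> B) p \<partial>\<gamma>)"
    by (rule nn_integral_cong) (auto simp: indicator_def)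
  also have "\<dots> = emeasure \<gamma> (A \<times> B)" using assms prod by simp
  finally show "emeasure (distr (density \<gamma> (indicator (A \<times> UNIV))) borel snd) B = emeasure \<gamma> (A \<times> B)" .
qed

lemma measure_eqI_rectangles:
  fixes M N :: "('a::second_countable_topology \<times> 'b::second_countable_topology) measure"
  assumes "finite_measure M" "sets M = sets borel" "sets N = sets borel"
    and "\<And>A B. A \<in> sets borel \<Longrightarrow> B \<in> sets borel \<Longrightarrow> emeasure M (A \<times> B) = emeasure N (A \<times> B)"
  shows "M = N"
proof (rule measure_eqI_generator_eq[where \<Omega>=UNIV and A="\<lambda>_. UNIV"
      and E="{a \<times> b |a b. a \<in> sets (borel :: 'a measure) \<and> b \<in> sets (borel :: 'b measure)}"])
  have *: "sets (borel :: ('a \<times> 'b) measure)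
      = sigma_sets UNIV {a \<times> b |a b. a \<in> sets (borel :: 'a measure) \<and> b \<in> sets (borel :: 'b measure)}"
    by (simp add: borel_prod[symmetric] sets_pair_measure)
  show "sets M = sigma_sets UNIV {a \<times> b |a b. a \<in> sets (borel :: 'a measure) \<and> b \<in> sets (borel :: 'b measure)}"
    "sets N = sigma_sets UNIV {a \<times> b |a b. a \<in> sets (borel :: 'a measure) \<and> b \<in> sets (borel :: 'b measure)}"
    using assms(2,3) * by simp_all
  show "Int_stable {a \<times> b |a b. a \<in> sets (borel :: 'a measure) \<and> b \<in> sets (borel :: 'b measure)}"
    by (rule Int_stable_pair_measure_generator)
  show "emeasure M UNIV \<noteq> \<infinity>" for i :: nat
    using finite_measure.emeasure_finite[OF assms(1)] by simp
  show "emeasure M X = emeasure N X"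
    if "X \<in> {a \<times> b |a b. a \<in> sets (borel :: 'a measure) \<and> b \<in> sets (borel :: 'b measure)}" for X
    using that assms(4) by auto
qed (auto intro!: exI[of _ UNIV])

text \<open>
  The conditional distribution functions come from Radon--Nikodym derivatives at rational levels.
  Taking the infimum over all rationals above the level makes them monotone and right continuous
  for every \<open>x\<close>, and the bounded support fixes their limits; only the identification with the
  given measure uses almost-everywhere statements.
\<close>

lemma disintegration_real:
  fixes \<gamma> :: "('a::second_countable_topology \<times> real) measure"
  assumes prob: "prob_space \<gamma>" and sets: "sets \<gamma> = sets borel"
    and supp: "AE p in \<gamma>. 0 \<le> snd p \<and> snd p \<le> 2"
  obtains Q where "Q \<in> measurable borel (prob_algebra borel)"
    "\<gamma> = bind (distr \<gamma> borel fst) (\<lambda>x. distr (Q x) borel (Pair x))"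
proof -
  interpret \<gamma>: prob_space \<gamma> by fact
  have [measurable_cong]: "sets \<gamma> = sets (borel \<Otimes>\<^sub>M borel)" using sets by (simp add: borel_prod[symmetric])
  have sp: "space \<gamma> = UNIV" using sets_eq_imp_space_eq[OF sets] by simp
  have prod: "C \<times> D \<in> sets \<gamma>" if "C \<in> sets borel" "D \<in> sets borel" for C :: "'a set" and D :: "real set"
    using pair_measureI[OF that] by (simp add: sets borel_prod[symmetric])
  define \<mu> where "\<mu> = distr \<gamma> borel fst"
  have fst: "fst \<in> measurable \<gamma> borel" by measurable
  interpret \<mu>: prob_space \<mu> unfolding \<mu>_def by (rule \<gamma>.prob_space_distr[OF fst])
  have sets\<mu>[measurable_cong]: "sets \<mu> = sets borel" by (simp add: \<mu>_def)
  have spm: "space \<mu> = UNIV" by (simp add: \<mu>_def)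
  have em_\<mu>: "emeasure \<mu> A = emeasure \<gamma> (A \<times> UNIV)" if "A \<in> sets borel" for A
    unfolding \<mu>_def by (subst emeasure_distr[OF fst]) (use that sp in \<open>auto intro!: arg_cong2[where f=emeasure]\<close>)
  define \<nu> where "\<nu> S = distr (density \<gamma> (indicator (UNIV \<times> S))) borel fst" for S :: "real set"
  have \<nu>: "emeasure (\<nu> S) A = emeasure \<gamma> (A \<times> S)" if "A \<in> sets borel" "S \<in> sets borel" for A S
    unfolding \<nu>_def using emeasure_distr_density_fst(1)[OF sets that] .
  have sets\<nu>: "sets (\<nu> S) = sets borel" for S by (simp add: \<nu>_def)
  have ac: "absolutely_continuous \<mu> (\<nu> S)" if "S \<in> sets borel" for S
    unfolding absolutely_continuous_def null_sets_def
  proof (safe)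
    fix A assume A: "A \<in> sets \<mu>" "emeasure \<mu> A = 0"
    then have "emeasure \<gamma> (A \<times> S) \<le> 0"
      using em_\<mu>[of A] emeasure_mono[of "A \<times> S" "A \<times> UNIV" \<gamma>] prod[of A UNIV] by (auto simp: \<mu>_def)
    then show "emeasure (\<nu> S) A = 0" using A \<nu>[of A S] that by (simp add: \<mu>_def)
  qed (simp add: \<mu>_def \<nu>_def)
  define f where "f S = RN_deriv \<mu> (\<nu> S)" for S
  have f_meas[measurable]: "f S \<in> borel_measurable borel" for S
    using borel_measurable_RN_deriv[of \<mu> "\<nu> S"] by (simp add: f_def)
  have f_unique: "AE x in \<mu>. g x = f S x"
    if "g \<in> borel_measurable borel" "S \<in> sets borel"
      "\<And>A. A \<in> sets borel \<Longrightarrow> (\<integral>\<^sup>+x. g x * indicator A x \<partial>\<mu>) = emeasure \<gamma> (A \<times> S)" for g S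
    unfolding f_def
  proof (rule \<mu>.RN_deriv_unique)
    show "g \<in> borel_measurable \<mu>" using that(1) by simp
    show "density \<mu> g = \<nu> S"
    proof (rule measure_eqI)
      fix A assume "A \<in> sets (density \<mu> g)"
      then have A: "A \<in> sets borel" by (simp add: sets\<mu>)
      have "emeasure (density \<mu> g) A = (\<integral>\<^sup>+x. g x * indicator A x \<partial>\<mu>)"
        using that(1) A by (intro emeasure_density) (simp_all add: sets\<mu>)
      then show "emeasure (density \<mu> g) A = emeasure (\<nu> S) A"
        using that(3)[OF A] \<nu>[OF A that(2)] by simp
    qed (simp add: sets\<mu> sets\<nu>)
  qed
  have f_int: "(\<integral>\<^sup>+x. f S x * indicator A x \<partial>\<mu>) = emeasure \<gamma> (A \<times> S)"
    if "A \<in> sets borel" "S \<in> sets borel" for A S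
  proof -
    have "density \<mu> (f S) = \<nu> S"
      unfolding f_def by (rule \<mu>.density_RN_deriv[OF ac]) (use that in \<open>auto simp: sets\<nu> \<mu>_def\<close>)
    then have "emeasure (density \<mu> (f S)) A = emeasure \<gamma> (A \<times> S)" using \<nu> that by simp
    then show ?thesis using that by (subst (asm) emeasure_density) auto
  qed
  have f_add: "AE x in \<mu>. f S x + f S' x = f (S \<union> S') x"
    if S: "S \<in> sets borel" "S' \<in> sets borel" "S \<inter> S' = {}" for S S'
  proof (rule f_unique)
    show "(\<integral>\<^sup>+x. (f S x + f S' x) * indicator A x \<partial>\<mu>) = emeasure \<gamma> (A \<times> (S \<union> S'))"
      if A: "A \<in> sets borel" for A
    proof -
      have "(\<integral>\<^sup>+x. (f S x + f S' x) * indicator A x \<partial>\<mu>)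
          = (\<integral>\<^sup>+x. f S x * indicator A x \<partial>\<mu>) + (\<integral>\<^sup>+x. f S' x * indicator A x \<partial>\<mu>)"
        using A by (subst nn_integral_add[symmetric]) (auto simp: distrib_right)
      also have "\<dots> = emeasure \<gamma> (A \<times> S) + emeasure \<gamma> (A \<times> S')" using f_int A S by simp
      also have "\<dots> = emeasure \<gamma> (A \<times> S \<union> A \<times> S')"
        using S A prod by (intro plus_emeasure) auto
      also have "A \<times> S \<union> A \<times> S' = A \<times> (S \<union> S')" by auto
      finally show ?thesis .
    qed
  qed (use S in auto)
  have f_mono: "AE x in \<mu>. f S x \<le> f S' x"
    if "S \<in> sets borel" "S' \<in> sets borel" "S \<subseteq> S'" for S S'
  proof -
    have "S \<union> (S' - S) = S'" using that by auto
    then have "AE x in \<mu>. f S x + f (S' - S) x = f S' x" using f_add[of S "S' - S"] that by auto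
    then show ?thesis by eventually_elim (metis le_iff_add)
  qed
  have f_full: "AE x in \<mu>. 1 = f S x" if "S \<in> sets borel" "{0..2} \<subseteq> S" for S
  proof (rule f_unique)
    fix A :: "'a set" assume A: "A \<in> sets borel"
    have "AE p in \<gamma>. p \<in> A \<times> UNIV \<longleftrightarrow> p \<in> A \<times> S"
      using supp by eventually_elim (use that in \<open>auto simp: subset_iff\<close>)
    then have "emeasure \<gamma> (A \<times> UNIV) = emeasure \<gamma> (A \<times> S)"
      using A that prod by (intro emeasure_eq_AE) auto
    then show "(\<integral>\<^sup>+x. 1 * indicator A x \<partial>\<mu>) = emeasure \<gamma> (A \<times> S)"
      using A em_\<mu> by simp
  qed (use that in auto)
  have f_null: "AE x in \<mu>. 0 = f S x" if "S \<in> sets borel" "S \<inter> {0..2} = {}" for S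
  proof (rule f_unique)
    fix A :: "'a set" assume A: "A \<in> sets borel"
    have "AE p in \<gamma>. p \<notin> A \<times> S"
      using supp by eventually_elim (use that in auto)
    then have "emeasure \<gamma> (A \<times> S) = 0"
      using A that prod[of A S] by (subst (asm) AE_iff_measurable[of "A \<times> S"]) (auto simp: sp)
    then show "(\<integral>\<^sup>+x. 0 * indicator A x \<partial>\<mu>) = emeasure \<gamma> (A \<times> S)" by simp
  qed (use that in auto)
  \<comment> \<open>values outside the support are prescribed, so that distribution functions arise for every \<open>x\<close>\<close>
  define k where "k q x = (if q < 0 then 0 else if 2 \<le> q then 1 else min 1 (enn2real (f {..q} x)))" for q x
  have k_meas[measurable]: "k q \<in> borel_measurable borel" for q unfolding k_def by measurable
  have k01: "0 \<le> k q x \<and> k q x \<le> 1" for q x by (auto simp: k_def)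
  have k_f: "AE x in \<mu>. ennreal (k q x) = f {..q} x" for q
  proof -
    have fle: "AE x in \<mu>. f {..q} x \<le> 1"
      using f_mono[of "{..q}" UNIV] f_full[of UNIV] by (auto elim: eventually_elim2)
    show ?thesis
    proof (cases "q < 0")
      case True
      then show ?thesis using f_null[of "{..q}"] by (auto simp: k_def)
    next
      case q0: False
      show ?thesis
      proof (cases "2 \<le> q")
        case True
        then have "{0..2} \<subseteq> {..q}" by auto
        then show ?thesis using f_full[of "{..q}"] q0 True by (auto simp: k_def)
      next
        case False
        show ?thesis using fle
        proof eventually_elim
          case (elim x)
          then obtain r where "f {..q} x = ennreal r" "0 \<le> r" "r \<le> 1"
            by (cases "f {..q} x") (auto simp: top_unique)
          then show ?case using q0 False by (simp add: k_def)
        qed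
      qed
    qed
  qed
  have k_mono: "AE x in \<mu>. \<forall>q\<in>\<rat>. \<forall>q'\<in>\<rat>. q \<le> q' \<longrightarrow> k q x \<le> k q' x"
  proof -
    have "AE x in \<mu>. q \<le> q' \<longrightarrow> k q x \<le> k q' x" for q q'
    proof (cases "q \<le> q'")
      case True
      have "AE x in \<mu>. f {..q} x \<le> f {..q'} x" using True by (intro f_mono) auto
      then show ?thesis using k_f[of q] k_f[of q']
      proof eventually_elim
        case (elim x)
        then have "ennreal (k q x) \<le> ennreal (k q' x)" by simp
        then show ?case using k01 by (simp add: ennreal_le_iff)
      qed
    qed auto
    then show ?thesis by (intro AE_ball_countable[THEN iffD2] countable_rat ballI) auto
  qed
  have k_int: "(\<integral>x. indicator A x * k q x \<partial>\<mu>) = measure \<gamma> (A \<times> {..q})" if A: "A \<in> sets borel" for A q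
  proof -
    have "(\<integral>x. indicator A x * k q x \<partial>\<mu>) = enn2real (\<integral>\<^sup>+x. ennreal (indicator A x * k q x) \<partial>\<mu>)"
      using A k01 by (intro integral_eq_nn_integral) auto
    also have "(\<integral>\<^sup>+x. ennreal (indicator A x * k q x) \<partial>\<mu>) = (\<integral>\<^sup>+x. f {..q} x * indicator A x \<partial>\<mu>)"
      using k_f[of q] by (intro nn_integral_cong_AE) (auto elim!: eventually_mono simp: indicator_def)
    also have "\<dots> = emeasure \<gamma> (A \<times> {..q})" using A by (intro f_int) auto
    finally show ?thesis by (simp add: measure_def)
  qed
  define I where "I a = {q \<in> \<rat>. a < q}" for a :: real
  define F where "F x a = (INF q\<in>I a. k q x)" for x a
  have I_ne: "I a \<noteq> {}" for a using Rats_dense_in_real[of a "a+1"] by (auto simp: I_def)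
  have bdd: "bdd_below ((\<lambda>q. k q x) ` I a)" for x a using k01 by (auto intro!: bdd_belowI[of _ 0])
  have F_le: "F x a \<le> k q x" if "q \<in> \<rat>" "a < q" for x a q
    unfolding F_def using that by (intro cINF_lower bdd) (auto simp: I_def)
  have F_ge: "c \<le> F x a" if "\<And>q. q \<in> \<rat> \<Longrightarrow> a < q \<Longrightarrow> c \<le> k q x" for x a c
    unfolding F_def using that by (intro cINF_greatest I_ne) (auto simp: I_def)
  have F_less: "\<exists>q\<in>\<rat>. a < q \<and> k q x < c" if "F x a < c" for x a c
  proof (rule ccontr)
    assume "\<not> ?thesis"
    then have "c \<le> F x a" by (intro F_ge) force
    with that show False by simp
  qed
  have F_mono: "F x a \<le> F x b" if "a \<le> b" for x a b
    by (rule F_ge) (use that in \<open>auto intro: F_le\<close>)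
  have F_0: "F x a = 0" if "a < 0" for x a
  proof -
    obtain q where "q \<in> \<rat>" "a < q" "q < 0" using Rats_dense_in_real[OF \<open>a < 0\<close>] by auto
    then have "F x a \<le> 0" using F_le[of q a x] by (simp add: k_def)
    moreover have "0 \<le> F x a" using k01 by (intro F_ge) auto
    ultimately show ?thesis by simp
  qed
  have F_1: "F x a = 1" if "2 \<le> a" for x a
  proof -
    obtain q where q: "q \<in> \<rat>" "a < q" using I_ne by (auto simp: I_def)
    have "F x a \<le> 1" using F_le[OF q, of x] k01[of q x] by simp
    moreover have "1 \<le> F x a" by (intro F_ge) (use that in \<open>auto simp: k_def\<close>)
    ultimately show ?thesis by simp
  qed
  have F_right: "continuous (at_right a) (F x)" for x a
    unfolding continuous_within
  proof (rule order_tendstoI)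
    show "\<forall>\<^sub>F b in at_right a. c < F x b" if "c < F x a" for c
      using eventually_at_right_less[of a]
      by eventually_elim (use that F_mono less_imp_le in \<open>blast intro: less_le_trans\<close>)
    show "\<forall>\<^sub>F b in at_right a. F x b < c" if "F x a < c" for c
    proof -
      obtain q where q: "q \<in> \<rat>" "a < q" "k q x < c" using F_less[OF \<open>F x a < c\<close>] by auto
      have "\<forall>\<^sub>F b in at_right a. b < q" using q(2) by (rule order_tendstoD(2)[OF tendsto_ident_at])
      then show ?thesis by eventually_elim (use q F_le in \<open>blast intro: le_less_trans\<close>)
    qed
  qed
  have F_bot: "(F x \<longlongrightarrow> 0) at_bot" for x
    by (rule tendsto_eventually) (use F_0 in \<open>auto simp: eventually_at_bot_dense intro!: exI[of _ 0]\<close>)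
  have F_top: "(F x \<longlongrightarrow> 1) at_top" for x
    by (rule tendsto_eventually) (use F_1 in \<open>auto simp: eventually_at_top_linorder intro!: exI[of _ 2]\<close>)
  have F_meas: "(\<lambda>x. F x a) \<in> borel_measurable borel" for a
    unfolding F_def
  proof (rule borel_measurable_cINF)
    show "countable (I a)" by (rule countable_subset[OF _ countable_rat]) (auto simp: I_def)
  qed (use bdd in auto)
  have F01: "0 \<le> F x a \<and> F x a \<le> 1" for x a
    using F_0[of "min a (-1)" x] F_mono[of "min a (-1)" a x] F_1[of "max a 2" x] F_mono[of a "max a 2" x] by auto
  define Q where "Q x = interval_measure (F x)" for x
  have rdQ: "real_distribution (Q x)" for x
    unfolding Q_def by (rule real_distribution_interval_measure[OF F_mono F_right F_bot F_top])
  have emQ: "emeasure (Q x) {..a} = ennreal (F x a)" for x a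
    unfolding Q_def by (rule emeasure_interval_measure_Iic[OF F_mono F_right F_bot])
  have Q_meas: "Q \<in> measurable borel (prob_algebra borel)"
  proof (rule measurable_prob_algebra_generated[where \<Omega>=UNIV and G="range (\<lambda>a::real. {..a})"])
    show "sets borel = sigma_sets UNIV (range (\<lambda>a::real. {..a}))"
      by (simp add: borel_eq_atMost)
    show "Int_stable (range (\<lambda>a::real. {..a}))" by (auto simp: Int_stable_def)
    show "prob_space (Q a)" "sets (Q a) = sets borel" for a
      using rdQ by (auto simp: real_distribution_def real_distribution_axioms_def)
    show "(\<lambda>a. emeasure (Q a) A) \<in> borel_measurable borel" if "A \<in> range (\<lambda>a::real. {..a})" for A
      using that F_meas by (auto simp: emQ)
  qed auto
  define K where "K x = distr (Q x) borel (Pair x)" for x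
  have setsQ: "sets (Q x) = sets borel" for x by (simp add: Q_def)
  have Pm: "Pair x \<in> measurable (Q x) borel" for x
    using setsQ[of x] by (subst measurable_cong_sets[OF _ refl, of _ borel]) (auto simp: borel_prod[symmetric])
  have K_meas: "K \<in> measurable borel (prob_algebra borel)"
    unfolding K_def[abs_def]
    by (rule measurable_distr_prob_space2[OF Q_meas]) (simp add: borel_prod)
  have \<mu>_in: "\<mu> \<in> space (prob_algebra borel)" using \<mu>.prob_space_axioms by (simp add: space_prob_algebra \<mu>_def)
  define \<kappa> where "\<kappa> = bind \<mu> K"
  have \<kappa>: "prob_space \<kappa>" "sets \<kappa> = sets borel"
    unfolding \<kappa>_def using prob_space_bind'[OF \<mu>_in K_meas] sets_bind'[OF \<mu>_in K_meas] by auto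
  interpret \<kappa>: prob_space \<kappa> by fact
  have em_\<kappa>: "emeasure \<kappa> (A \<times> B) = (\<integral>\<^sup>+x. indicator A x * emeasure (Q x) B \<partial>\<mu>)"
    if "A \<in> sets borel" "B \<in> sets borel" for A B
  proof -
    have AB: "A \<times> B \<in> sets borel" using prod[OF that] sets by simp
    have "emeasure (K x) (A \<times> B) = indicator A x * emeasure (Q x) B" for x
    proof -
      have "Pair x -` (A \<times> B) \<inter> space (Q x) = (if x \<in> A then B else {})"
        using setsQ[THEN sets_eq_imp_space_eq] by auto
      then show ?thesis unfolding K_def using emeasure_distr[OF Pm AB, of x] by (auto simp: indicator_def)
    qed
    then show ?thesis
      unfolding \<kappa>_def by (subst emeasure_bind_prob_algebra[OF \<mu>_in K_meas AB]) simp
  qed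
  have "emeasure \<gamma> (A \<times> B) = emeasure \<kappa> (A \<times> B)" if A: "A \<in> sets borel" and B: "B \<in> sets borel" for A B
  proof -
    define slice where "slice L = distr (density L (indicator (A \<times> UNIV))) borel snd" for L :: "('a \<times> real) measure"
    have slice: "emeasure (slice L) B = emeasure L (A \<times> B)" if "sets L = sets borel" "B \<in> sets borel" for L B
      unfolding slice_def using emeasure_distr_density_fst(2)[OF that(1) A that(2)] .
    have fbm: "finite_borel_measure (slice L)" if "prob_space L" "sets L = sets borel" for L
    proof -
      interpret L: prob_space L by fact
      have "finite_measure (slice L)"
        using slice[OF that(2), of UNIV] by (intro finite_measureI) (auto simp: slice_def)
      then show ?thesis
        by (simp add: finite_borel_measure_def finite_borel_measure_axioms_def slice_def)
    qed
    have cdf: "cdf (slice L) a = measure L (A \<times> {..a})" if "sets L = sets borel" for L a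
      using slice[OF that, of "{..a}"] by (simp add: cdf_def measure_def)
    interpret S: finite_borel_measure "slice \<gamma>" by (rule fbm[OF prob sets])
    have "cdf (slice \<gamma>) a = cdf (slice \<kappa>) a" for a
    proof -
      have "\<exists>q\<in>\<rat>. a < q \<and> q < a + 1 / real (Suc n)" for n
        using Rats_dense_in_real[of a "a + 1 / real (Suc n)"] by auto
      then obtain q where q: "\<And>n. q n \<in> \<rat>" "\<And>n. a < q n" "\<And>n. q n < a + 1 / real (Suc n)" by metis
      have "(\<lambda>n. a + 1 / real (Suc n)) \<longlonglongrightarrow> a + 0"
        by (intro tendsto_intros LIMSEQ_Suc lim_1_over_n)
      then have qa: "q \<longlonglongrightarrow> a"
        using q by (intro tendsto_sandwich[of "\<lambda>_. a" q _ "\<lambda>n. a + 1 / real (Suc n)"]) (auto intro!: always_eventually less_imp_le)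
      have "(\<lambda>n. cdf (slice \<gamma>) (q n)) \<longlonglongrightarrow> cdf (slice \<gamma>) a"
      proof (rule filterlim_compose[OF S.cdf_is_right_cont[unfolded continuous_within, of a]])
        show "filterlim q (at_right a) sequentially"
          unfolding filterlim_at using qa q(2) less_imp_neq[OF q(2), THEN not_sym] by (simp add: always_eventually)
      qed
      then have l1: "(\<lambda>n. measure \<gamma> (A \<times> {..q n})) \<longlonglongrightarrow> measure \<gamma> (A \<times> {..a})"
        by (simp add: cdf[OF sets])
      have "AE x in \<mu>. (\<lambda>n. indicator A x * k (q n) x) \<longlonglongrightarrow> indicator A x * F x a"
        using k_mono
      proof eventually_elim
        case (elim x)
        have "(\<lambda>n. k (q n) x) \<longlonglongrightarrow> F x a"
        proof (rule order_tendstoI)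
          show "\<forall>\<^sub>F n in sequentially. c < k (q n) x" if "c < F x a" for c
            using less_le_trans[OF that F_le[OF q(1,2)]] by (simp add: always_eventually)
          show "\<forall>\<^sub>F n in sequentially. k (q n) x < c" if c: "F x a < c" for c
          proof -
            obtain q' where q': "q' \<in> \<rat>" "a < q'" "k q' x < c" using F_less[OF c] by auto
            have "\<forall>\<^sub>F n in sequentially. q n < q'" using order_tendstoD(2)[OF qa q'(2)] .
            then show ?thesis
              by eventually_elim (use elim q' q(1) in \<open>meson le_less_trans less_imp_le\<close>)
          qed
        qed
        then show ?case by (intro tendsto_intros)
      qed
      then have "(\<lambda>n. \<integral>x. indicator A x * k (q n) x \<partial>\<mu>) \<longlonglongrightarrow> (\<integral>x. indicator A x * F x a \<partial>\<mu>)"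
      proof (rule integral_dominated_convergence[where w="\<lambda>_. 1", rotated 3])
        show "AE x in \<mu>. norm (indicator A x * k (q n) x) \<le> 1" for n
          using k01 by (auto simp: indicator_def)
      qed (use A F_meas[of a] in auto)
      then have "measure \<gamma> (A \<times> {..a}) = (\<integral>x. indicator A x * F x a \<partial>\<mu>)"
        using l1 unfolding k_int[OF A] by (rule LIMSEQ_unique[rotated])
      also have "\<dots> = measure \<kappa> (A \<times> {..a})"
      proof -
        have "(\<integral>x. indicator A x * F x a \<partial>\<mu>) = enn2real (\<integral>\<^sup>+x. ennreal (indicator A x * F x a) \<partial>\<mu>)"
          using A F01 F_meas[of a] by (intro integral_eq_nn_integral) auto
        also have "(\<integral>\<^sup>+x. ennreal (indicator A x * F x a) \<partial>\<mu>) = (\<integral>\<^sup>+x. indicator A x * emeasure (Q x) {..a} \<partial>\<mu>)"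
          by (intro nn_integral_cong) (auto simp: emQ indicator_def)
        also have "\<dots> = emeasure \<kappa> (A \<times> {..a})" using em_\<kappa>[OF A] by simp
        finally show ?thesis by (simp add: measure_def)
      qed
      finally show ?thesis by (simp add: cdf[OF sets] cdf[OF \<kappa>(2)])
    qed
    then have "slice \<gamma> = slice \<kappa>" by (intro cdf_unique' fbm prob sets \<kappa> ext)
    then show ?thesis using slice[OF sets B] slice[OF \<kappa>(2) B] by simp
  qed
  then have "\<gamma> = \<kappa>" by (intro measure_eqI_rectangles \<gamma>.finite_measure_axioms sets \<kappa>(2))
  then show ?thesis using that[OF Q_meas] by (simp add: \<kappa>_def \<mu>_def K_def[abs_def])
qed

lemma disintegration:
  fixes \<gamma> :: "('a::second_countable_topology \<times> 'b::{complete_space, second_countable_topology}) measure"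
  assumes cpt: "compact (UNIV :: 'b set)" and prob: "prob_space \<gamma>" and sets: "sets \<gamma> = sets borel"
  obtains Q where "Q \<in> measurable borel (prob_algebra borel)"
    "\<gamma> = bind (distr \<gamma> borel fst) (\<lambda>x. distr (Q x) borel (Pair x))"
proof -
  interpret \<gamma>: prob_space \<gamma> by fact
  obtain c :: "'b \<Rightarrow> real" and g C where c[measurable]: "c \<in> borel_measurable borel" and C: "range c \<subseteq> C" "C \<subseteq> {0..2}"
    and g[measurable]: "g \<in> borel_measurable borel" and gc: "\<And>x. g (c x) = x"
    using compact_real_coding[OF cpt] by metis
  have c02: "0 \<le> c x" "c x \<le> 2" for x
    using subsetD[OF C(2) subsetD[OF C(1) rangeI[of c x]]] by auto
  have [measurable_cong]: "sets \<gamma> = sets (borel \<Otimes>\<^sub>M borel)" using sets by (simp add: borel_prod[symmetric])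
  define code where "code = (\<lambda>p :: 'a \<times> 'b. (fst p, c (snd p)))"
  define decode where "decode = (\<lambda>p :: 'a \<times> real. (fst p, g (snd p)))"
  have code: "code \<in> measurable \<gamma> borel"
    unfolding code_def borel_prod[symmetric] by measurable
  have decode: "decode \<in> measurable borel borel"
    unfolding decode_def borel_prod[symmetric] by measurable
  have fst: "fst \<in> measurable (borel :: ('a \<times> real) measure) borel"
    unfolding borel_prod[symmetric] by measurable
  define \<gamma>' where "\<gamma>' = distr \<gamma> borel code"
  have \<gamma>'_prob: "prob_space \<gamma>'" "sets \<gamma>' = sets borel" unfolding \<gamma>'_def by (simp_all add: \<gamma>.prob_space_distr[OF code])
  have \<gamma>'_supp: "AE p in \<gamma>'. 0 \<le> snd p \<and> snd p \<le> 2"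
  proof -
    have "{p. 0 \<le> snd p \<and> snd p \<le> 2} \<in> sets (borel :: ('a \<times> real) measure)"
      by (intro borel_closed closed_Collect_conj closed_Collect_le continuous_intros)
    then show ?thesis
      unfolding \<gamma>'_def by (subst AE_distr_iff[OF code]) (simp_all add: code_def c02)
  qed
  obtain Q' where Q': "Q' \<in> measurable borel (prob_algebra borel)"
    "\<gamma>' = bind (distr \<gamma>' borel fst) (\<lambda>x. distr (Q' x) borel (Pair x))"
    by (rule disintegration_real[OF \<gamma>'_prob \<gamma>'_supp]) (rule that)
  have setsQ': "sets (Q' x) = sets borel" for x
    using measurable_space[OF Q'(1), of x] by (simp add: space_prob_algebra)
  have marg: "distr \<gamma>' borel fst = distr \<gamma> borel fst"
    unfolding \<gamma>'_def by (subst distr_distr[OF fst code]) (simp add: o_def code_def)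
  have Pm: "Pair x \<in> measurable (borel :: 'c measure) (borel :: ('a \<times> 'c::second_countable_topology) measure)" for x :: 'a
    unfolding borel_prod[symmetric] by measurable
  have Pm': "Pair x \<in> measurable (Q' x) borel" for x
    using Pm[of x] by (simp add: measurable_cong_sets[OF setsQ' refl])
  have K: "(\<lambda>x. distr (Q' x) borel (Pair x)) \<in> measurable borel (subprob_algebra borel)"
    by (intro measurable_prob_algebraD measurable_distr_prob_space2[OF Q'(1)]) (simp add: borel_prod)
  have "\<gamma> = distr \<gamma>' borel decode"
  proof -
    have "decode \<circ> code = (\<lambda>p. p)" by (auto simp: decode_def code_def gc)
    then show ?thesis unfolding \<gamma>'_def using distr_id2[of borel \<gamma>] sets
      by (subst distr_distr[OF decode code]) simp
  qed
  also have "\<dots> = bind (distr \<gamma> borel fst) (\<lambda>x. distr (distr (Q' x) borel (Pair x)) borel decode)"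
    by (subst Q'(2), unfold marg, rule distr_bind[OF _ _ decode]) (use K in auto)
  also have "(\<lambda>x. distr (distr (Q' x) borel (Pair x)) borel decode)
      = (\<lambda>x. distr (distr (Q' x) borel g) borel (Pair x))"
  proof
    fix x
    have gm: "g \<in> measurable (Q' x) borel" using g by (simp add: measurable_cong_sets[OF setsQ' refl])
    have "decode \<circ> Pair x = Pair x \<circ> g" by (auto simp: decode_def)
    then show "distr (distr (Q' x) borel (Pair x)) borel decode = distr (distr (Q' x) borel g) borel (Pair x)"
      by (simp add: distr_distr[OF decode Pm'] distr_distr[OF Pm gm])
  qed
  finally show ?thesis
    using Q'(1) by (intro that[of "\<lambda>x. distr (Q' x) borel g"] measurable_distr_prob_space2[where M=borel]) auto
qed

text \<open>
  By second countability the complement of the support is a countable union of open null sets.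
\<close>

lemma AE_msupport:
  fixes M :: "'b::second_countable_topology measure"
  assumes "sets M = sets borel"
  shows "AE x in M. x \<in> msupport M"
proof -
  obtain B :: "'b set set" where B: "countable B" "topological_basis B" using ex_countable_basis by auto
  have op: "open b" if "b \<in> B" for b using topological_basis_open[OF B(2) that] .
  have "AE x in M. \<forall>b\<in>{b\<in>B. emeasure M b = 0}. x \<notin> b"
  proof (intro AE_ball_countable[THEN iffD2] ballI)
    show "countable {b\<in>B. emeasure M b = 0}" using B(1) by auto
    fix b assume "b \<in> {b\<in>B. emeasure M b = 0}"
    then have "b \<in> null_sets M" using op assms by (auto simp: null_sets_def)
    then show "AE x in M. x \<notin> b" by (rule AE_not_in)
  qed
  then show ?thesis
  proof eventually_elim
    case (elim x)
    show ?case unfolding msupport_def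
    proof (clarify)
      fix U assume U: "open U" "x \<in> U"
      obtain b where b: "b \<in> B" "x \<in> b" "b \<subseteq> U" using topological_basisE[OF B(2) U] by metis
      then have "emeasure M b \<noteq> 0" using elim by auto
      moreover have "emeasure M b \<le> emeasure M U" using b U assms by (intro emeasure_mono) auto
      ultimately show "0 < emeasure M U" by (metis not_gr_zero le_zero_eq)
    qed
  qed
qed

lemma (in prob_space) expectation_in_closed_convex:
  fixes f :: "'a \<Rightarrow> 'b::euclidean_space"
  assumes f: "integrable M f" and K: "convex K" "closed K" and AE: "AE x in M. f x \<in> K"
  shows "expectation f \<in> K"
proof (rule ccontr)
  assume "expectation f \<notin> K"
  then obtain a b where ab: "inner a (expectation f) < b" "\<And>x. x \<in> K \<Longrightarrow> inner a x > b"
    using separating_hyperplane_closed_point[OF K] by metis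
  have "b = (\<integral>x. b \<partial>M)" by (simp add: prob_space)
  also have "\<dots> \<le> (\<integral>x. inner a (f x) \<partial>M)"
  proof (rule integral_mono_AE)
    show "AE x in M. b \<le> inner a (f x)"
      using AE by eventually_elim (use ab(2) in \<open>auto intro: less_imp_le\<close>)
  qed (use f in auto)
  also have "\<dots> = inner a (expectation f)" using f by (rule integral_inner_right)
  finally show False using ab(1) by simp
qed

section \<open>Compactness of the rotation set\<close>

text \<open>
  A correspondence on a compact metric space with a continuous vector-valued potential on its graph.
\<close>

locale compact_correspondence =
  fixes T :: "'a::polish_space \<Rightarrow> 'a set" and \<psi> :: "'a \<times> 'a \<Rightarrow> real ^ 'd"
  assumes compact_UNIV: "compact (UNIV :: 'a set)"
    and corr: "correspondence T"
    and cont: "continuous_on (graph T) \<psi>"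
begin

text \<open>
  The two-coordinate distribution as a measure on the whole product; restricted to the graph it is
  \<^const>\<open>pair_law\<close>.
\<close>

definition joint_law :: "'a measure \<Rightarrow> ('a \<Rightarrow> 'a measure) \<Rightarrow> ('a \<times> 'a) measure" where
  "joint_law \<mu> Q = bind \<mu> (\<lambda>x. distr (Q x) borel (Pair x))"

text \<open>
  The compact convex set that contains all integrals of \<open>\<psi>\<close> and all orbit averages.
\<close>

definition value_hull :: "(real ^ 'd) set" where
  "value_hull = convex hull (\<psi> ` graph T)"

lemma closed_graph: "closed (graph T)"
  using corr by (simp add: correspondence_def)

lemma values_nonempty: "T x \<noteq> {}"
  using corr by (simp add: correspondence_def)

lemma graph_nonempty: "graph T \<noteq> {}"
  using values_nonempty[of undefined] by (auto simp: graph_def)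

lemma compact_UNIV_pair: "compact (UNIV :: ('a \<times> 'a) set)"
  using compact_Times[OF compact_UNIV compact_UNIV] by simp

lemma compact_graph: "compact (graph T)"
  using compact_Int_closed[OF compact_UNIV_pair closed_graph] by simp

lemma compact_value_hull: "compact value_hull"
  unfolding value_hull_def by (intro compact_convex_hull compact_continuous_image cont compact_graph)

lemma convex_value_hull: "convex value_hull"
  by (simp add: value_hull_def)

lemma value_in_hull: "p \<in> graph T \<Longrightarrow> \<psi> p \<in> value_hull"
  unfolding value_hull_def by (intro hull_inc) auto

text \<open>
  A continuous extension of \<open>\<psi>\<close> to the product, by which integrals over the graph become integrals
  of a continuous function on a compact space.
\<close>

definition \<psi>_ext :: "'a \<times> 'a \<Rightarrow> real ^ 'd" where
  "\<psi>_ext = (SOME f. continuous_on UNIV f \<and> (\<forall>p\<in>graph T. f p = \<psi> p))"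

lemma \<psi>_ext: "continuous_on UNIV \<psi>_ext" "p \<in> graph T \<Longrightarrow> \<psi>_ext p = \<psi> p"
proof -
  obtain g where "continuous_on UNIV g" "\<And>x. x \<in> graph T \<Longrightarrow> g x = \<psi> x"
    using Tietze_unbounded[OF cont, of UNIV] closed_graph by (auto simp: closedin_closed_eq)
  then have "\<exists>f. continuous_on UNIV f \<and> (\<forall>p\<in>graph T. f p = \<psi> p)" by blast
  from someI_ex[OF this] show "continuous_on UNIV \<psi>_ext" "p \<in> graph T \<Longrightarrow> \<psi>_ext p = \<psi> p"
    unfolding \<psi>_ext_def by auto
qed

lemma integrable_continuous:
  fixes f :: "'a \<times> 'a \<Rightarrow> 'c::{banach, second_countable_topology}"
  assumes "prob_space \<gamma>" "sets \<gamma> = sets borel" "continuous_on UNIV f"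
  shows "integrable \<gamma> f"
proof -
  interpret prob_space \<gamma> by fact
  obtain B where "\<And>x. norm (f x) \<le> B" using bounded_of_compact_UNIV[OF compact_UNIV_pair assms(3)] by blast
  then show ?thesis
    by (intro integrable_const_bound[where B=B])
       (auto simp: measurable_cong_sets[OF assms(2) refl] intro: borel_measurable_continuous_onI assms)
qed

lemma prob_kernelD:
  assumes "Q \<in> measurable borel (prob_algebra borel)"
  shows "sets (Q x) = sets borel" "prob_space (Q x)"
  using measurable_space[OF assms, of x] by (auto simp: space_prob_algebra)

lemma transition_kernelD:
  assumes "Q \<in> transition_kernels T"
  shows "Q \<in> measurable borel (prob_algebra borel)" "AE y in Q x. y \<in> T x"
proof -
  show Q: "Q \<in> measurable borel (prob_algebra borel)" using assms by (simp add: transition_kernels_def)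
  show "AE y in Q x. y \<in> T x"
    using AE_msupport[OF prob_kernelD(1)[OF Q]]
    by (rule eventually_mono) (use assms in \<open>auto simp: transition_kernels_def\<close>)
qed

lemma joint_kernel_measurable:
  assumes "Q \<in> measurable borel (prob_algebra borel)"
  shows "(\<lambda>x. distr (Q x) borel (Pair x)) \<in> measurable borel (prob_algebra (borel :: ('a \<times> 'a) measure))"
  by (rule measurable_distr_prob_space2[OF assms]) (simp add: borel_prod)

lemma Pair_measurable:
  assumes "sets M = sets borel"
  shows "Pair x \<in> measurable M (borel :: ('a \<times> 'a) measure)"
  unfolding measurable_cong_sets[OF assms refl] borel_prod[symmetric] by measurable

lemma fst_measurable: "fst \<in> measurable (borel :: ('a \<times> 'a) measure) borel"
  and snd_measurable: "snd \<in> measurable (borel :: ('a \<times> 'a) measure) borel"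
  unfolding borel_prod[symmetric] by measurable

lemma joint_law_prob:
  assumes "Q \<in> measurable borel (prob_algebra borel)" "\<mu> \<in> space (prob_algebra borel)"
  shows "prob_space (joint_law \<mu> Q)" "sets (joint_law \<mu> Q) = sets borel"
  unfolding joint_law_def
  using prob_space_bind'[OF assms(2) joint_kernel_measurable[OF assms(1)]]
    sets_bind'[OF assms(2) joint_kernel_measurable[OF assms(1)]] by auto

lemma joint_law_marginals:
  assumes Q: "Q \<in> measurable borel (prob_algebra borel)" and \<mu>: "\<mu> \<in> space (prob_algebra borel)"
  shows "distr (joint_law \<mu> Q) borel fst = \<mu>" "distr (joint_law \<mu> Q) borel snd = bind \<mu> Q"
proof -
  have s: "sets \<mu> = sets borel" and p: "prob_space \<mu>" using \<mu> by (auto simp: space_prob_algebra)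
  interpret prob_space \<mu> by (rule p)
  note sQ = prob_kernelD(1)[OF Q] and pQ = prob_kernelD(2)[OF Q]
  have K: "(\<lambda>x. distr (Q x) borel (Pair x)) \<in> measurable \<mu> (subprob_algebra (borel :: ('a \<times> 'a) measure))"
    using measurable_prob_algebraD[OF joint_kernel_measurable[OF Q]] by (simp add: measurable_cong_sets[OF s refl])
  have "distr (joint_law \<mu> Q) borel fst = bind \<mu> (\<lambda>x. distr (distr (Q x) borel (Pair x)) borel fst)"
    unfolding joint_law_def by (rule distr_bind[OF K not_empty fst_measurable])
  also have "(\<lambda>x. distr (distr (Q x) borel (Pair x)) borel fst) = return borel"
    by (intro ext, subst distr_distr[OF fst_measurable Pair_measurable[OF sQ]])
       (simp add: o_def prob_space.distr_const[OF pQ])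
  also have "bind \<mu> (return borel) = \<mu>" by (rule bind_return''[OF s])
  finally show "distr (joint_law \<mu> Q) borel fst = \<mu>" .
  have "distr (joint_law \<mu> Q) borel snd = bind \<mu> (\<lambda>x. distr (distr (Q x) borel (Pair x)) borel snd)"
    unfolding joint_law_def by (rule distr_bind[OF K not_empty snd_measurable])
  also have "(\<lambda>x. distr (distr (Q x) borel (Pair x)) borel snd) = Q"
    by (intro ext, subst distr_distr[OF snd_measurable Pair_measurable[OF sQ]])
       (simp add: o_def distr_id2 sQ)
  finally show "distr (joint_law \<mu> Q) borel snd = bind \<mu> Q" .
qed

lemma AE_joint_law:
  assumes Q: "Q \<in> measurable borel (prob_algebra borel)" and \<mu>: "\<mu> \<in> space (prob_algebra borel)"
  shows "(AE p in joint_law \<mu> Q. p \<in> graph T) \<longleftrightarrow> (AE x in \<mu>. AE y in Q x. y \<in> T x)"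
proof -
  have s: "sets \<mu> = sets borel" using \<mu> by (auto simp: space_prob_algebra)
  note sQ = prob_kernelD(1)[OF Q]
  have K: "(\<lambda>x. distr (Q x) borel (Pair x)) \<in> measurable \<mu> (subprob_algebra (borel :: ('a \<times> 'a) measure))"
    using measurable_prob_algebraD[OF joint_kernel_measurable[OF Q]] by (simp add: measurable_cong_sets[OF s refl])
  have G: "graph T \<in> sets borel" using closed_graph by auto
  then have "(AE p in distr (Q x) borel (Pair x). p \<in> graph T) \<longleftrightarrow> (AE y in Q x. y \<in> T x)" for x
    by (subst AE_distr_iff[OF Pair_measurable[OF sQ]]) (auto simp: graph_def)
  then show ?thesis
    unfolding joint_law_def using G by (subst AE_bind[OF K]) (auto simp: pred_def)
qed

lemma stationary_pair_joint_law:
  assumes "(\<mu>, Q) \<in> stationary_pairs T"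
  shows "prob_space (joint_law \<mu> Q)" "sets (joint_law \<mu> Q) = sets borel"
    "AE p in joint_law \<mu> Q. p \<in> graph T"
    "distr (joint_law \<mu> Q) borel fst = distr (joint_law \<mu> Q) borel snd"
proof -
  have Q: "Q \<in> transition_kernels T" and \<mu>: "\<mu> \<in> space (prob_algebra borel)" "bind \<mu> Q = \<mu>"
    using assms by (auto simp: stationary_pairs_def stationary_measures_def)
  note QD = transition_kernelD[OF Q]
  show "prob_space (joint_law \<mu> Q)" "sets (joint_law \<mu> Q) = sets borel"
    using joint_law_prob[OF QD(1) \<mu>(1)] by auto
  show "AE p in joint_law \<mu> Q. p \<in> graph T" using AE_joint_law[OF QD(1) \<mu>(1)] QD(2) by simp
  show "distr (joint_law \<mu> Q) borel fst = distr (joint_law \<mu> Q) borel snd"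
    using joint_law_marginals[OF QD(1) \<mu>(1)] \<mu>(2) by simp
qed

lemma rotation_vector_joint_law:
  assumes "(\<mu>, Q) \<in> stationary_pairs T"
  shows "rotation_vector T \<psi> (\<mu>, Q) = (\<integral>p. \<psi>_ext p \<partial>joint_law \<mu> Q)"
proof -
  note J = stationary_pair_joint_law[OF assms]
  have G: "graph T \<in> sets (joint_law \<mu> Q)" using closed_graph J(2) by auto
  have "rotation_vector T \<psi> (\<mu>, Q) = (\<integral>p. indicator (graph T) p *\<^sub>R \<psi> p \<partial>joint_law \<mu> Q)"
    unfolding rotation_vector_def pair_law_def joint_law_def[symmetric] prod.case
    by (rule integral_restrict_space) (use G in auto)
  also have "(\<lambda>p. indicator (graph T) p *\<^sub>R \<psi> p) = (\<lambda>p. indicator (graph T) p *\<^sub>R \<psi>_ext p)"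
    by (rule ext) (auto simp: indicator_def \<psi>_ext(2))
  also have "(\<integral>p. indicator (graph T) p *\<^sub>R \<psi>_ext p \<partial>joint_law \<mu> Q) = (\<integral>p. \<psi>_ext p \<partial>joint_law \<mu> Q)"
  proof (rule integral_cong_AE)
    show "\<psi>_ext \<in> borel_measurable (joint_law \<mu> Q)"
      using \<psi>_ext(1) by (simp add: measurable_cong_sets[OF J(2) refl] borel_measurable_continuous_onI)
    then show "(\<lambda>p. indicator (graph T) p *\<^sub>R \<psi>_ext p) \<in> borel_measurable (joint_law \<mu> Q)"
      using G by simp
    show "AE p in joint_law \<mu> Q. indicator (graph T) p *\<^sub>R \<psi>_ext p = \<psi>_ext p"
      using J(3) by eventually_elim simp
  qed
  finally show ?thesis .
qed

text \<open>
  The disintegration gives a kernel with support in \<open>T x\<close> only for almost every \<open>x\<close>. On the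
  exceptional null set it is replaced by a given transition kernel, as the support condition is
  required at every point.
\<close>

lemma stationary_pair_of_joint_law:
  assumes \<gamma>: "prob_space \<gamma>" "sets \<gamma> = sets borel" "AE p in \<gamma>. p \<in> graph T"
    "distr \<gamma> borel fst = distr \<gamma> borel snd"
    and Q0: "Q0 \<in> transition_kernels T"
  obtains \<mu> Q where "(\<mu>, Q) \<in> stationary_pairs T" "joint_law \<mu> Q = \<gamma>"
proof -
  interpret \<gamma>: prob_space \<gamma> by fact
  define \<mu> where "\<mu> = distr \<gamma> borel fst"
  have fst: "fst \<in> measurable \<gamma> borel" using fst_measurable by (simp add: measurable_cong_sets[OF \<gamma>(2) refl])
  have \<mu>: "\<mu> \<in> space (prob_algebra borel)"
    unfolding \<mu>_def using \<gamma>.prob_space_distr[OF fst] by (simp add: space_prob_algebra)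
  obtain Q1 where Q1: "Q1 \<in> measurable borel (prob_algebra borel)" and \<gamma>_eq: "\<gamma> = joint_law \<mu> Q1"
    unfolding joint_law_def \<mu>_def using disintegration[OF compact_UNIV \<gamma>(1,2)] by metis
  note sQ1 = prob_kernelD(1)[OF Q1] and pQ1 = prob_kernelD(2)[OF Q1]
  have spQ1: "space (Q1 x) = UNIV" for x using sets_eq_imp_space_eq[OF sQ1, of x] by simp
  have G: "graph T \<in> sets borel" using closed_graph by auto
  have clT: "closed (T x)" for x using corr by (simp add: correspondence_def)
  have eq_T: "emeasure (distr (Q1 x) borel (Pair x)) (graph T) = emeasure (Q1 x) (T x)" for x
  proof -
    have "Pair x -` graph T \<inter> space (Q1 x) = T x" by (auto simp: graph_def spQ1)
    then show ?thesis using emeasure_distr[OF Pair_measurable[OF sQ1] G, of x x] by simp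
  qed
  have "(\<lambda>x. emeasure (distr (Q1 x) borel (Pair x)) (graph T)) \<in> borel_measurable borel"
    by (rule measurable_emeasure_kernel[OF measurable_prob_algebraD[OF joint_kernel_measurable[OF Q1]] G])
  then have Tm: "(\<lambda>x. emeasure (Q1 x) (T x)) \<in> borel_measurable borel" by (simp add: eq_T)
  define Q where "Q x = (if emeasure (Q1 x) (T x) = 1 then Q1 x else Q0 x)" for x
  have Q_meas: "Q \<in> measurable borel (prob_algebra borel)"
    unfolding Q_def[abs_def]
    by (rule measurable_If[OF Q1 transition_kernelD(1)[OF Q0]]) (use Tm in measurable)
  have full: "emeasure (Q1 x) (T x) = 1 \<longleftrightarrow> (AE y in Q1 x. y \<in> T x)" for x
  proof -
    interpret q: prob_space "Q1 x" by (rule pQ1)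
    have "T x \<in> sets (Q1 x)" using clT sQ1 by auto
    then show ?thesis by (simp add: q.AE_in_set_eq_1 q.emeasure_eq_measure)
  qed
  have "msupport (Q x) \<subseteq> T x" for x
  proof (cases "emeasure (Q1 x) (T x) = 1")
    case True
    show ?thesis
    proof
      fix y assume y: "y \<in> msupport (Q x)"
      show "y \<in> T x"
      proof (rule ccontr)
        assume "y \<notin> T x"
        then have "emeasure (Q1 x) (- T x) > 0"
          using y True clT[of x] by (auto simp: msupport_def Q_def open_Compl)
        moreover have "emeasure (Q1 x) (- T x) = 0"
        proof -
          have "AE y in Q1 x. y \<notin> - T x" using full True by simp
          then show ?thesis
            by (subst (asm) AE_iff_measurable[of "- T x"]) (use clT[of x] sQ1[of x] spQ1[of x] in auto)
        qed
        ultimately show False by simp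
      qed
    qed
  next
    case False
    then show ?thesis using Q0 by (simp add: Q_def transition_kernels_def)
  qed
  then have Q: "Q \<in> transition_kernels T" using Q_meas by (simp add: transition_kernels_def)
  have "AE x in \<mu>. emeasure (Q1 x) (T x) = 1"
    using AE_joint_law[OF Q1 \<mu>] \<gamma>(3) unfolding full \<gamma>_eq[symmetric] by blast
  then have AE_Q: "AE x in \<mu>. distr (Q x) borel (Pair x) = distr (Q1 x) borel (Pair x)"
    by eventually_elim (simp add: Q_def)
  have jl: "joint_law \<mu> Q = \<gamma>"
    unfolding \<gamma>_eq joint_law_def
    by (rule bind_cong_AE'[OF \<mu> joint_kernel_measurable[OF Q_meas] joint_kernel_measurable[OF Q1] AE_Q])
  have "bind \<mu> Q = \<mu>"
    using joint_law_marginals(2)[OF Q_meas \<mu>] \<gamma>(4) jl by (simp add: \<mu>_def)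
  then have "(\<mu>, Q) \<in> stationary_pairs T"
    using Q \<mu> by (simp add: stationary_pairs_def stationary_measures_def)
  then show ?thesis using jl that by blast
qed

lemma closed_rotation_set: "closed (rotation_set T \<psi>)"
  unfolding closed_sequential_limits
proof (intro allI impI, elim conjE)
  fix z l assume z: "\<forall>n. z n \<in> rotation_set T \<psi>" and lim: "z \<longlonglongrightarrow> l"
  have "\<exists>\<mu> Q. (\<mu>, Q) \<in> stationary_pairs T \<and> z n = rotation_vector T \<psi> (\<mu>, Q)" for n
    using z[rule_format, of n] unfolding rotation_set_def by (metis imageE surj_pair)
  then obtain \<mu> Q where pairs: "\<And>n. (\<mu> n, Q n) \<in> stationary_pairs T"
    and zn: "\<And>n. z n = rotation_vector T \<psi> (\<mu> n, Q n)" by metis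
  define \<gamma> where "\<gamma> n = joint_law (\<mu> n) (Q n)" for n
  note J = stationary_pair_joint_law[OF pairs, folded \<gamma>_def]
  have zn': "z n = (\<integral>p. \<psi>_ext p \<partial>\<gamma> n)" for n
    using zn rotation_vector_joint_law[OF pairs] by (simp add: \<gamma>_def)
  obtain r M where r: "strict_mono (r :: nat \<Rightarrow> nat)" and M: "prob_space M" "sets M = sets borel"
    and conv: "\<And>f :: 'a \<times> 'a \<Rightarrow> real. continuous_on UNIV f \<Longrightarrow> (\<lambda>n. \<integral>x. f x \<partial>\<gamma> (r n)) \<longlonglongrightarrow> (\<integral>x. f x \<partial>M)"
    by (rule weak_sequential_compactness[OF compact_UNIV_pair J(1,2)]) (rule that)
  have AE_M: "AE p in M. p \<in> graph T"
  proof -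
    \<comment> \<open>the distance to the closed graph is continuous and has integral \<open>0\<close> for every \<open>\<gamma> n\<close>,
        hence also in the limit\<close>
    let ?f = "\<lambda>p. infdist p (graph T)"
    have cf: "continuous_on UNIV ?f" by (intro continuous_intros)
    have "(\<integral>p. ?f p \<partial>\<gamma> n) = 0" for n
      by (rule integral_eq_zero_AE) (use J(3)[of n] in \<open>auto elim!: eventually_mono\<close>)
    then have "(\<integral>p. ?f p \<partial>M) = 0" using conv[OF cf] by (simp add: LIMSEQ_const_iff)
    then have "AE p in M. ?f p = 0"
      using integrable_continuous[OF M cf]
      by (subst (asm) integral_nonneg_eq_0_iff_AE) (auto simp: infdist_nonneg)
    then show ?thesis
      by eventually_elim (use in_closed_iff_infdist_zero[OF closed_graph graph_nonempty] in auto)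
  qed
  have fstM: "fst \<in> measurable M borel" and sndM: "snd \<in> measurable M borel"
    using fst_measurable snd_measurable by (simp_all add: measurable_cong_sets[OF M(2) refl])
  have marg: "distr M borel fst = distr M borel snd"
  proof (rule prob_measure_eqI_continuous)
    show "prob_space (distr M borel fst)" "prob_space (distr M borel snd)"
      using M(1) fstM sndM by (auto intro: prob_space.prob_space_distr)
    fix f :: "'a \<Rightarrow> real" assume f: "continuous_on UNIV f"
    then have fb: "f \<in> borel_measurable borel" by (rule borel_measurable_continuous_onI)
    have c1: "continuous_on UNIV (\<lambda>p :: 'a \<times> 'a. f (fst p))" and c2: "continuous_on UNIV (\<lambda>p :: 'a \<times> 'a. f (snd p))"
      by (auto intro!: continuous_on_compose2[OF f] continuous_intros)
    have "(\<integral>p. f (fst p) \<partial>\<gamma> n) = (\<integral>p. f (snd p) \<partial>\<gamma> n)" for n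
    proof -
      have m: "fst \<in> measurable (\<gamma> n) borel" "snd \<in> measurable (\<gamma> n) borel"
        using fst_measurable snd_measurable by (simp_all add: measurable_cong_sets[OF J(2) refl])
      show ?thesis using integral_distr[OF m(1) fb] integral_distr[OF m(2) fb] J(4)[of n] by simp
    qed
    then have "(\<lambda>n. \<integral>p. f (fst p) \<partial>\<gamma> (r n)) = (\<lambda>n. \<integral>p. f (snd p) \<partial>\<gamma> (r n))" by simp
    then have "(\<integral>p. f (fst p) \<partial>M) = (\<integral>p. f (snd p) \<partial>M)"
      using conv[OF c1] conv[OF c2] by (metis LIMSEQ_unique)
    then show "(\<integral>x. f x \<partial>distr M borel fst) = (\<integral>x. f x \<partial>distr M borel snd)"
      by (simp add: integral_distr[OF fstM fb] integral_distr[OF sndM fb])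
  qed auto
  have "Q 0 \<in> transition_kernels T" using pairs[of 0] by (simp add: stationary_pairs_def)
  then obtain \<mu>' Q' where pair': "(\<mu>', Q') \<in> stationary_pairs T" "joint_law \<mu>' Q' = M"
    using stationary_pair_of_joint_law[OF M AE_M marg] by metis
  have "l = (\<integral>p. \<psi>_ext p \<partial>M)"
  proof (rule euclidean_eqI)
    fix b :: "real ^ 'd" assume "b \<in> Basis"
    have cb: "continuous_on UNIV (\<lambda>p. \<psi>_ext p \<bullet> b)" by (intro continuous_intros \<psi>_ext(1))
    have "z n \<bullet> b = (\<integral>p. \<psi>_ext p \<bullet> b \<partial>\<gamma> n)" for n
      unfolding zn' using integral_inner_left[OF integrable_continuous[OF J(1,2) \<psi>_ext(1)]] by simp
    then have "(\<lambda>n. z (r n) \<bullet> b) \<longlonglongrightarrow> (\<integral>p. \<psi>_ext p \<bullet> b \<partial>M)"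
      using conv[OF cb] by simp
    moreover have "(\<lambda>n. z (r n) \<bullet> b) \<longlonglongrightarrow> l \<bullet> b"
      using LIMSEQ_subseq_LIMSEQ[OF lim r] by (intro tendsto_intros) (simp add: o_def)
    ultimately have "l \<bullet> b = (\<integral>p. \<psi>_ext p \<bullet> b \<partial>M)" by (rule LIMSEQ_unique[rotated])
    then show "l \<bullet> b = (\<integral>p. \<psi>_ext p \<partial>M) \<bullet> b"
      using integral_inner_left[OF integrable_continuous[OF M \<psi>_ext(1)]] by simp
  qed
  then have "l = rotation_vector T \<psi> (\<mu>', Q')"
    using rotation_vector_joint_law[OF pair'(1)] pair'(2) by simp
  then show "l \<in> rotation_set T \<psi>" using pair'(1) by (auto simp: rotation_set_def)
qed

lemma rotation_set_subset_hull: "rotation_set T \<psi> \<subseteq> value_hull"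
proof
  fix z assume "z \<in> rotation_set T \<psi>"
  then obtain \<mu> Q where p: "(\<mu>, Q) \<in> stationary_pairs T" and z: "z = rotation_vector T \<psi> (\<mu>, Q)"
    by (auto simp: rotation_set_def)
  note J = stationary_pair_joint_law[OF p]
  interpret prob_space "joint_law \<mu> Q" by (rule J(1))
  have "(\<integral>p. \<psi>_ext p \<partial>joint_law \<mu> Q) \<in> value_hull"
    by (rule expectation_in_closed_convex[OF integrable_continuous[OF J(1,2) \<psi>_ext(1)] convex_value_hull compact_imp_closed[OF compact_value_hull]])
       (use J(3) in \<open>auto elim!: eventually_mono simp: \<psi>_ext(2) value_in_hull\<close>)
  then show "z \<in> value_hull" using z rotation_vector_joint_law[OF p] by simp
qed

lemma compact_rotation_set: "compact (rotation_set T \<psi>)"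
  using compact_Int_closed[OF compact_value_hull closed_rotation_set] rotation_set_subset_hull
  by (simp add: Int_absorb1)

end

section \<open>Partition sums over separated sets\<close>

text \<open>
  The compactness argument behind both pressure bounds and the existence of maximizers: finitely many
  of the functions are enough for their maximum to be bounded below by a positive constant.
\<close>

lemma compact_finite_positive_cover:
  fixes f :: "'i \<Rightarrow> 'b::topological_space \<Rightarrow> real"
  assumes K: "compact K" and c: "\<And>i. i \<in> I \<Longrightarrow> continuous_on K (f i)"
    and pos: "\<And>w. w \<in> K \<Longrightarrow> \<exists>i\<in>I. 0 < f i w"
  obtains J \<tau> where "finite J" "J \<subseteq> I" "0 < (\<tau> :: real)" "\<And>w. w \<in> K \<Longrightarrow> \<exists>i\<in>J. \<tau> < f i w"
proof -
  define O' where "O' p = {w \<in> K. 1 / real (Suc (snd p)) < f (fst p) w}" for p :: "'i \<times> nat"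
  have "\<exists>A. open A \<and> A \<inter> K = O' p" if "fst p \<in> I" for p
  proof -
    have "\<exists>A. open A \<and> A \<inter> K = f (fst p) -` {1 / real (Suc (snd p))<..} \<inter> K"
      by (rule c[OF that, unfolded continuous_on_open_invariant, rule_format]) simp
    also have "f (fst p) -` {1 / real (Suc (snd p))<..} \<inter> K = O' p" by (auto simp: O'_def)
    finally show ?thesis .
  qed
  then obtain A where A: "\<And>p. fst p \<in> I \<Longrightarrow> open (A p) \<and> A p \<inter> K = O' p" by metis
  have "K \<subseteq> (\<Union>p\<in>I \<times> UNIV. A p)"
  proof
    fix w assume w: "w \<in> K"
    obtain i where i: "i \<in> I" "0 < f i w" using pos[OF w] by blast
    obtain n where "1 / real (Suc n) < f i w" using nat_approx_posE[OF i(2)] by blast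
    then have "w \<in> O' (i, n)" using w by (simp add: O'_def)
    then show "w \<in> (\<Union>p\<in>I \<times> UNIV. A p)" using A[of "(i, n)"] i(1) by auto
  qed
  moreover have "open (A p)" if "p \<in> I \<times> UNIV" for p using A[of p] that by auto
  ultimately obtain D where D: "D \<subseteq> I \<times> UNIV" "finite D" "K \<subseteq> (\<Union>p\<in>D. A p)"
    using compactE_image[OF K] by metis
  define \<tau> where "\<tau> = 1 / real (Suc (Max (insert 0 (snd ` D))))"
  show ?thesis
  proof
    show "finite (fst ` D)" "fst ` D \<subseteq> I" using D by auto
    show "0 < \<tau>" by (simp add: \<tau>_def)
    fix w assume w: "w \<in> K"
    obtain p where p: "p \<in> D" "w \<in> A p" using D(3) w by blast
    have "fst p \<in> I" using p(1) D(1) by auto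
    then have "A p \<inter> K = O' p" using A by blast
    then have "w \<in> O' p" using p(2) w by blast
    moreover have "\<tau> \<le> 1 / real (Suc (snd p))"
    proof -
      have "snd p \<le> Max (insert 0 (snd ` D))" using p(1) D(2) by (intro Max_ge) auto
      then show ?thesis unfolding \<tau>_def by (intro divide_left_mono) auto
    qed
    ultimately show "\<exists>i\<in>fst ` D. \<tau> < f i w" using p(1) by (intro bexI[of _ "fst p"]) (auto simp: O'_def)
  qed
qed

lemma Lim_at_right_antimono:
  fixes f :: "real \<Rightarrow> ereal"
  assumes "\<And>a b. 0 < a \<Longrightarrow> a \<le> b \<Longrightarrow> f b \<le> f a"
  shows "Lim (at_right 0) f = (SUP \<epsilon>\<in>{0<..}. f \<epsilon>)"
proof (rule tendsto_Lim)
  show "(f \<longlongrightarrow> (SUP \<epsilon>\<in>{0<..}. f \<epsilon>)) (at_right 0)"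
  proof (rule order_tendstoI)
    fix a assume "a < (SUP \<epsilon>\<in>{0<..}. f \<epsilon>)"
    then obtain \<epsilon> where \<epsilon>: "\<epsilon> > 0" "a < f \<epsilon>" by (auto simp: less_SUP_iff)
    have "\<forall>\<^sub>F x in at_right 0. x < \<epsilon>" using \<epsilon>(1) by (rule order_tendstoD(2)[OF tendsto_ident_at])
    then show "\<forall>\<^sub>F x in at_right 0. a < f x"
      using eventually_at_right_less[of 0]
      by eventually_elim (use assms \<epsilon> in \<open>force intro: less_le_trans\<close>)
  next
    fix a assume a: "(SUP \<epsilon>\<in>{0<..}. f \<epsilon>) < a"
    show "\<forall>\<^sub>F x in at_right 0. f x < a"
      using eventually_at_right_less[of 0]
    proof eventually_elim
      case (elim x)
      then have "f x \<le> (SUP \<epsilon>\<in>{0<..}. f \<epsilon>)" by (intro SUP_upper) auto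
      with a show ?case by simp
    qed
  qed
qed simp

lemma orbit_dist_le_iff: "orbit_dist n x y \<le> r \<longleftrightarrow> (\<forall>j\<le>n. dist (x j) (y j) \<le> r)"
  unfolding orbit_dist_def by (subst Max_le_iff) auto

lemma separated_empty: "separated T n \<epsilon> {}"
  by (simp add: separated_def)

lemma separated_subset: "separated T n \<epsilon> C \<Longrightarrow> D \<subseteq> C \<Longrightarrow> separated T n \<epsilon> D"
  by (auto simp: separated_def subset_iff)

lemma separated_antimono: "separated T n \<epsilon> C \<Longrightarrow> \<delta> \<le> \<epsilon> \<Longrightarrow> separated T n \<delta> C"
  unfolding separated_def by (meson le_less_trans)

lemma sum_blocks:
  fixes f :: "nat \<Rightarrow> real"
  shows "(\<Sum>j<k * n. f j) = (\<Sum>i<k. \<Sum>j<n. f (i * n + j))"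
proof -
  have "(\<Sum>i<k. \<Sum>j<n. f (i * n + j)) = (\<Sum>i<k. sum f {i * n..<i * n + n})"
  proof (rule sum.cong[OF refl])
    fix i
    show "(\<Sum>j<n. f (i * n + j)) = sum f {i * n..<i * n + n}"
      using sum.shift_bounds_nat_ivl[of f 0 "i * n" n] by (simp add: add.commute atLeast0LessThan)
  qed
  also have "\<dots> = (\<Sum>j<k * n. f j)" by (rule sum.nat_group)
  finally show ?thesis by simp
qed

context compact_correspondence
begin

text \<open>
  The average of \<open>\<psi>\<close> along the transitions of a finite orbit, which is the integral of \<open>\<psi>\<close> with
  respect to the empirical measure.
\<close>

definition orbit_average :: "nat \<Rightarrow> (nat \<Rightarrow> 'a) \<Rightarrow> real ^ 'd" where
  "orbit_average n x = (1 / real n) *\<^sub>R (\<Sum>j<n. \<psi> (x j, x (Suc j)))"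

lemma finite_orbitsD: "x \<in> finite_orbits T n \<Longrightarrow> j < n \<Longrightarrow> (x j, x (Suc j)) \<in> graph T"
  by (simp add: finite_orbits_def graph_def)

lemma orbit_average_in_hull:
  assumes "n \<ge> 1" "x \<in> finite_orbits T n"
  shows "orbit_average n x \<in> value_hull"
proof -
  have "(\<Sum>j<n. (1 / real n) *\<^sub>R \<psi> (x j, x (Suc j))) \<in> value_hull"
    using assms by (intro convex_sum convex_value_hull) (auto intro: value_in_hull finite_orbitsD)
  then show ?thesis by (simp add: orbit_average_def scaleR_sum_right)
qed

lemma empirical_expectation:
  assumes n: "n \<ge> 1" and x: "x \<in> finite_orbits T n"
  shows "integrable (empirical T n x) \<psi>" "(\<integral>p. \<psi> p \<partial>empirical T n x) = orbit_average n x"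
proof -
  let ?f = "\<lambda>j. (x j, x (Suc j))"
  have f: "?f \<in> measurable (uniform_count_measure {..<n}) (restrict_space borel (graph T))"
    using finite_orbitsD[OF x]
    by (intro measurableI) (auto simp: space_uniform_count_measure sets_uniform_count_measure space_restrict_space)
  have \<psi>m: "\<psi> \<in> borel_measurable (restrict_space borel (graph T))"
    using cont by (rule borel_measurable_continuous_on_restrict)
  have "integrable (uniform_count_measure {..<n}) (\<lambda>j. \<psi> (?f j))"
    unfolding uniform_count_measure_def by (rule integrable_point_measure_finite) auto
  then show "integrable (empirical T n x) \<psi>"
    unfolding empirical_def by (subst integrable_distr_eq[OF f \<psi>m])
  have "(\<integral>p. \<psi> p \<partial>empirical T n x) = (\<integral>j. \<psi> (?f j) \<partial>uniform_count_measure {..<n})"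
    unfolding empirical_def by (rule integral_distr[OF f \<psi>m])
  also have "\<dots> = (\<Sum>j<n. (1 / real n) *\<^sub>R \<psi> (?f j))"
    unfolding uniform_count_measure_def by (subst lebesgue_integral_point_measure_finite) auto
  finally show "(\<integral>p. \<psi> p \<partial>empirical T n x) = orbit_average n x"
    by (simp add: orbit_average_def scaleR_sum_right)
qed

text \<open>
  The partition sum over one separated set, for an energy that depends on the orbit average through
  \<open>G\<close>, and its supremum \<open>Z\<close> over all separated sets.
\<close>

definition separated_sum :: "(real ^ 'd \<Rightarrow> real) \<Rightarrow> nat \<Rightarrow> (nat \<Rightarrow> 'a) set \<Rightarrow> real" where
  "separated_sum G n C = (\<Sum>x\<in>C. exp (real n * G (orbit_average n x)))"

definition Z :: "(real ^ 'd \<Rightarrow> real) \<Rightarrow> nat \<Rightarrow> real \<Rightarrow> real" where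
  "Z G n \<epsilon> = (SUP C \<in> {C. separated T n \<epsilon> C}. separated_sum G n C)"

lemma partition_sum_eq_Z:
  assumes "n \<ge> 1" "\<And>x. x \<in> finite_orbits T n \<Longrightarrow> E (empirical T n x) = G (orbit_average n x)"
  shows "partition_sum T E n \<epsilon> = Z G n \<epsilon>"
  unfolding partition_sum_def Z_def separated_sum_def
  by (intro SUP_cong sum.cong) (use assms in \<open>auto simp: separated_def\<close>)

lemma separated_card_bound:
  assumes "\<epsilon> > 0"
  obtains N :: nat where "\<And>n C. separated T n \<epsilon> C \<Longrightarrow> finite C \<and> card C \<le> N ^ Suc n"
proof -
  obtain D :: "'a set" where D: "finite D" "UNIV \<subseteq> (\<Union>d\<in>D. ball d (\<epsilon>/2))"
    using compact_eq_totally_bounded[of "UNIV :: 'a set"] compact_UNIV assms by (meson half_gt_zero)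
  have "\<exists>d\<in>D. dist d x < \<epsilon>/2" for x using D(2) by (auto simp: subset_iff)
  then obtain ctr where ctr: "\<And>x. ctr x \<in> D" "\<And>x. dist (ctr x) x < \<epsilon>/2" by metis
  have "finite C \<and> card C \<le> card D ^ Suc n" if C: "separated T n \<epsilon> C" for n C
  proof -
    let ?f = "\<lambda>x. restrict (ctr \<circ> x) {..n}"
    have inj: "inj_on ?f C"
    proof (rule inj_onI, rule ccontr)
      fix x y assume xy: "x \<in> C" "y \<in> C" "?f x = ?f y" "x \<noteq> y"
      have "dist (x j) (y j) \<le> \<epsilon>" if "j \<le> n" for j
      proof -
        have "ctr (x j) = ctr (y j)" using fun_cong[OF xy(3), of j] that by simp
        then have "dist (x j) (y j) < \<epsilon>"
          using dist_triangle_half_r[OF ctr(2)[of "x j"], of "y j"] ctr(2)[of "y j"] by simp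
        then show ?thesis by simp
      qed
      then have "orbit_dist n x y \<le> \<epsilon>" by (simp add: orbit_dist_le_iff)
      then show False using C xy unfolding separated_def by force
    qed
    have im: "?f ` C \<subseteq> PiE {..n} (\<lambda>_. D)" using ctr(1) by (auto simp: PiE_def)
    have fin: "finite (PiE {..n} (\<lambda>_. D))" using D(1) by (intro finite_PiE) auto
    have "card C \<le> card (PiE {..n} (\<lambda>_. D))" by (rule card_inj_on_le[OF inj im fin])
    moreover have "finite C" using inj im fin by (meson finite_imageD finite_subset)
    ultimately show ?thesis by (simp add: card_PiE)
  qed
  then show ?thesis using that by blast
qed

lemma separated_finite: "\<epsilon> > 0 \<Longrightarrow> separated T n \<epsilon> C \<Longrightarrow> finite C"
  by (metis separated_card_bound)

lemma separated_orbits: "separated T n \<epsilon> C \<Longrightarrow> x \<in> C \<Longrightarrow> x \<in> finite_orbits T n"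
  by (auto simp: separated_def)

lemma bounded_on_hull:
  fixes G :: "real ^ 'd \<Rightarrow> real"
  assumes "continuous_on value_hull G"
  obtains B where "0 \<le> B" "\<And>w. w \<in> value_hull \<Longrightarrow> \<bar>G w\<bar> \<le> B"
proof -
  obtain b where "\<And>w. w \<in> value_hull \<Longrightarrow> norm (G w) \<le> b"
    using compact_imp_bounded[OF compact_continuous_image[OF assms compact_value_hull]] by (auto simp: bounded_iff)
  then show ?thesis by (intro that[of "max 0 b"]) (auto intro: le_max_iff_disj[THEN iffD2])
qed

lemma separated_sum_bdd:
  assumes "continuous_on value_hull G" "n \<ge> 1" "\<epsilon> > 0"
  shows "bdd_above (separated_sum G n ` {C. separated T n \<epsilon> C})"
proof -
  obtain B where B: "0 \<le> B" "\<And>w. w \<in> value_hull \<Longrightarrow> \<bar>G w\<bar> \<le> B" using bounded_on_hull[OF assms(1)] by blast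
  obtain N where N: "\<And>n C. separated T n \<epsilon> C \<Longrightarrow> finite C \<and> card C \<le> N ^ Suc n"
    using separated_card_bound[OF assms(3)] by blast
  show ?thesis
  proof (rule bdd_aboveI2)
    fix C assume C: "C \<in> {C. separated T n \<epsilon> C}"
    have "separated_sum G n C \<le> (\<Sum>x\<in>C. exp (real n * B))"
      unfolding separated_sum_def
    proof (rule sum_mono)
      fix x assume "x \<in> C"
      then have "G (orbit_average n x) \<le> B"
        using C B(2)[OF orbit_average_in_hull[OF assms(2)], of x] by (auto simp: separated_def)
      then show "exp (real n * G (orbit_average n x)) \<le> exp (real n * B)" by (simp add: mult_left_mono)
    qed
    also have "\<dots> \<le> real (N ^ Suc n) * exp (real n * B)"
      using N[of n C] C by (simp add: of_nat_mono del: power_Suc of_nat_power)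
    finally show "separated_sum G n C \<le> real (N ^ Suc n) * exp (real n * B)" .
  qed
qed

lemma Z_upper:
  assumes "continuous_on value_hull G" "n \<ge> 1" "\<epsilon> > 0" "separated T n \<epsilon> C"
  shows "separated_sum G n C \<le> Z G n \<epsilon>"
  unfolding Z_def by (rule cSUP_upper) (use assms separated_sum_bdd in auto)

lemma Z_least:
  assumes "\<And>C. separated T n \<epsilon> C \<Longrightarrow> separated_sum G n C \<le> b"
  shows "Z G n \<epsilon> \<le> b"
  unfolding Z_def
proof (rule cSUP_least)
  show "{C. separated T n \<epsilon> C} \<noteq> {}" using separated_empty[of T n \<epsilon>] by blast
qed (use assms in auto)

lemma Z_less_obtain:
  assumes "c < Z G n \<epsilon>"
  obtains C where "separated T n \<epsilon> C" "c < separated_sum G n C"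
proof (rule ccontr)
  assume "\<not> thesis"
  then have "Z G n \<epsilon> \<le> c" by (intro Z_least) (meson not_le that)
  with assms show False by simp
qed

lemma Z_antimono:
  assumes "continuous_on value_hull G" "n \<ge> 1" "0 < \<delta>" "\<delta> \<le> \<epsilon>"
  shows "Z G n \<epsilon> \<le> Z G n \<delta>"
  by (intro Z_least Z_upper) (use assms separated_antimono in auto)

text \<open>
  A choice of a point in \<open>T x\<close>, which makes every finite orbit extendable.
\<close>

definition successor :: "'a \<Rightarrow> 'a" where
  "successor x = (SOME y. y \<in> T x)"

lemma successor: "successor x \<in> T x"
  unfolding successor_def using values_nonempty by (simp add: some_in_eq)

text \<open>
  The continuation of an orbit of length \<open>N\<close> to one of length \<open>M\<close> by a fixed choice of successors.
\<close>

definition extend_orbit :: "nat \<Rightarrow> nat \<Rightarrow> (nat \<Rightarrow> 'a) \<Rightarrow> nat \<Rightarrow> 'a" where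
  "extend_orbit N M x = (\<lambda>j. if j \<le> N then x j else if j \<le> M then (successor ^^ (j - N)) (x N) else undefined)"

lemma extend_orbit:
  assumes "x \<in> finite_orbits T N" "N \<le> M"
  shows "extend_orbit N M x \<in> finite_orbits T M" "j \<le> N \<Longrightarrow> extend_orbit N M x j = x j"
proof -
  have "extend_orbit N M x (Suc j) \<in> T (extend_orbit N M x j)" if "j < M" for j
  proof (cases "j < N")
    case True
    then show ?thesis using assms by (auto simp: extend_orbit_def finite_orbits_def)
  next
    case False
    then have "(successor ^^ (Suc j - N)) (x N) = successor ((successor ^^ (j - N)) (x N))"
      by (simp add: Suc_diff_le)
    then show ?thesis using False that successor by (auto simp: extend_orbit_def le_less not_less)
  qed
  then show "extend_orbit N M x \<in> finite_orbits T M"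
    using assms by (auto simp: finite_orbits_def extensional_def extend_orbit_def)
  show "extend_orbit N M x j = x j" if "j \<le> N" using that by (simp add: extend_orbit_def)
qed

lemma finite_orbits_nonempty: "finite_orbits T n \<noteq> {}"
proof -
  have "(\<lambda>j\<in>{..0}. undefined) \<in> finite_orbits T 0" by (auto simp: finite_orbits_def)
  from extend_orbit(1)[OF this, of n] show ?thesis by auto
qed

lemma Z_lower_bound:
  assumes "continuous_on value_hull G" "n \<ge> 1" "\<epsilon> > 0" "\<And>w. w \<in> value_hull \<Longrightarrow> - B \<le> G w"
  shows "exp (- (real n * B)) \<le> Z G n \<epsilon>"
proof -
  obtain x where x: "x \<in> finite_orbits T n" using finite_orbits_nonempty by blast
  have "- B \<le> G (orbit_average n x)" using orbit_average_in_hull[OF assms(2) x] assms(4) by blast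
  then have "exp (- (real n * B)) \<le> exp (real n * G (orbit_average n x))"
    using mult_left_mono[of "-B" _ "real n"] by simp
  also have "\<dots> = separated_sum G n {x}" by (simp add: separated_sum_def)
  also have "\<dots> \<le> Z G n \<epsilon>" by (rule Z_upper[OF assms(1-3)]) (use x in \<open>auto simp: separated_def\<close>)
  finally show ?thesis .
qed

lemma Z_pos:
  assumes "continuous_on value_hull G" "n \<ge> 1" "\<epsilon> > 0"
  shows "0 < Z G n \<epsilon>"
proof -
  obtain B where "0 \<le> B" "\<And>w. w \<in> value_hull \<Longrightarrow> \<bar>G w\<bar> \<le> B" using bounded_on_hull[OF assms(1)] by blast
  then have "exp (- (real n * B)) \<le> Z G n \<epsilon>"
    by (intro Z_lower_bound[OF assms]) (use abs_le_D2 in force)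
  then show ?thesis using exp_gt_zero less_le_trans by blast
qed

text \<open>
  The exponential growth rate of the partition sum at time \<open>n\<close>.
\<close>

definition growth :: "(real ^ 'd \<Rightarrow> real) \<Rightarrow> real \<Rightarrow> nat \<Rightarrow> ereal" where
  "growth G \<epsilon> n = ereal (ln (Z G n \<epsilon>) / real n)"

lemma growth_antimono:
  assumes "continuous_on value_hull G" "n \<ge> 1" "0 < \<delta>" "\<delta> \<le> \<epsilon>"
  shows "growth G \<epsilon> n \<le> growth G \<delta> n"
proof -
  have "ln (Z G n \<epsilon>) \<le> ln (Z G n \<delta>)"
    using Z_antimono[OF assms] Z_pos[OF assms(1,2), of \<epsilon>] Z_pos[OF assms(1,2), of \<delta>] assms(3,4) by simp
  then show ?thesis unfolding growth_def by (simp add: divide_right_mono)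
qed

lemma eventually_ge_1: "(\<And>n. n \<ge> 1 \<Longrightarrow> P n) \<Longrightarrow> eventually P sequentially"
  unfolding eventually_sequentially by blast

lemma pressures_eq_SUP:
  assumes G: "continuous_on value_hull G"
    and E: "\<And>n x. n \<ge> 1 \<Longrightarrow> x \<in> finite_orbits T n \<Longrightarrow> E (empirical T n x) = G (orbit_average n x)"
  shows "upper_pressure T E = (SUP \<epsilon>\<in>{0<..}. limsup (growth G \<epsilon>))"
    and "lower_pressure T E = (SUP \<epsilon>\<in>{0<..}. liminf (growth G \<epsilon>))"
proof -
  have eq: "eventually (\<lambda>n. ereal (ln (partition_sum T E n \<epsilon>) / real n) = growth G \<epsilon> n) sequentially" for \<epsilon>
    by (rule eventually_ge_1) (use partition_sum_eq_Z E in \<open>auto simp: growth_def\<close>)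
  have "limsup (\<lambda>n. ereal (ln (partition_sum T E n \<epsilon>) / real n)) = limsup (growth G \<epsilon>)"
    "liminf (\<lambda>n. ereal (ln (partition_sum T E n \<epsilon>) / real n)) = liminf (growth G \<epsilon>)" for \<epsilon>
    by (rule Limsup_eq[OF eq], rule Liminf_eq[OF eq])
  moreover have "limsup (growth G b) \<le> limsup (growth G a)" "liminf (growth G b) \<le> liminf (growth G a)"
    if "0 < a" "a \<le> b" for a b
    using growth_antimono[OF G _ that] by (auto intro!: Limsup_mono Liminf_mono eventually_ge_1)
  ultimately show "upper_pressure T E = (SUP \<epsilon>\<in>{0<..}. limsup (growth G \<epsilon>))"
    and "lower_pressure T E = (SUP \<epsilon>\<in>{0<..}. liminf (growth G \<epsilon>))"
    unfolding upper_pressure_def lower_pressure_def by (simp_all add: Lim_at_right_antimono)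
qed

lemma rotation_energy_empirical:
  "n \<ge> 1 \<Longrightarrow> x \<in> finite_orbits T n \<Longrightarrow> rotation_energy \<psi> G (empirical T n x) = G (orbit_average n x)"
  by (simp add: rotation_energy_def empirical_expectation)

lemma linear_energy_empirical:
  "n \<ge> 1 \<Longrightarrow> x \<in> finite_orbits T n \<Longrightarrow> linear_energy (\<lambda>p. y \<bullet> \<psi> p) (empirical T n x) = y \<bullet> orbit_average n x"
  by (simp add: linear_energy_def empirical_expectation)

section \<open>Existence of the linear pressure\<close>

lemma maximal_separated:
  assumes "\<epsilon> > 0"
  obtains C where "separated T n \<epsilon> C" "\<And>x. x \<in> finite_orbits T n \<Longrightarrow> \<exists>c\<in>C. orbit_dist n x c \<le> \<epsilon>"
proof -
  obtain N where N: "\<And>n C. separated T n \<epsilon> C \<Longrightarrow> finite C \<and> card C \<le> N ^ Suc n"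
    using separated_card_bound[OF assms] by blast
  have "\<exists>C. separated T n \<epsilon> C \<and> (\<forall>D. separated T n \<epsilon> D \<longrightarrow> card D \<le> card C)"
    by (rule ex_has_greatest_nat[where k="{}" and b="Suc (N ^ Suc n)"])
       (use N separated_empty in \<open>auto simp: less_Suc_eq_le simp del: power_Suc\<close>)
  then obtain C where C: "separated T n \<epsilon> C" "\<And>D. separated T n \<epsilon> D \<Longrightarrow> card D \<le> card C" by blast
  have "\<exists>c\<in>C. orbit_dist n x c \<le> \<epsilon>" if x: "x \<in> finite_orbits T n" for x
  proof (rule ccontr)
    assume far: "\<not> ?thesis"
    have sym: "orbit_dist n c x = orbit_dist n x c" for c unfolding orbit_dist_def by (simp only: dist_commute)
    have far': "\<epsilon> < orbit_dist n x c" "\<epsilon> < orbit_dist n c x" if "c \<in> C" for c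
      unfolding sym[of c] using far that not_le by blast+
    have "orbit_dist n x x \<le> \<epsilon>" using assms by (simp add: orbit_dist_le_iff)
    then have "x \<notin> C" using far by blast
    have "separated T n \<epsilon> (insert x C)"
      using C(1) x by (auto simp: separated_def far')
    then have "card (insert x C) \<le> card C" by (rule C(2))
    then show False using \<open>x \<notin> C\<close> N[OF C(1)] by simp
  qed
  then show ?thesis using that C(1) by blast
qed

text \<open>
  The Birkhoff sum of the linear potential with coefficient vector \<open>y\<close>.
\<close>

definition orbit_sum :: "real ^ 'd \<Rightarrow> nat \<Rightarrow> (nat \<Rightarrow> 'a) \<Rightarrow> real" where
  "orbit_sum y n x = (\<Sum>j<n. y \<bullet> \<psi> (x j, x (Suc j)))"

lemma orbit_sum_average: "n \<ge> 1 \<Longrightarrow> real n * (y \<bullet> orbit_average n x) = orbit_sum y n x"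
  by (simp add: orbit_average_def orbit_sum_def inner_sum_right)

lemma linear_continuous: "continuous_on A (\<lambda>w :: real ^ 'd. y \<bullet> w)"
  by (intro continuous_intros)

text \<open>
  Submultiplicativity up to a change of scale. An orbit is extended to a multiple of the block length
  \<open>n\<close>, and each block is replaced by a nearby element of a maximal \<open>\<epsilon>\<close>-separated set. Orbits
  with the same sequence of blocks are within \<open>2 * \<epsilon>\<close>, so the sequence of blocks determines the
  element of a \<open>2 * \<epsilon>\<close>-separated set.
\<close>

lemma Z_linear_blocks:
  fixes y :: "real ^ 'd"
  assumes \<epsilon>: "\<epsilon> > 0" and n: "n \<ge> 1" and N: "N \<ge> 1"
    and osc: "\<And>p q. p \<in> graph T \<Longrightarrow> q \<in> graph T \<Longrightarrow> dist (fst p) (fst q) \<le> \<epsilon> \<Longrightarrow> dist (snd p) (snd q) \<le> \<epsilon>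
      \<Longrightarrow> y \<bullet> \<psi> p \<le> y \<bullet> \<psi> q + \<omega>"
    and B: "0 \<le> B" "\<And>w. w \<in> value_hull \<Longrightarrow> - B \<le> y \<bullet> w"
  shows "Z (\<lambda>w. y \<bullet> w) N (2 * \<epsilon>) \<le> exp (real n * B) * (exp (real n * \<omega>) * Z (\<lambda>w. y \<bullet> w) n \<epsilon>) ^ Suc (N div n)"
proof (rule Z_least)
  fix D assume D: "separated T N (2 * \<epsilon>) D"
  obtain C where C: "separated T n \<epsilon> C" "\<And>x. x \<in> finite_orbits T n \<Longrightarrow> \<exists>c\<in>C. orbit_dist n x c \<le> \<epsilon>"
    using maximal_separated[OF \<epsilon>] by blast
  have finC: "finite C" by (rule separated_finite[OF \<epsilon> C(1)])
  have CO: "c \<in> finite_orbits T n" if "c \<in> C" for c by (rule separated_orbits[OF C(1) that])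
  define ctr where "ctr x = (SOME c. c \<in> C \<and> orbit_dist n x c \<le> \<epsilon>)" for x
  have ctr: "ctr x \<in> C" "orbit_dist n x (ctr x) \<le> \<epsilon>" if "x \<in> finite_orbits T n" for x
    using someI_ex[of "\<lambda>c. c \<in> C \<and> orbit_dist n x c \<le> \<epsilon>"] C(2)[OF that] unfolding ctr_def by blast+
  define k where "k = Suc (N div n)"
  define M where "M = k * n"
  have NM: "N < M" unfolding M_def k_def using n by (simp add: dividend_less_times_div mult.commute)
  have MN: "M \<le> N + n" unfolding M_def k_def by (simp add: add.commute)
  define ext where "ext x = extend_orbit N M x" for x
  define block where "block x i = (\<lambda>j\<in>{..n}. ext x (i * n + j))" for x i
  have DO: "x \<in> finite_orbits T N" if "x \<in> D" for x by (rule separated_orbits[OF D that])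
  have ext: "ext x \<in> finite_orbits T M" if "x \<in> D" for x
    unfolding ext_def using extend_orbit(1)[OF DO[OF that]] NM by simp
  have ext_eq: "ext x j = x j" if "x \<in> D" "j \<le> N" for x j
    unfolding ext_def using extend_orbit(2)[OF DO[OF that(1)] _ that(2)] NM by simp
  have in_block: "i * n + j < M" if "i < k" "j < n" for i j
  proof -
    have "Suc i * n \<le> k * n" using that(1) by (intro mult_right_mono) auto
    then show ?thesis using that(2) by (simp add: M_def)
  qed
  have block: "block x i \<in> finite_orbits T n" if "x \<in> D" "i < k" for x i
    using ext[OF that(1)] in_block[OF that(2)] by (auto simp: finite_orbits_def block_def)
  define code where "code x = (\<lambda>i\<in>{..<k}. ctr (block x i))" for x
  have code_in: "code x \<in> PiE {..<k} (\<lambda>_. C)" if "x \<in> D" for x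
    using ctr(1)[OF block[OF that]] by (auto simp: code_def)
  have inj: "inj_on code D"
  proof (rule inj_onI, rule ccontr)
    fix x x' assume x: "x \<in> D" "x' \<in> D" and eq: "code x = code x'" and ne: "x \<noteq> x'"
    have "dist (x j) (x' j) \<le> 2 * \<epsilon>" if j: "j \<le> N" for j
    proof -
      define i where "i = j div n"
      have i: "i < k" "j = i * n + j mod n" and jn: "j mod n \<le> n"
        using j n by (auto simp: i_def k_def div_le_mono less_Suc_eq_le intro: less_imp_le)
      have c: "ctr (block x i) = ctr (block x' i)" using fun_cong[OF eq, of i] i(1) by (simp add: code_def)
      have "dist (block u i (j mod n)) (ctr (block u i) (j mod n)) \<le> \<epsilon>" if "u \<in> D" for u
        using ctr(2)[OF block[OF that i(1)]] jn by (simp add: orbit_dist_le_iff)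
      moreover have "block u i (j mod n) = u j" if "u \<in> D" for u
        using ext_eq[OF that j] i(2) jn by (simp add: block_def)
      ultimately have "dist (x j) (ctr (block x i) (j mod n)) \<le> \<epsilon>" "dist (x' j) (ctr (block x i) (j mod n)) \<le> \<epsilon>"
        using x c by metis+
      then show ?thesis using dist_triangle2[of "x j" "x' j" "ctr (block x i) (j mod n)"] by linarith
    qed
    then have "orbit_dist N x x' \<le> 2 * \<epsilon>" by (simp add: orbit_dist_le_iff)
    then show False using D x ne unfolding separated_def by force
  qed
  have bound: "orbit_sum y N x \<le> real n * B + (\<Sum>i<k. real n * \<omega> + orbit_sum y n (code x i))" if x: "x \<in> D" for x
  proof -
    let ?f = "\<lambda>j. y \<bullet> \<psi> (ext x j, ext x (Suc j))"
    have low: "- B \<le> ?f j" if "j < M" for j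
      using B(2) value_in_hull finite_orbitsD[OF ext[OF x] that] by blast
    have "orbit_sum y N x = (\<Sum>j<N. ?f j)"
      unfolding orbit_sum_def using ext_eq[OF x] by (intro sum.cong) auto
    moreover have "(\<Sum>j<N. ?f j) = (\<Sum>j<M. ?f j) - (\<Sum>j\<in>{N..<M}. ?f j)"
    proof -
      have "{..<M} = {..<N} \<union> {N..<M}" using NM by auto
      then have "(\<Sum>j<M. ?f j) = (\<Sum>j<N. ?f j) + (\<Sum>j\<in>{N..<M}. ?f j)"
        by (simp add: sum.union_disjoint ivl_disj_int)
      then show ?thesis by simp
    qed
    moreover have "(\<Sum>j\<in>{N..<M}. ?f j) \<ge> - (real n * B)"
    proof -
      have "(\<Sum>j\<in>{N..<M}. - B) \<le> (\<Sum>j\<in>{N..<M}. ?f j)" by (rule sum_mono) (use low in auto)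
      moreover have "(\<Sum>j\<in>{N..<M}. - B) \<ge> - (real n * B)"
      proof -
        have "real (M - N) * B \<le> real n * B" using MN B(1) by (intro mult_right_mono) auto
        then show ?thesis by simp
      qed
      ultimately show ?thesis by linarith
    qed
    moreover have "(\<Sum>j<M. ?f j) = (\<Sum>i<k. \<Sum>j<n. ?f (i * n + j))" unfolding M_def by (rule sum_blocks)
    moreover have "(\<Sum>i<k. \<Sum>j<n. ?f (i * n + j)) \<le> (\<Sum>i<k. real n * \<omega> + orbit_sum y n (code x i))"
    proof (rule sum_mono)
      fix i assume i: "i \<in> {..<k}"
      then have ik: "i < k" by simp
      let ?c = "ctr (block x i)"
      have c: "?c \<in> finite_orbits T n" using ctr(1)[OF block[OF x ik]] CO by blast
      have d: "dist (ext x (i * n + j)) (?c j) \<le> \<epsilon>" if "j \<le> n" for j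
        using ctr(2)[OF block[OF x ik]] that unfolding orbit_dist_le_iff by (auto simp: block_def)
      have "?f (i * n + j) \<le> y \<bullet> \<psi> (?c j, ?c (Suc j)) + \<omega>" if "j < n" for j
        using osc[OF finite_orbitsD[OF ext[OF x] in_block[OF ik that]] finite_orbitsD[OF c that]] d[of j] d[of "Suc j"] that
        by simp
      then have "(\<Sum>j<n. ?f (i * n + j)) \<le> (\<Sum>j<n. y \<bullet> \<psi> (?c j, ?c (Suc j)) + \<omega>)" by (intro sum_mono) auto
      also have "\<dots> = real n * \<omega> + orbit_sum y n (code x i)"
        using ik by (simp add: sum.distrib orbit_sum_def code_def)
      finally show "(\<Sum>j<n. ?f (i * n + j)) \<le> real n * \<omega> + orbit_sum y n (code x i)" .
    qed
    ultimately show ?thesis by linarith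
  qed
  let ?w = "\<lambda>c. exp (real n * \<omega> + orbit_sum y n c)"
  have finP: "finite (PiE {..<k} (\<lambda>_. C))" using finC by (intro finite_PiE) auto
  have "separated_sum (\<lambda>w. y \<bullet> w) N D = (\<Sum>x\<in>D. exp (orbit_sum y N x))"
    unfolding separated_sum_def using N by (simp add: orbit_sum_average)
  also have "\<dots> \<le> (\<Sum>x\<in>D. exp (real n * B) * (\<Prod>i<k. ?w (code x i)))"
  proof (rule sum_mono)
    fix x assume "x \<in> D"
    from bound[OF this] show "exp (orbit_sum y N x) \<le> exp (real n * B) * (\<Prod>i<k. ?w (code x i))"
      by (simp flip: exp_sum exp_add)
  qed
  also have "\<dots> = exp (real n * B) * (\<Sum>g\<in>code ` D. \<Prod>i<k. ?w (g i))"
    by (simp add: sum.reindex[OF inj] sum_distrib_left)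
  also have "\<dots> \<le> exp (real n * B) * (\<Sum>g\<in>PiE {..<k} (\<lambda>_. C). \<Prod>i<k. ?w (g i))"
    by (intro mult_left_mono sum_mono2 finP) (use code_in in \<open>auto intro: prod_nonneg\<close>)
  also have "(\<Sum>g\<in>PiE {..<k} (\<lambda>_. C). \<Prod>i<k. ?w (g i)) = (\<Prod>i<k. \<Sum>c\<in>C. ?w c)"
    by (rule prod_sum_PiE[symmetric]) (use finC in auto)
  also have "\<dots> = (exp (real n * \<omega>) * separated_sum (\<lambda>w. y \<bullet> w) n C) ^ k"
    using n by (simp add: separated_sum_def orbit_sum_average exp_add sum_distrib_left)
  also have "exp (real n * B) * \<dots> \<le> exp (real n * B) * (exp (real n * \<omega>) * Z (\<lambda>w. y \<bullet> w) n \<epsilon>) ^ k"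
    by (intro mult_left_mono power_mono Z_upper linear_continuous)
       (use n \<epsilon> C(1) in \<open>auto simp: separated_sum_def intro!: mult_nonneg_nonneg sum_nonneg\<close>)
  finally show "separated_sum (\<lambda>w. y \<bullet> w) N D
      \<le> exp (real n * B) * (exp (real n * \<omega>) * Z (\<lambda>w. y \<bullet> w) n \<epsilon>) ^ Suc (N div n)"
    by (simp add: k_def)
qed

text \<open>
  As the left side does not depend on \<open>n\<close>, this bounds the upper growth rate at scale \<open>2 * \<epsilon>\<close> by the
  lower one at scale \<open>\<epsilon>\<close>, up to the oscillation \<open>\<omega>\<close>.
\<close>

lemma limsup_growth_linear_le:
  fixes y :: "real ^ 'd"
  assumes \<epsilon>: "\<epsilon> > 0" and n: "n \<ge> 1"
    and osc: "\<And>p q. p \<in> graph T \<Longrightarrow> q \<in> graph T \<Longrightarrow> dist (fst p) (fst q) \<le> \<epsilon> \<Longrightarrow> dist (snd p) (snd q) \<le> \<epsilon>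
      \<Longrightarrow> y \<bullet> \<psi> p \<le> y \<bullet> \<psi> q + \<omega>"
  shows "limsup (growth (\<lambda>w. y \<bullet> w) (2 * \<epsilon>)) \<le> growth (\<lambda>w. y \<bullet> w) \<epsilon> n + ereal \<omega>"
proof -
  let ?Z = "Z (\<lambda>w. y \<bullet> w)"
  obtain B where B: "0 \<le> B" "\<And>w. w \<in> value_hull \<Longrightarrow> \<bar>y \<bullet> w\<bar> \<le> B"
    using bounded_on_hull[OF linear_continuous] by blast
  have B': "- B \<le> y \<bullet> w" if "w \<in> value_hull" for w using B(2)[OF that] by linarith
  have Zn: "0 < ?Z n \<epsilon>" by (rule Z_pos[OF linear_continuous n \<epsilon>])
  define c where "c = real n * \<omega> + ln (?Z n \<epsilon>)"
  have main: "ln (?Z N (2 * \<epsilon>)) / real N \<le> c / real n + (real n * B + \<bar>c\<bar>) / real N" if N: "N \<ge> 1" for N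
  proof -
    have ZN: "0 < ?Z N (2 * \<epsilon>)" using Z_pos[OF linear_continuous N] \<epsilon> by simp
    have "ln (?Z N (2 * \<epsilon>)) \<le> ln (exp (real n * B) * (exp (real n * \<omega>) * ?Z n \<epsilon>) ^ Suc (N div n))"
      using Z_linear_blocks[OF \<epsilon> n N osc B(1) B'] ZN by (subst ln_le_cancel_iff) auto
    also have "\<dots> = real n * B + real (Suc (N div n)) * c"
      using Zn by (simp add: ln_mult ln_realpow c_def del: power_Suc)
    also have "real (Suc (N div n)) * c \<le> real N / real n * c + \<bar>c\<bar>"
    proof -
      have eq: "real N = real (N div n) * real n + real (N mod n)"
        by (metis div_mult_mod_eq of_nat_add of_nat_mult)
      have "real (N mod n) < real n" using n by simp
      then have "0 \<le> real (Suc (N div n)) - real N / real n" "real (Suc (N div n)) - real N / real n \<le> 1"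
        using n by (auto simp: eq field_simps)
      then have "\<bar>(real (Suc (N div n)) - real N / real n) * c\<bar> \<le> 1 * \<bar>c\<bar>"
        unfolding abs_mult by (intro mult_right_mono) auto
      then show ?thesis by (simp add: left_diff_distrib abs_le_iff)
    qed
    finally have "ln (?Z N (2 * \<epsilon>)) \<le> real n * B + (real N / real n * c + \<bar>c\<bar>)" by simp
    then have "ln (?Z N (2 * \<epsilon>)) / real N \<le> (real n * B + (real N / real n * c + \<bar>c\<bar>)) / real N"
      by (rule divide_right_mono) simp
    also have "\<dots> = c / real n + (real n * B + \<bar>c\<bar>) / real N" using N n by (simp add: field_simps)
    finally show ?thesis .
  qed
  have "limsup (growth (\<lambda>w. y \<bullet> w) (2 * \<epsilon>)) \<le> limsup (\<lambda>N. ereal (c / real n + (real n * B + \<bar>c\<bar>) / real N))"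
    by (rule Limsup_mono, rule eventually_ge_1) (use main in \<open>simp add: growth_def\<close>)
  also have "\<dots> = ereal (c / real n)"
  proof (rule lim_imp_Limsup)
    have "(\<lambda>N. c / real n + (real n * B + \<bar>c\<bar>) / real N) \<longlonglongrightarrow> c / real n + 0"
      by (intro tendsto_intros lim_const_over_n)
    then show "(\<lambda>N. ereal (c / real n + (real n * B + \<bar>c\<bar>) / real N)) \<longlonglongrightarrow> ereal (c / real n)" by simp
  qed simp
  also have "c / real n = ln (?Z n \<epsilon>) / real n + \<omega>" using n by (simp add: c_def field_simps)
  finally show ?thesis by (simp add: growth_def[abs_def])
qed

text \<open>
  The upper pressure of the linear energy with coefficient vector \<open>y\<close>, as an extended real, because
  its finiteness is known only once strict convexity of the pressure function is assumed.
\<close>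

definition linear_growth :: "real ^ 'd \<Rightarrow> ereal" where
  "linear_growth y = (SUP \<epsilon>\<in>{0<..}. limsup (growth (\<lambda>w. y \<bullet> w) \<epsilon>))"

lemma linear_growth_eq_liminf: "linear_growth y = (SUP \<epsilon>\<in>{0<..}. liminf (growth (\<lambda>w. y \<bullet> w) \<epsilon>))"
proof (rule antisym)
  show "(SUP \<epsilon>\<in>{0<..}. liminf (growth (\<lambda>w. y \<bullet> w) \<epsilon>)) \<le> linear_growth y"
    unfolding linear_growth_def by (intro SUP_mono' Liminf_le_Limsup) simp
  let ?L = "SUP \<epsilon>\<in>{0<..}. liminf (growth (\<lambda>w. y \<bullet> w) \<epsilon>)"
  show "linear_growth y \<le> ?L"
    unfolding linear_growth_def
  proof (rule SUP_least)
    fix \<epsilon> :: real assume "\<epsilon> \<in> {0<..}"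
    then have \<epsilon>: "\<epsilon> > 0" by simp
    show "limsup (growth (\<lambda>w. y \<bullet> w) \<epsilon>) \<le> ?L"
    proof (rule ereal_le_epsilon2)
      fix \<omega> :: real assume \<omega>: "0 < \<omega>"
      have "uniformly_continuous_on (graph T) (\<lambda>p. y \<bullet> \<psi> p)"
        by (intro compact_uniformly_continuous compact_graph continuous_intros cont)
      then obtain d where d: "d > 0" "\<And>p q. p \<in> graph T \<Longrightarrow> q \<in> graph T \<Longrightarrow> dist q p < d \<Longrightarrow> dist (y \<bullet> \<psi> q) (y \<bullet> \<psi> p) < \<omega>"
        unfolding uniformly_continuous_on_def using \<omega> by metis
      define \<delta> where "\<delta> = min (\<epsilon>/2) (d/3)"
      have \<delta>: "\<delta> > 0" "2 * \<delta> \<le> \<epsilon>" "2 * \<delta> < d" using \<epsilon> d(1) by (auto simp: \<delta>_def)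
      have osc: "y \<bullet> \<psi> p \<le> y \<bullet> \<psi> q + \<omega>"
        if "p \<in> graph T" "q \<in> graph T" "dist (fst p) (fst q) \<le> \<delta>" "dist (snd p) (snd q) \<le> \<delta>" for p q
      proof -
        have "dist p q \<le> dist (fst p) (fst q) + dist (snd p) (snd q)"
          unfolding dist_prod_def by (rule sqrt_sum_squares_le_sum) auto
        then have "dist p q < d" using that \<delta>(3) by linarith
        then have "dist (y \<bullet> \<psi> p) (y \<bullet> \<psi> q) < \<omega>" using d(2) that by blast
        then show ?thesis by (simp add: dist_real_def abs_less_iff)
      qed
      have "limsup (growth (\<lambda>w. y \<bullet> w) \<epsilon>) \<le> limsup (growth (\<lambda>w. y \<bullet> w) (2 * \<delta>))"
        by (intro Limsup_mono eventually_ge_1 growth_antimono linear_continuous) (use \<delta> in auto)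
      also have "\<dots> \<le> liminf (\<lambda>n. growth (\<lambda>w. y \<bullet> w) \<delta> n + ereal \<omega>)"
        by (intro Liminf_bounded eventually_ge_1 limsup_growth_linear_le[OF \<delta>(1) _ osc])
      also have "\<dots> = liminf (growth (\<lambda>w. y \<bullet> w) \<delta>) + ereal \<omega>"
        by (rule Liminf_add_ereal_right) auto
      also have "\<dots> \<le> ?L + ereal \<omega>"
        by (intro add_right_mono SUP_upper) (use \<delta> in auto)
      finally show "limsup (growth (\<lambda>w. y \<bullet> w) \<epsilon>) \<le> ?L + ereal \<omega>" .
    qed
  qed
qed

lemma pressure_fun_eq: "pressure_fun T \<psi> y = real_of_ereal (linear_growth y)"
proof -
  note P = pressures_eq_SUP[where E="linear_energy (\<lambda>p. y \<bullet> \<psi> p)" and G="\<lambda>w. y \<bullet> w",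
      OF linear_continuous linear_energy_empirical]
  have "upper_pressure T (linear_energy (\<lambda>p. y \<bullet> \<psi> p)) = linear_growth y"
    "lower_pressure T (linear_energy (\<lambda>p. y \<bullet> \<psi> p)) = linear_growth y"
    using P by (simp_all add: linear_growth_def linear_growth_eq_liminf[unfolded linear_growth_def])
  then have "top_pressure T (linear_energy (\<lambda>p. y \<bullet> \<psi> p)) = linear_growth y"
    unfolding top_pressure_def by auto
  then show ?thesis by (simp add: pressure_fun_def linear_pressure_def)
qed

lemma linear_growth_not_MInf: "linear_growth y \<noteq> -\<infinity>"
proof -
  obtain B where B: "0 \<le> B" "\<And>w. w \<in> value_hull \<Longrightarrow> \<bar>y \<bullet> w\<bar> \<le> B"
    using bounded_on_hull[OF linear_continuous] by blast
  have B': "- B \<le> y \<bullet> w" if "w \<in> value_hull" for w using B(2)[OF that] by linarith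
  have "ereal (- B) \<le> growth (\<lambda>w. y \<bullet> w) 1 n" if n: "n \<ge> 1" for n
  proof -
    have "exp (- (real n * B)) \<le> Z (\<lambda>w. y \<bullet> w) n 1"
      by (rule Z_lower_bound[OF linear_continuous n]) (use B' in auto)
    then have "- (real n * B) \<le> ln (Z (\<lambda>w. y \<bullet> w) n 1)"
      using Z_pos[OF linear_continuous n, of 1] by (simp add: ln_ge_iff)
    then show ?thesis using n by (simp add: growth_def field_simps)
  qed
  then have "ereal (- B) \<le> liminf (growth (\<lambda>w. y \<bullet> w) 1)" by (intro Liminf_bounded eventually_ge_1)
  also have "\<dots> \<le> linear_growth y" unfolding linear_growth_eq_liminf by (rule SUP_upper) simp
  finally show ?thesis by auto
qed

lemma linear_growth_perturb:
  obtains b where "linear_growth y \<le> linear_growth y' + ereal b"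
proof -
  obtain b where b: "0 \<le> b" "\<And>w. w \<in> value_hull \<Longrightarrow> \<bar>(y - y') \<bullet> w\<bar> \<le> b"
    using bounded_on_hull[OF linear_continuous] by blast
  have "growth (\<lambda>w. y \<bullet> w) \<epsilon> n \<le> growth (\<lambda>w. y' \<bullet> w) \<epsilon> n + ereal b" if n: "n \<ge> 1" and \<epsilon>: "\<epsilon> > 0" for n \<epsilon>
  proof -
    have "Z (\<lambda>w. y \<bullet> w) n \<epsilon> \<le> exp (real n * b) * Z (\<lambda>w. y' \<bullet> w) n \<epsilon>"
    proof (rule Z_least)
      fix C assume C: "separated T n \<epsilon> C"
      have "separated_sum (\<lambda>w. y \<bullet> w) n C \<le> exp (real n * b) * separated_sum (\<lambda>w. y' \<bullet> w) n C"
        unfolding separated_sum_def sum_distrib_left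
      proof (rule sum_mono)
        fix x assume "x \<in> C"
        then have "\<bar>(y - y') \<bullet> orbit_average n x\<bar> \<le> b"
          using b(2) orbit_average_in_hull[OF n separated_orbits[OF C]] by blast
        then have "y \<bullet> orbit_average n x \<le> b + y' \<bullet> orbit_average n x" by (simp add: inner_diff_left)
        then have "real n * (y \<bullet> orbit_average n x) \<le> real n * (b + y' \<bullet> orbit_average n x)" by (intro mult_left_mono) auto
        then show "exp (real n * (y \<bullet> orbit_average n x)) \<le> exp (real n * b) * exp (real n * (y' \<bullet> orbit_average n x))"
          by (simp add: distrib_left flip: exp_add)
      qed
      also have "\<dots> \<le> exp (real n * b) * Z (\<lambda>w. y' \<bullet> w) n \<epsilon>"
        by (intro mult_left_mono Z_upper linear_continuous n \<epsilon> C) auto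
      finally show "separated_sum (\<lambda>w. y \<bullet> w) n C \<le> exp (real n * b) * Z (\<lambda>w. y' \<bullet> w) n \<epsilon>" .
    qed
    then have "ln (Z (\<lambda>w. y \<bullet> w) n \<epsilon>) \<le> ln (exp (real n * b) * Z (\<lambda>w. y' \<bullet> w) n \<epsilon>)"
      using Z_pos[OF linear_continuous n \<epsilon>] by (subst ln_le_cancel_iff) auto
    also have "\<dots> = real n * b + ln (Z (\<lambda>w. y' \<bullet> w) n \<epsilon>)"
      using Z_pos[OF linear_continuous n \<epsilon>, of y'] by (simp add: ln_mult)
    finally show ?thesis using n by (simp add: growth_def field_simps)
  qed
  then have "limsup (growth (\<lambda>w. y \<bullet> w) \<epsilon>) \<le> limsup (\<lambda>n. growth (\<lambda>w. y' \<bullet> w) \<epsilon> n + ereal b)" if "\<epsilon> > 0" for \<epsilon>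
    using that by (intro Limsup_mono eventually_ge_1)
  also have "limsup (\<lambda>n. growth (\<lambda>w. y' \<bullet> w) \<epsilon> n + ereal b) = limsup (growth (\<lambda>w. y' \<bullet> w) \<epsilon>) + ereal b" for \<epsilon>
    by (rule Limsup_add_ereal_right) auto
  finally have le: "limsup (growth (\<lambda>w. y \<bullet> w) \<epsilon>) \<le> limsup (growth (\<lambda>w. y' \<bullet> w) \<epsilon>) + ereal b" if "\<epsilon> > 0" for \<epsilon>
    using that .
  have "linear_growth y \<le> linear_growth y' + ereal b"
    unfolding linear_growth_def[of y]
  proof (rule SUP_least)
    fix \<epsilon> :: real assume "\<epsilon> \<in> {0<..}"
    then have \<epsilon>: "\<epsilon> > 0" by simp
    have "limsup (growth (\<lambda>w. y' \<bullet> w) \<epsilon>) \<le> linear_growth y'"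
      unfolding linear_growth_def by (rule SUP_upper) (use \<epsilon> in auto)
    then show "limsup (growth (\<lambda>w. y \<bullet> w) \<epsilon>) \<le> linear_growth y' + ereal b"
      using le[OF \<epsilon>] add_right_mono order_trans by blast
  qed
  then show ?thesis by (rule that)
qed

text \<open>
  If one linear pressure were infinite, then all would be, as the potentials are bounded. The
  real-valued \<^const>\<open>pressure_fun\<close> would then be constant, against strict convexity.
\<close>

lemma linear_growth_finite:
  assumes "strictly_convex_on UNIV (pressure_fun T \<psi>)"
  shows "linear_growth y = ereal (pressure_fun T \<psi> y)"
proof -
  have "linear_growth y \<noteq> \<infinity>"
  proof
    assume inf: "linear_growth y = \<infinity>"
    have "linear_growth y' = \<infinity>" for y'
      using linear_growth_perturb[of y y'] inf by auto
    then have P0: "pressure_fun T \<psi> y' = 0" for y' by (simp add: pressure_fun_eq)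
    obtain b :: "real ^ 'd" where "b \<in> Basis" using nonempty_Basis by blast
    then have "b \<noteq> 0" by auto
    then have "pressure_fun T \<psi> ((1 - 1/2) *\<^sub>R 0 + (1/2) *\<^sub>R b) < (1 - 1/2) * pressure_fun T \<psi> 0 + 1/2 * pressure_fun T \<psi> b"
      using assms[unfolded strictly_convex_on_def, THEN conjunct2, rule_format, of 0 b "1/2"] by simp
    then show False by (simp add: P0)
  qed
  then show ?thesis using linear_growth_not_MInf[of y] by (cases "linear_growth y") (simp_all add: pressure_fun_eq)
qed

section \<open>Bounds for the nonlinear pressure\<close>

text \<open>
  A pointwise bound by finitely many affine functions of the orbit average becomes a bound by
  linear partition sums.
\<close>

lemma separated_sum_le_linear:
  assumes n: "n \<ge> 1" and \<epsilon>: "\<epsilon> > 0" and C: "separated T n \<epsilon> C" and Y: "finite Y"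
    and le: "\<And>x. x \<in> C \<Longrightarrow> \<exists>y\<in>Y. G (orbit_average n x) \<le> a y + y \<bullet> orbit_average n x"
  shows "separated_sum G n C \<le> (\<Sum>y\<in>Y. exp (real n * a y) * Z (\<lambda>w. y \<bullet> w) n \<epsilon>)"
proof -
  have "separated_sum G n C \<le> (\<Sum>x\<in>C. \<Sum>y\<in>Y. exp (real n * a y) * exp (real n * (y \<bullet> orbit_average n x)))"
    unfolding separated_sum_def
  proof (rule sum_mono)
    fix x assume "x \<in> C"
    then obtain y where y: "y \<in> Y" "G (orbit_average n x) \<le> a y + y \<bullet> orbit_average n x" using le by blast
    have "exp (real n * G (orbit_average n x)) \<le> exp (real n * a y) * exp (real n * (y \<bullet> orbit_average n x))"
      using mult_left_mono[OF y(2), of "real n"] by (simp add: distrib_left flip: exp_add)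
    also have "\<dots> \<le> (\<Sum>y\<in>Y. exp (real n * a y) * exp (real n * (y \<bullet> orbit_average n x)))"
      by (rule member_le_sum) (use y Y in auto)
    finally show "exp (real n * G (orbit_average n x)) \<le> \<dots>" .
  qed
  also have "\<dots> = (\<Sum>y\<in>Y. exp (real n * a y) * separated_sum (\<lambda>w. y \<bullet> w) n C)"
    unfolding separated_sum_def sum_distrib_left by (rule sum.swap)
  also have "\<dots> \<le> (\<Sum>y\<in>Y. exp (real n * a y) * Z (\<lambda>w. y \<bullet> w) n \<epsilon>)"
    by (intro sum_mono mult_left_mono Z_upper linear_continuous n \<epsilon> C) auto
  finally show ?thesis .
qed

lemma eventually_Z_linear_le:
  assumes fin: "linear_growth y = ereal p" and "\<epsilon> > 0" "\<eta> > 0"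
  shows "\<forall>\<^sub>F n in sequentially. Z (\<lambda>w. y \<bullet> w) n \<epsilon> \<le> exp (real n * (p + \<eta>))"
proof -
  have "limsup (growth (\<lambda>w. y \<bullet> w) \<epsilon>) \<le> ereal p"
    unfolding fin[symmetric] linear_growth_def by (rule SUP_upper) (use assms in auto)
  also have "\<dots> < ereal (p + \<eta>)" using assms by simp
  finally have "\<forall>\<^sub>F n in sequentially. growth (\<lambda>w. y \<bullet> w) \<epsilon> n < ereal (p + \<eta>)" by (rule Limsup_lessD)
  then show ?thesis using eventually_ge_at_top[of 1]
  proof eventually_elim
    case (elim n)
    then have "ln (Z (\<lambda>w. y \<bullet> w) n \<epsilon>) \<le> real n * (p + \<eta>)" by (simp add: growth_def field_simps)
    then have "exp (ln (Z (\<lambda>w. y \<bullet> w) n \<epsilon>)) \<le> exp (real n * (p + \<eta>))" by simp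
    then show ?case using Z_pos[OF linear_continuous elim(2) \<open>\<epsilon> > 0\<close>] by (simp only: exp_ln)
  qed
qed

lemma eventually_Z_linear_ge:
  assumes fin: "linear_growth y = ereal p" and "\<eta> > 0"
  obtains \<epsilon> where "\<epsilon> > 0" "\<forall>\<^sub>F n in sequentially. exp (real n * (p - \<eta>)) \<le> Z (\<lambda>w. y \<bullet> w) n \<epsilon>"
proof -
  have "ereal (p - \<eta>) < linear_growth y" using assms by simp
  then obtain \<epsilon> where \<epsilon>: "\<epsilon> > 0" "ereal (p - \<eta>) < liminf (growth (\<lambda>w. y \<bullet> w) \<epsilon>)"
    unfolding linear_growth_eq_liminf by (auto simp: less_SUP_iff)
  have "\<forall>\<^sub>F n in sequentially. exp (real n * (p - \<eta>)) \<le> Z (\<lambda>w. y \<bullet> w) n \<epsilon>"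
    using less_LiminfD[OF \<epsilon>(2)] eventually_ge_at_top[of 1]
  proof eventually_elim
    case (elim n)
    then have "real n * (p - \<eta>) \<le> ln (Z (\<lambda>w. y \<bullet> w) n \<epsilon>)" by (simp add: growth_def field_simps)
    then show ?case using Z_pos[OF linear_continuous, of n \<epsilon> y] elim \<epsilon>(1) by (simp add: ln_ge_iff)
  qed
  with \<epsilon>(1) show ?thesis by (rule that)
qed

lemma rotation_energy_pressures:
  assumes "continuous_on value_hull G"
  shows "upper_pressure T (rotation_energy \<psi> G) = (SUP \<epsilon>\<in>{0<..}. limsup (growth G \<epsilon>))"
    and "lower_pressure T (rotation_energy \<psi> G) = (SUP \<epsilon>\<in>{0<..}. liminf (growth G \<epsilon>))"
  by (rule pressures_eq_SUP[OF assms rotation_energy_empirical]; assumption)+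

lemma upper_pressure_le:
  assumes G: "continuous_on value_hull G"
    and fin: "\<And>y. linear_growth y = ereal (P y)"
    and s: "\<And>w. w \<in> value_hull \<Longrightarrow> \<exists>y. P y - y \<bullet> w + G w < s"
  shows "upper_pressure T (rotation_energy \<psi> G) \<le> ereal s"
proof -
  define f where "f y w = s - (P y - y \<bullet> w + G w)" for y w
  have "continuous_on value_hull (f y)" for y unfolding f_def by (intro continuous_intros G)
  moreover have "\<exists>y\<in>UNIV. 0 < f y w" if "w \<in> value_hull" for w using s[OF that] by (auto simp: f_def)
  ultimately obtain Y \<tau> where Y: "finite Y" "Y \<subseteq> UNIV" "0 < \<tau>" "\<And>w. w \<in> value_hull \<Longrightarrow> \<exists>y\<in>Y. \<tau> < f y w"
    using compact_finite_positive_cover[OF compact_value_hull, of UNIV f] by metis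
  have le: "\<exists>y\<in>Y. G w \<le> (s - P y) + y \<bullet> w" if "w \<in> value_hull" for w
    using Y(3) Y(4)[OF that] by (force simp: f_def)
  have ZG: "Z G n \<epsilon> \<le> (\<Sum>y\<in>Y. exp (real n * (s - P y)) * Z (\<lambda>w. y \<bullet> w) n \<epsilon>)" if "n \<ge> 1" "\<epsilon> > 0" for n \<epsilon>
    by (rule Z_least, rule separated_sum_le_linear[OF that _ Y(1)])
       (use le orbit_average_in_hull[OF that(1)] separated_orbits in blast)+
  have "limsup (growth G \<epsilon>) \<le> ereal s" if \<epsilon>: "\<epsilon> > 0" for \<epsilon>
  proof (rule ereal_le_epsilon2)
    fix \<eta> :: real assume \<eta>: "0 < \<eta>"
    have "\<forall>\<^sub>F n in sequentially. \<forall>y\<in>Y. Z (\<lambda>w. y \<bullet> w) n \<epsilon> \<le> exp (real n * (P y + \<eta>/2))"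
      using \<eta> by (intro eventually_ball_finite Y(1) ballI eventually_Z_linear_le[OF fin \<epsilon>]) auto
    moreover have "\<forall>\<^sub>F n in sequentially. ln (1 + real (card Y)) < real n * (\<eta>/2)"
      using \<eta> by real_asymp
    ultimately have "\<forall>\<^sub>F n in sequentially. growth G \<epsilon> n \<le> ereal (s + \<eta>)"
      using eventually_ge_at_top[of 1]
    proof eventually_elim
      case (elim n)
      have "Z G n \<epsilon> \<le> (\<Sum>y\<in>Y. exp (real n * (s - P y)) * Z (\<lambda>w. y \<bullet> w) n \<epsilon>)" by (rule ZG) (use elim \<epsilon> in auto)
      also have "\<dots> \<le> (\<Sum>y\<in>Y. exp (real n * (s - P y)) * exp (real n * (P y + \<eta>/2)))"
        by (intro sum_mono mult_left_mono) (use elim in auto)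
      also have "\<dots> = real (card Y) * exp (real n * (s + \<eta>/2))"
        by (simp add: algebra_simps flip: exp_add)
      also have "\<dots> \<le> (1 + real (card Y)) * exp (real n * (s + \<eta>/2))" by simp
      finally have "ln (Z G n \<epsilon>) \<le> ln ((1 + real (card Y)) * exp (real n * (s + \<eta>/2)))"
        using Z_pos[OF G, of n \<epsilon>] elim \<epsilon> by (subst ln_le_cancel_iff) (auto intro!: mult_pos_pos add_pos_nonneg)
      also have "\<dots> = ln (1 + real (card Y)) + real n * (s + \<eta>/2)"
        by (subst ln_mult) (auto intro!: add_pos_nonneg)
      also have "\<dots> \<le> real n * (s + \<eta>)" using elim(2) by (simp add: algebra_simps)
      finally show ?case using elim by (simp add: growth_def field_simps)
    qed
    then have "limsup (growth G \<epsilon>) \<le> ereal (s + \<eta>)" by (rule Limsup_bounded)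
    then show "limsup (growth G \<epsilon>) \<le> ereal s + ereal \<eta>" by simp
  qed
  then show ?thesis
    unfolding rotation_energy_pressures(1)[OF G] by (intro SUP_least) auto
qed

text \<open>
  The uniqueness hypothesis says that \<open>z\<close> is the only possible subgradient of \<open>P\<close> at \<open>y\<close> inside the
  hull. The averages in \<open>K\<close>, where \<open>G w - y \<bullet> w\<close> is too small, stay away from \<open>z\<close>; their share
  \<open>D\<close> of a nearly optimal separated set \<open>C\<close> is exponentially negligible.
\<close>

lemma lower_pressure_ge:
  assumes G: "continuous_on value_hull G"
    and fin: "\<And>y. linear_growth y = ereal (P y)"
    and z: "z \<in> value_hull"
    and uniq: "\<And>w. w \<in> value_hull \<Longrightarrow> w \<noteq> z \<Longrightarrow> \<exists>y'. P y' < P y + (y' - y) \<bullet> w"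
  shows "ereal (P y - y \<bullet> z + G z) \<le> lower_pressure T (rotation_energy \<psi> G)"
proof (rule ereal_le_epsilon2)
  fix \<eta> :: real assume \<eta>: "0 < \<eta>"
  let ?c = "G z - y \<bullet> z - \<eta>/3"
  define K where "K = {w \<in> value_hull. G w - y \<bullet> w \<le> ?c}"
  have "closedin (top_of_set value_hull) (value_hull \<inter> (\<lambda>w. G w - y \<bullet> w) -` {..?c})"
    by (intro continuous_closedin_preimage continuous_intros G closed_atMost)
  also have "value_hull \<inter> (\<lambda>w. G w - y \<bullet> w) -` {..?c} = K" by (auto simp: K_def)
  finally have K: "compact K" by (rule closedin_compact[OF compact_value_hull])
  define f where "f y' w = P y + (y' - y) \<bullet> w - P y'" for y' w
  have "z \<notin> K" using \<eta> by (simp add: K_def)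
  then have "\<exists>y'\<in>UNIV. 0 < f y' w" if "w \<in> K" for w
  proof -
    have "w \<in> value_hull" "w \<noteq> z" using that \<open>z \<notin> K\<close> by (auto simp: K_def)
    then show ?thesis using uniq[of w] by (auto simp: f_def)
  qed
  moreover have "continuous_on K (f y')" for y' unfolding f_def by (intro continuous_intros)
  ultimately obtain Y \<tau> where Y: "finite Y" "Y \<subseteq> UNIV" "0 < \<tau>" "\<And>w. w \<in> K \<Longrightarrow> \<exists>y'\<in>Y. \<tau> < f y' w"
    using compact_finite_positive_cover[OF K, of UNIV f] by metis
  \<comment> \<open>\<open>\<delta> \<le> \<tau>/4\<close> leaves a gap of at least \<open>\<tau>/4\<close> between the rate \<open>P y - \<delta>\<close> of the whole sum
      and the bound \<open>P y - \<tau>/2\<close> for the rate of its part over \<open>K\<close>\<close>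
  define \<delta> where "\<delta> = min (\<tau>/4) (\<eta>/3)"
  have \<delta>: "0 < \<delta>" "\<delta> \<le> \<tau>/4" "\<delta> \<le> \<eta>/3" using Y(3) \<eta> by (auto simp: \<delta>_def)
  obtain \<epsilon> where \<epsilon>: "\<epsilon> > 0" "\<forall>\<^sub>F n in sequentially. exp (real n * (P y - \<delta>)) \<le> Z (\<lambda>w. y \<bullet> w) n \<epsilon>"
    using eventually_Z_linear_ge[OF fin \<delta>(1)] by blast
  have "\<forall>\<^sub>F n in sequentially. \<forall>y'\<in>Y. Z (\<lambda>w. y' \<bullet> w) n \<epsilon> \<le> exp (real n * (P y' + \<tau>/2))"
    using Y(3) by (intro eventually_ball_finite Y(1) ballI eventually_Z_linear_le[OF fin \<epsilon>(1)]) auto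
  moreover have "\<forall>\<^sub>F n in sequentially. real (card Y) * exp (- (real n * (\<tau>/4))) < 1/4"
    using Y(3) by real_asymp
  moreover have "\<forall>\<^sub>F n in sequentially. ln 4 < real n * (\<eta>/3)" using \<eta> by real_asymp
  ultimately have "\<forall>\<^sub>F n in sequentially. ereal (P y - y \<bullet> z + G z - \<eta>) \<le> growth G \<epsilon> n"
    using \<epsilon>(2) eventually_ge_at_top[of 1]
  proof eventually_elim
    case (elim n)
    let ?S = "separated_sum (\<lambda>w. y \<bullet> w) n" and ?e = "exp (real n * (P y - \<delta>))"
    have n: "n \<ge> 1" by fact
    have "?e / 2 < Z (\<lambda>w. y \<bullet> w) n \<epsilon>" using elim(4) exp_gt_zero[of "real n * (P y - \<delta>)"] by linarith
    then obtain C where C: "separated T n \<epsilon> C" "?e / 2 < ?S C" by (rule Z_less_obtain)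
    define D where "D = {x \<in> C. orbit_average n x \<in> K}"
    have finC: "finite C" by (rule separated_finite[OF \<epsilon>(1) C(1)])
    have "separated T n \<epsilon> D" by (rule separated_subset[OF C(1)]) (auto simp: D_def)
    then have "?S D \<le> (\<Sum>y'\<in>Y. exp (real n * (P y - P y' - \<tau>)) * Z (\<lambda>w. y' \<bullet> w) n \<epsilon>)"
    proof (rule separated_sum_le_linear[OF n \<epsilon>(1) _ Y(1)])
      fix x assume "x \<in> D"
      then obtain y' where "y' \<in> Y" "\<tau> < f y' (orbit_average n x)" using Y(4) by (auto simp: D_def)
      then show "\<exists>y'\<in>Y. y \<bullet> orbit_average n x \<le> P y - P y' - \<tau> + y' \<bullet> orbit_average n x"
        by (intro bexI[of _ y']) (auto simp: f_def inner_diff_left)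
    qed
    also have "\<dots> \<le> (\<Sum>y'\<in>Y. exp (real n * (P y - P y' - \<tau>)) * exp (real n * (P y' + \<tau>/2)))"
      by (intro sum_mono mult_left_mono) (use elim in auto)
    also have "\<dots> = real (card Y) * exp (real n * (P y - \<tau>/2))"
      by (simp add: algebra_simps flip: exp_add)
    also have "\<dots> \<le> real (card Y) * (?e * exp (- (real n * (\<tau>/4))))"
    proof -
      have "real n * (P y - \<tau>/2) \<le> real n * (P y - \<delta> - \<tau>/4)" using \<delta> by (intro mult_left_mono) auto
      then show ?thesis by (intro mult_left_mono) (auto simp: algebra_simps simp flip: exp_add)
    qed
    also have "\<dots> = ?e * (real (card Y) * exp (- (real n * (\<tau>/4))))" by simp
    also have "\<dots> \<le> ?e * (1/4)" using elim(2) by (intro mult_left_mono) auto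
    finally have SD: "?S D \<le> ?e / 4" by simp
    have "?S C = ?S D + ?S (C - D)"
      unfolding separated_sum_def using finC by (subst sum.subset_diff[of D C]) (auto simp: D_def)
    then have CD: "?e / 4 \<le> ?S (C - D)" using SD C(2) by linarith
    have sepCD: "separated T n \<epsilon> (C - D)" by (rule separated_subset[OF C(1)]) auto
    have "exp (real n * ?c) * ?S (C - D) \<le> separated_sum G n (C - D)"
      unfolding separated_sum_def sum_distrib_left
    proof (rule sum_mono)
      fix x assume x: "x \<in> C - D"
      then have "orbit_average n x \<in> value_hull"
        using orbit_average_in_hull[OF n] separated_orbits[OF C(1)] by blast
      then have "?c + y \<bullet> orbit_average n x \<le> G (orbit_average n x)"
        using x by (auto simp: D_def K_def)
      then have "real n * (?c + y \<bullet> orbit_average n x) \<le> real n * G (orbit_average n x)" by (intro mult_left_mono) auto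
      then show "exp (real n * ?c) * exp (real n * (y \<bullet> orbit_average n x)) \<le> exp (real n * G (orbit_average n x))"
        by (simp add: distrib_left flip: exp_add)
    qed
    also have "\<dots> \<le> Z G n \<epsilon>" by (rule Z_upper[OF G n \<epsilon>(1) sepCD])
    finally have "exp (real n * ?c) * ?S (C - D) \<le> Z G n \<epsilon>" .
    then have "exp (real n * ?c) * (?e / 4) \<le> Z G n \<epsilon>"
      by (rule order.trans[OF mult_left_mono[OF CD exp_ge_zero]])
    then have "ln (exp (real n * ?c) * (?e / 4)) \<le> ln (Z G n \<epsilon>)"
      using Z_pos[OF G n \<epsilon>(1)] by (subst ln_le_cancel_iff) auto
    also have "ln (exp (real n * ?c) * (?e / 4)) = real n * ?c + real n * (P y - \<delta>) - ln 4"
      by (simp add: ln_mult ln_div)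
    finally have "real n * ?c + real n * (P y - \<delta>) - real n * (\<eta>/3) \<le> ln (Z G n \<epsilon>)" using elim(3) by linarith
    moreover have "real n * (P y - y \<bullet> z + G z - \<eta>) \<le> real n * (?c + (P y - \<delta>) - \<eta>/3)"
      using \<delta>(3) by (intro mult_left_mono) auto
    ultimately have "real n * (P y - y \<bullet> z + G z - \<eta>) \<le> ln (Z G n \<epsilon>)"
      unfolding distrib_left right_diff_distrib by linarith
    then show ?case using n by (simp add: growth_def field_simps)
  qed
  then have "ereal (P y - y \<bullet> z + G z - \<eta>) \<le> liminf (growth G \<epsilon>)" by (rule Liminf_bounded)
  also have "\<dots> \<le> lower_pressure T (rotation_energy \<psi> G)"
    unfolding rotation_energy_pressures(2)[OF G] by (rule SUP_upper) (use \<epsilon>(1) in auto)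
  finally have "ereal (P y - y \<bullet> z + G z - \<eta>) + ereal \<eta> \<le> lower_pressure T (rotation_energy \<psi> G) + ereal \<eta>"
    by (rule add_right_mono)
  then show "ereal (P y - y \<bullet> z + G z) \<le> lower_pressure T (rotation_energy \<psi> G) + ereal \<eta>" by simp
qed

lemma lower_pressure_le_upper_pressure:
  assumes G: "continuous_on value_hull G"
  shows "lower_pressure T (rotation_energy \<psi> G) \<le> upper_pressure T (rotation_energy \<psi> G)"
  unfolding rotation_energy_pressures[OF G]
  by (intro SUP_mono' Liminf_le_Limsup) simp

end

section \<open>Equilibrium pairs\<close>

lemma rotation_maximizers_iff:
  "z \<in> rotation_maximizers T \<psi> F \<longleftrightarrow> z \<in> rotation_set T \<psi> \<and>
     (\<forall>w\<in>rotation_set T \<psi>. local_entropy T \<psi> w + ereal (F w) \<le> local_entropy T \<psi> z + ereal (F z))"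
  unfolding rotation_maximizers_def is_arg_max_def by (auto simp: not_less)

lemma kernel_entropy_le_local_entropy:
  assumes "(\<mu>, Q) \<in> stationary_pairs T"
  shows "kernel_entropy \<mu> Q \<le> local_entropy T \<psi> (rotation_vector T \<psi> (\<mu>, Q))"
  unfolding local_entropy_def
  by (rule SUP_upper2[of "(\<mu>, Q)"]) (use assms in auto)

text \<open>
  Maximizing over pairs amounts to maximizing over rotation vectors, and then over the pairs with
  a given rotation vector.
\<close>

lemma equilibrium_pairs_iff:
  assumes E: "\<And>\<mu> Q. (\<mu>, Q) \<in> stationary_pairs T \<Longrightarrow> E (pair_law T \<mu> Q) = F (rotation_vector T \<psi> (\<mu>, Q))"
    and fin: "\<And>z. z \<in> rotation_set T \<psi> \<Longrightarrow> \<bar>local_entropy T \<psi> z\<bar> \<noteq> \<infinity>"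
  shows "(\<mu>, Q) \<in> equilibrium_pairs T E \<longleftrightarrow> (\<mu>, Q) \<in> stationary_pairs T \<and>
     rotation_vector T \<psi> (\<mu>, Q) \<in> rotation_maximizers T \<psi> F \<and>
     kernel_entropy \<mu> Q = local_entropy T \<psi> (rotation_vector T \<psi> (\<mu>, Q))"
    (is "?L \<longleftrightarrow> ?R")
proof -
  let ?h = "local_entropy T \<psi>" and ?\<rho> = "rotation_vector T \<psi>"
  have L: "?L \<longleftrightarrow> (\<mu>, Q) \<in> stationary_pairs T \<and>
      (\<forall>\<mu>' Q'. (\<mu>', Q') \<in> stationary_pairs T \<longrightarrow>
        kernel_entropy \<mu>' Q' + ereal (F (?\<rho> (\<mu>', Q'))) \<le> kernel_entropy \<mu> Q + ereal (F (?\<rho> (\<mu>, Q))))"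
    unfolding equilibrium_pairs_def is_arg_max_def using E by (auto simp: not_less)
  have in_R: "?\<rho> (\<mu>', Q') \<in> rotation_set T \<psi>" if "(\<mu>', Q') \<in> stationary_pairs T" for \<mu>' Q'
    using that unfolding rotation_set_def by (rule imageI)
  show ?thesis
  proof
    assume ?L
    then have st: "(\<mu>, Q) \<in> stationary_pairs T"
      and max: "\<And>\<mu>' Q'. (\<mu>', Q') \<in> stationary_pairs T \<Longrightarrow>
        kernel_entropy \<mu>' Q' + ereal (F (?\<rho> (\<mu>', Q'))) \<le> kernel_entropy \<mu> Q + ereal (F (?\<rho> (\<mu>, Q)))"
      using L by auto
    have le: "?h w + ereal (F w) \<le> kernel_entropy \<mu> Q + ereal (F (?\<rho> (\<mu>, Q)))"
      if w: "w \<in> rotation_set T \<psi>" for w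
    proof -
      have "?h w \<le> kernel_entropy \<mu> Q + ereal (F (?\<rho> (\<mu>, Q))) - ereal (F w)"
        unfolding local_entropy_def
      proof (rule SUP_least, clarify)
        fix \<mu>' Q' assume "(\<mu>', Q') \<in> stationary_pairs T" "w = ?\<rho> (\<mu>', Q')"
        then show "kernel_entropy \<mu>' Q' \<le> kernel_entropy \<mu> Q + ereal (F (?\<rho> (\<mu>, Q))) - ereal (F (?\<rho> (\<mu>', Q')))"
          using max[of \<mu>' Q'] by (simp add: ereal_le_minus)
      qed
      then show ?thesis by (simp add: ereal_le_minus)
    qed
    note ke = kernel_entropy_le_local_entropy[OF st, of \<psi>]
    have "?h (?\<rho> (\<mu>, Q)) \<le> kernel_entropy \<mu> Q"
      using le[OF in_R[OF st]] by (simp add: ereal_add_le_add_iff2)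
    then have eq: "kernel_entropy \<mu> Q = ?h (?\<rho> (\<mu>, Q))" using ke by simp
    show ?R using st eq le in_R[OF st] by (simp add: rotation_maximizers_iff)
  next
    assume R: ?R
    have "kernel_entropy \<mu>' Q' + ereal (F (?\<rho> (\<mu>', Q'))) \<le> kernel_entropy \<mu> Q + ereal (F (?\<rho> (\<mu>, Q)))"
      if st: "(\<mu>', Q') \<in> stationary_pairs T" for \<mu>' Q'
    proof -
      have "kernel_entropy \<mu>' Q' + ereal (F (?\<rho> (\<mu>', Q'))) \<le> ?h (?\<rho> (\<mu>', Q')) + ereal (F (?\<rho> (\<mu>', Q')))"
        by (intro add_right_mono kernel_entropy_le_local_entropy st)
      also have "\<dots> \<le> ?h (?\<rho> (\<mu>, Q)) + ereal (F (?\<rho> (\<mu>, Q)))"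
        using R in_R[OF st] by (auto simp: rotation_maximizers_iff)
      finally show ?thesis using R by simp
    qed
    then show ?L using L R by blast
  qed
qed

context compact_correspondence
begin

lemma linear_energy_pair_law:
  assumes "(\<mu>, Q) \<in> stationary_pairs T"
  shows "linear_energy (\<lambda>p. y \<bullet> \<psi> p) (pair_law T \<mu> Q) = y \<bullet> rotation_vector T \<psi> (\<mu>, Q)"
proof -
  note J = stationary_pair_joint_law[OF assms]
  have G: "graph T \<in> sets (joint_law \<mu> Q)" using closed_graph J(2) by auto
  have "integrable (joint_law \<mu> Q) (\<lambda>p. indicator (graph T) p *\<^sub>R \<psi>_ext p)"
    by (rule integrable_mult_indicator[OF G integrable_continuous[OF J(1,2) \<psi>_ext(1)]])
  also have "(\<lambda>p. indicator (graph T) p *\<^sub>R \<psi>_ext p) = (\<lambda>p. indicator (graph T) p *\<^sub>R \<psi> p)"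
    by (rule ext) (auto simp: indicator_def \<psi>_ext(2))
  finally have "integrable (pair_law T \<mu> Q) \<psi>"
    unfolding pair_law_def joint_law_def[symmetric] using G by (subst integrable_restrict_space) auto
  then show ?thesis by (simp add: linear_energy_def rotation_vector_def)
qed

end

theorem theoremC:
  fixes T :: "'a::polish_space \<Rightarrow> 'a set"
    and \<psi> :: "'a \<times> 'a \<Rightarrow> real ^ 'd"
    and U :: "(real ^ 'd) set"
    and F :: "real ^ 'd \<Rightarrow> real"
  assumes "compact (UNIV :: 'a set)"
    and "correspondence T"
    and "forward_expansive T"
    and "continuous_on (graph T) \<psi>"
    and "C1_legendre T \<psi>"
    and "open U"
    and "convex hull (\<psi> ` graph T) \<subseteq> U"
    and "C1_on U F"
    and "abundance_ergodic T (rotation_energy \<psi> F)"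
    and "rotation_maximizers T \<psi> F \<subseteq> interior (rotation_set T \<psi>)"
  shows "rotation_maximizers T \<psi> F \<noteq> {} \<and>
     upper_pressure T (rotation_energy \<psi> F) = lower_pressure T (rotation_energy \<psi> F) \<and>
     top_pressure T (rotation_energy \<psi> F)
       = (SUP z\<in>rotation_set T \<psi>. local_entropy T \<psi> z + ereal (F z)) \<and>
     equilibrium_pairs T (rotation_energy \<psi> F)
       = (\<Union>y \<in> gradient (pressure_fun T \<psi>) -` rotation_maximizers T \<psi> F.
            linear_equilibrium_pairs T (\<lambda>p. y \<bullet> \<psi> p)) \<and>
     (\<forall>y \<in> gradient (pressure_fun T \<psi>) -` rotation_maximizers T \<psi> F.
        y = gradient F (gradient (pressure_fun T \<psi>) y))"
proof -
  interpret compact_correspondence T \<psi> by standard fact+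
  define R where "R = rotation_set T \<psi>"
  define h where "h = local_entropy T \<psi>"
  define P where "P = pressure_fun T \<psi>"
  define H where "H z = real_of_ereal (h z)" for z
  have "interior R \<noteq> {}" and h_fin: "\<And>z. z \<in> R \<Longrightarrow> \<bar>h z\<bar> \<noteq> \<infinity>"
    and H_C1: "C1_on (interior R) H"
    and P_C1: "C1_on UNIV P" and P_conv: "strictly_convex_on UNIV P"
    and homeo: "\<exists>G. homeomorphism UNIV (interior R) (gradient P) G"
    and h_INF: "\<And>z. z \<in> R \<Longrightarrow> h z = (INF y. ereal (P y - y \<bullet> z))"
    using assms(5) unfolding C1_legendre_def Let_def R_def h_def P_def H_def by auto
  have range_P: "range (gradient P) = interior R" using homeo by (auto simp: homeomorphism_def)
  have gP: "GDERIV P y :> gradient P y" for y by (rule C1_onD[OF P_C1]) simp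
  have cR: "compact R" and clR: "closed R" and R_hull: "R \<subseteq> value_hull"
    using compact_rotation_set closed_rotation_set rotation_set_subset_hull by (auto simp: R_def)
  have hull_U: "value_hull \<subseteq> U" using assms(7) by (simp add: value_hull_def)
  have contF: "continuous_on value_hull F"
    using C1_on_imp_continuous_on[OF assms(8)] hull_U continuous_on_subset by blast
  have fin: "linear_growth y = ereal (P y)" for y
    using linear_growth_finite P_conv by (simp add: P_def)
  have h_H: "h z = ereal (H z)" if "z \<in> R" for z
    using h_fin[OF that] by (simp add: H_def ereal_real)
  have H_le: "H z \<le> P y - y \<bullet> z" if "z \<in> R" for z y
  proof -
    have "h z \<le> ereal (P y - y \<bullet> z)" unfolding h_INF[OF that] by (rule INF_lower) simp
    then show ?thesis using h_H[OF that] by simp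
  qed
  have H_ex: "\<exists>y. P y - y \<bullet> z < c" if "z \<in> R" "H z < c" for z c
  proof -
    have "(INF y. ereal (P y - y \<bullet> z)) < ereal c" using that h_H h_INF by simp
    then show ?thesis by (auto simp: INF_less_iff)
  qed
  have tangent: "P y - y \<bullet> gradient P y \<le> P y' - y' \<bullet> gradient P y" for y y'
    using strictly_convex_above_tangent[OF P_conv gP[of y], of y'] by (simp add: inner_diff_left)
  have grad_R: "gradient P y \<in> R" "gradient P y \<in> interior R" for y
    using range_P interior_subset by blast+
  have H_grad: "H (gradient P y) = P y - y \<bullet> gradient P y" for y
  proof (rule antisym)
    show "H (gradient P y) \<le> P y - y \<bullet> gradient P y" by (rule H_le[OF grad_R(1)])
    show "P y - y \<bullet> gradient P y \<le> H (gradient P y)"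
      using H_ex[OF grad_R(1), of y] tangent[of y] by (meson not_le)
  qed
  have max_iff: "z \<in> rotation_maximizers T \<psi> G \<longleftrightarrow> z \<in> R \<and> (\<forall>w\<in>R. H w + G w \<le> H z + G z)" for G z
  proof -
    have "h w + ereal (G w) \<le> h z + ereal (G z) \<longleftrightarrow> H w + G w \<le> H z + G z" if "w \<in> R" "z \<in> R" for w
      using that by (simp add: h_H)
    then show ?thesis unfolding rotation_maximizers_iff R_def[symmetric] h_def[symmetric] by blast
  qed

  \<comment> \<open>Without a maximizer, finitely many values \<open>H w + F w\<close> would strictly dominate all of \<open>R\<close>,
      including the point where the largest of them is taken.\<close>
  have V_ne: "rotation_maximizers T \<psi> F \<noteq> {}"
  proof (rule ccontr)
    assume "\<not> ?thesis"
    then have none: "\<exists>w\<in>R. H z + F z < H w + F w" if "z \<in> R" for z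
      using max_iff[of z F] that by (auto simp: not_le)
    define f where "f i v = H (snd i) + F (snd i) - (P (fst i) - fst i \<bullet> v + F v)" for i v
    have "\<exists>i\<in>UNIV \<times> R. 0 < f i v" if v: "v \<in> R" for v
    proof -
      obtain w where w: "w \<in> R" "H v + F v < H w + F w" using none[OF v] by blast
      then obtain y where "P y - y \<bullet> v < H w + F w - F v" using H_ex[OF v, of "H w + F w - F v"] by auto
      then show ?thesis using w(1) by (intro bexI[of _ "(y, w)"]) (auto simp: f_def)
    qed
    moreover have "continuous_on R (f i)" for i
      unfolding f_def by (intro continuous_intros continuous_on_subset[OF contF R_hull])
    ultimately obtain J \<tau> where J: "finite J" "J \<subseteq> UNIV \<times> R" "0 < \<tau>" "\<And>v. v \<in> R \<Longrightarrow> \<exists>i\<in>J. \<tau> < f i v"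
      using compact_finite_positive_cover[OF cR, of "UNIV \<times> R" f] by metis
    have "R \<noteq> {}" using \<open>interior R \<noteq> {}\<close> interior_subset by blast
    then have "J \<noteq> {}" using J(4) by blast
    let ?val = "\<lambda>i. H (snd i) + F (snd i)"
    obtain i0 where i0: "i0 \<in> J" "\<And>i. i \<in> J \<Longrightarrow> ?val i \<le> ?val i0"
    proof -
      have "Max (?val ` J) \<in> ?val ` J" using J(1) \<open>J \<noteq> {}\<close> by (intro Max_in) auto
      then obtain i0 where "i0 \<in> J" "Max (?val ` J) = ?val i0" by blast
      moreover have "?val i \<le> Max (?val ` J)" if "i \<in> J" for i using J(1) that by (intro Max_ge) auto
      ultimately show thesis by (intro that[of i0]) auto
    qed
    have "snd i0 \<in> R" using i0(1) J(2) by auto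
    then obtain i where i: "i \<in> J" "\<tau> < f i (snd i0)" using J(4) by blast
    have "H (snd i0) \<le> P (fst i) - fst i \<bullet> snd i0" by (rule H_le) fact
    then show False using i(2) J(3) i0(2)[OF i(1)] by (simp add: f_def)
  qed
  then obtain z where z: "z \<in> rotation_maximizers T \<psi> F" by blast
  then have zR: "z \<in> R" and z_max: "\<And>w. w \<in> R \<Longrightarrow> H w + F w \<le> H z + F z" using max_iff by auto
  have V_int: "w \<in> range (gradient P)" if "w \<in> rotation_maximizers T \<psi> F" for w
    using assms(10) that range_P by (auto simp: R_def)
  then obtain y0 where y0: "z = gradient P y0" using z by blast

  let ?s = "H z + F z"
  have upper: "upper_pressure T (rotation_energy \<psi> F) \<le> ereal ?s"
  proof (rule ereal_le_epsilon2)
    fix \<eta> :: real assume \<eta>: "0 < \<eta>"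
    have "\<exists>y. P y - y \<bullet> w + F w < ?s + \<eta>" if w: "w \<in> value_hull" for w
    proof (cases "w \<in> R")
      case True
      then have "H w < ?s + \<eta> - F w" using z_max[of w] \<eta> by simp
      then obtain y where "P y - y \<bullet> w < ?s + \<eta> - F w" using H_ex[OF True] by blast
      then show ?thesis by (intro exI[of _ y]) simp
    next
      case False
      have "closure (range (gradient P)) \<subseteq> R"
        unfolding range_P by (rule closure_minimal[OF interior_subset clR])
      then have "w \<notin> closure (range (gradient P))" using False by blast
      then have "\<not> (\<forall>y. ?s + \<eta> - F w \<le> P y - y \<bullet> w)"
        using closure_range_gradient[of P "gradient P" "?s + \<eta> - F w" w] gP by blast
      then obtain y where "P y - y \<bullet> w < ?s + \<eta> - F w" unfolding not_all not_le ..
      then show ?thesis by (intro exI[of _ y]) simp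
    qed
    then have "upper_pressure T (rotation_energy \<psi> F) \<le> ereal (?s + \<eta>)"
      by (rule upper_pressure_le[OF contF fin])
    then show "upper_pressure T (rotation_energy \<psi> F) \<le> ereal ?s + ereal \<eta>" by simp
  qed
  have lower: "ereal ?s \<le> lower_pressure T (rotation_energy \<psi> F)"
  proof -
    have "\<exists>y'. P y' < P y0 + (y' - y0) \<bullet> w" if "w \<noteq> z" for w
    proof (rule ccontr)
      assume "\<not> ?thesis"
      then have "P y0 - y0 \<bullet> w \<le> P y' - y' \<bullet> w" for y'
        by (auto simp: not_less inner_diff_left dest: spec[of _ y'])
      then have "gradient P y0 = w" by (rule gradient_eq_of_global_min[OF gP])
      then show False using that y0 by simp
    qed
    then have "ereal (P y0 - y0 \<bullet> z + F z) \<le> lower_pressure T (rotation_energy \<psi> F)"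
      using zR R_hull by (intro lower_pressure_ge[OF contF fin]) auto
    then show ?thesis using H_grad[of y0] y0 by simp
  qed
  have up_s: "upper_pressure T (rotation_energy \<psi> F) = ereal ?s" and lo_s: "lower_pressure T (rotation_energy \<psi> F) = ereal ?s"
    using upper lower lower_pressure_le_upper_pressure[OF contF] by (auto intro: antisym)
  have top_s: "top_pressure T (rotation_energy \<psi> F) = ereal ?s"
    unfolding top_pressure_def using up_s lo_s by auto
  have sup_s: "(SUP z\<in>R. h z + ereal (F z)) = ereal ?s"
  proof (rule antisym)
    show "(SUP z\<in>R. h z + ereal (F z)) \<le> ereal ?s"
      by (rule SUP_least) (simp add: h_H z_max)
    show "ereal ?s \<le> (SUP z\<in>R. h z + ereal (F z))"
      by (rule SUP_upper2[OF zR]) (simp add: h_H zR)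
  qed

  \<comment> \<open>A maximizer of \<open>h + y \<bullet> w\<close> is a point where \<open>y\<close> minimizes \<open>P y' - y' \<bullet> w\<close>.\<close>
  have lin_max: "rotation_maximizers T \<psi> (\<lambda>w. y \<bullet> w) = {gradient P y}" for y
  proof (intro equalityI subsetI)
    fix w assume "w \<in> rotation_maximizers T \<psi> (\<lambda>w. y \<bullet> w)"
    then have w: "w \<in> R" "H (gradient P y) + y \<bullet> gradient P y \<le> H w + y \<bullet> w"
      using max_iff[of w "\<lambda>w. y \<bullet> w"] grad_R(1) by auto
    then have "P y - y \<bullet> w \<le> P y' - y' \<bullet> w" for y' using H_grad[of y] H_le[OF w(1), of y'] by simp
    then have "gradient P y = w" by (rule gradient_eq_of_global_min[OF gP])
    then show "w \<in> {gradient P y}" by simp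
  next
    fix w assume "w \<in> {gradient P y}"
    then have w: "w = gradient P y" by simp
    have "H v + y \<bullet> v \<le> H w + y \<bullet> w" if "v \<in> R" for v
      using H_le[OF that, of y] H_grad[of y] w by simp
    then show "w \<in> rotation_maximizers T \<psi> (\<lambda>w. y \<bullet> w)" using max_iff[of w "\<lambda>w. y \<bullet> w"] grad_R(1) w by simp
  qed
  have fin_h: "\<bar>local_entropy T \<psi> z\<bar> \<noteq> \<infinity>" if "z \<in> rotation_set T \<psi>" for z
    using h_fin that by (simp add: R_def h_def)
  have nl: "(\<mu>, Q) \<in> equilibrium_pairs T (rotation_energy \<psi> F) \<longleftrightarrow> (\<mu>, Q) \<in> stationary_pairs T \<and>
     rotation_vector T \<psi> (\<mu>, Q) \<in> rotation_maximizers T \<psi> F \<and>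
     kernel_entropy \<mu> Q = local_entropy T \<psi> (rotation_vector T \<psi> (\<mu>, Q))" for \<mu> Q
    by (rule equilibrium_pairs_iff[OF _ fin_h]) (auto simp: rotation_energy_def rotation_vector_def)
  have li: "(\<mu>, Q) \<in> linear_equilibrium_pairs T (\<lambda>p. y \<bullet> \<psi> p) \<longleftrightarrow> (\<mu>, Q) \<in> stationary_pairs T \<and>
     rotation_vector T \<psi> (\<mu>, Q) = gradient P y \<and>
     kernel_entropy \<mu> Q = local_entropy T \<psi> (rotation_vector T \<psi> (\<mu>, Q))" for \<mu> Q y
    unfolding linear_equilibrium_pairs_def
    using equilibrium_pairs_iff[where E="linear_energy (\<lambda>p. y \<bullet> \<psi> p)" and F="\<lambda>w. y \<bullet> w" and \<psi>=\<psi> and T=T and \<mu>=\<mu> and Q=Q, OF linear_energy_pair_law fin_h]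
    by (simp add: lin_max)
  have eq: "equilibrium_pairs T (rotation_energy \<psi> F)
       = (\<Union>y \<in> gradient P -` rotation_maximizers T \<psi> F. linear_equilibrium_pairs T (\<lambda>p. y \<bullet> \<psi> p))"
  proof (intro set_eqI)
    fix p :: "'a measure \<times> ('a \<Rightarrow> 'a measure)"
    obtain \<mu> Q where p: "p = (\<mu>, Q)" by (cases p)
    show "p \<in> equilibrium_pairs T (rotation_energy \<psi> F) \<longleftrightarrow>
        p \<in> (\<Union>y \<in> gradient P -` rotation_maximizers T \<psi> F. linear_equilibrium_pairs T (\<lambda>p. y \<bullet> \<psi> p))"
      unfolding p UN_iff nl li using V_int[of "rotation_vector T \<psi> (\<mu>, Q)"] by force
  qed

  have crit: "y = gradient F (gradient P y)" if y: "gradient P y \<in> rotation_maximizers T \<psi> F" for y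
  proof -
    let ?z = "gradient P y"
    have gH: "GDERIV H ?z :> gradient H ?z" by (rule C1_onD[OF H_C1 grad_R(2)])
    have gF: "GDERIV F ?z :> gradient F ?z"
      by (rule C1_onD[OF assms(8)]) (use grad_R(1) R_hull hull_U in blast)
    have nearR: "eventually (\<lambda>w. w \<in> R) (at ?z)"
      using eventually_at_in_open'[OF open_interior grad_R(2)[of y]]
      by (rule eventually_mono) (use interior_subset in blast)
    \<comment> \<open>\<open>H w \<le> P y - w \<bullet> y\<close> with equality at \<open>\<nabla>P y\<close>, so the derivative of \<open>H\<close> there is \<open>- y\<close>\<close>
    have "GDERIV (\<lambda>w. (P y - w \<bullet> y) - H w) ?z :> (0 - y) - gradient H ?z"
      by (intro GDERIV_diff GDERIV_const GDERIV_inner gH)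
    moreover have "eventually (\<lambda>w. (P y - ?z \<bullet> y) - H ?z \<le> (P y - w \<bullet> y) - H w) (at ?z)"
      using nearR by (rule eventually_mono) (use H_le H_grad[of y] in \<open>simp add: inner_commute\<close>)
    ultimately have "(0 - y) - gradient H ?z = 0" by (rule GDERIV_local_min)
    moreover have "- (gradient H ?z + gradient F ?z) = 0"
    proof (rule GDERIV_local_min)
      show "GDERIV (\<lambda>w. - (H w + F w)) ?z :> - (gradient H ?z + gradient F ?z)"
        by (intro GDERIV_minus GDERIV_add gH gF)
      show "eventually (\<lambda>w. - (H ?z + F ?z) \<le> - (H w + F w)) (at ?z)"
        using nearR by (rule eventually_mono) (use y max_iff in auto)
    qed
    ultimately have "- y = gradient H ?z" "- gradient F ?z = gradient H ?z" by (simp_all add: algebra_simps)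
    then show ?thesis by (metis neg_equal_iff_equal)
  qed
  show ?thesis
    using V_ne up_s lo_s top_s sup_s eq crit unfolding R_def h_def P_def by auto
qed

end
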